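(* Let $I$ be a finite set, fix non-zero complex numbers $\beta_i$, $i\in I$, and let $\mathbb P$ be a Bernoulli measure on $\Omega=I^{\mathbb N}$. Then there exists a Borel set $\mathcal G\subset\Omega\times\mathbb D$ such that: (i) for $\mathbb P$-a.e. $\omega\in\Omega$, $\dim_H\{\lambda\in\mathbb D_*:(\omega,\lambda)\notin\mathcal G\}\le1$; (ii) if $(\omega,\lambda)\in\mathcal G$ and $\Sigma=((\Phi^{(i)})_{i\in I},(p_i)_{i\in I},\mathbb P)$ is any non-degenerate planar model with selection measure $\mathbb P$ such that the linear part of the maps in $\Phi^{(i)}$ is $\lambda^{\beta_i}$ with $|\lambda^{\beta_i}|<1$ for each $i$, then $\eta^{(\omega)}\in\mathcal D_2$.
   Context: $\mathbb D$ is the open unit disc, $\mathbb D_*=\mathbb D\setminus\{0\}$; $\lambda^\beta:=e^{\beta\log\lambda}$ with $\log$ the principal branch (imaginary part in $(-\pi,\pi]$). A planar model $\Sigma=((\Phi^{(i)})_{i\in I},(p_i)_{i\in I},\mathbb P)$: for each $i\in I$, $\Phi^{(i)}=(f^{(i)}_1,\dots,f^{(i)}_{k_i})$ with $f^{(i)}_j(z)=\lambda_i z+t^{(i)}_j$, $0<|\lambda_i|<1$; $p_i$ a probability vector with positive entries; $\mathbb P$ a probability on $\Omega=I^{\mathbb N}$. The random measure $\eta^{(\omega)}$ is the law of $\sum_{n\ge1}(\prod_{j=1}^{n-1}\lambda_{\omega_j})t^{(\omega_n)}_{u_n}$ with $u_n\in\{1,\dots,k_{\omega_n}\}$ independent with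 laws $p_{\omega_n}$. The model is non-degenerate if there is $i_0$ with $\mathbb P(\omega_1=i_0)>0$ and not all maps in $\Phi^{(i_0)}$ equal. Fourier transform $\widehat\mu(\xi)=\int e^{2\pi i\,\mathrm{Re}(z\bar\xi)}d\mu(z)$; $\mathcal D_2(\sigma)=\{\mu:|\widehat\mu(\xi)|=O_\mu(|\xi|^{-\sigma})\}$, $\mathcal D_2=\bigcup_{\sigma>0}\mathcal D_2(\sigma)$. *)

theory Defs
  imports "HOL-Probability.Probability"
begin

definition hausdorff_pre :: "real \<Rightarrow> real \<Rightarrow> 'a::metric_space set \<Rightarrow> ennreal" where
  "hausdorff_pre s \<delta> A =
     (INF C \<in> {C :: nat \<Rightarrow> 'a set. A \<subseteq> (\<Union>n. C n) \<and> (\<forall>n. bounded (C n) \<and> diameter (C n) \<le> \<delta>)}.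
        (\<Sum>n. ennreal (diameter (C n) powr s)))"

definition hausdorff_measure :: "real \<Rightarrow> 'a::metric_space set \<Rightarrow> ennreal" where
  "hausdorff_measure s A = (SUP \<delta> \<in> {0<..}. hausdorff_pre s \<delta> A)"

definition hausdorff_dim :: "'a::metric_space set \<Rightarrow> ereal" where
  "hausdorff_dim A = (INF s \<in> {s::real. 0 \<le> s \<and> hausdorff_measure s A = 0}. ereal s)"

text \<open>Omega = I^N with the product (= Borel) sigma-algebra, I a finite type.\<close>
definition Omega_space :: "(nat \<Rightarrow> 'i) measure" where
  "Omega_space = PiM UNIV (\<lambda>_::nat. count_space (UNIV :: 'i set))"

definition bernoulli_measure :: "'i pmf \<Rightarrow> (nat \<Rightarrow> 'i) measure" where
  "bernoulli_measure q = PiM UNIV (\<lambda>_::nat. measure_pmf q)"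

text \<open>A planar model: for each i, k i maps z \<mapsto> lam i * z + t i j (j < k i, indices from 0),
  probability weights p i j > 0 summing to one, and 0 < |lam i| < 1.\<close>
definition planar_model ::
  "('i \<Rightarrow> nat) \<Rightarrow> ('i \<Rightarrow> nat \<Rightarrow> complex) \<Rightarrow> ('i \<Rightarrow> nat \<Rightarrow> real) \<Rightarrow> ('i \<Rightarrow> complex) \<Rightarrow> bool" where
  "planar_model k t p lam \<longleftrightarrow>
     (\<forall>i. 1 \<le> k i \<and> (\<forall>j<k i. 0 < p i j) \<and> (\<Sum>j<k i. p i j) = 1 \<and>
          0 < cmod (lam i) \<and> cmod (lam i) < 1)"

definition nondegenerate ::
  "(nat \<Rightarrow> 'i) measure \<Rightarrow> ('i \<Rightarrow> nat) \<Rightarrow> ('i \<Rightarrow> nat \<Rightarrow> complex) \<Rightarrow> bool" where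
  "nondegenerate P k t \<longleftrightarrow>
     (\<exists>i0. 0 < measure P {\<omega> \<in> space P. \<omega> 0 = i0} \<and>
           (\<exists>j1<k i0. \<exists>j2<k i0. t i0 j1 \<noteq> t i0 j2))"

definition digit_measure :: "nat \<Rightarrow> (nat \<Rightarrow> real) \<Rightarrow> nat measure" where
  "digit_measure m w = density (count_space UNIV) (\<lambda>j. if j < m then ennreal (w j) else 0)"

definition eta ::
  "('i \<Rightarrow> nat) \<Rightarrow> ('i \<Rightarrow> nat \<Rightarrow> complex) \<Rightarrow> ('i \<Rightarrow> nat \<Rightarrow> real) \<Rightarrow> ('i \<Rightarrow> complex)
     \<Rightarrow> (nat \<Rightarrow> 'i) \<Rightarrow> complex measure" where
  "eta k t p lam \<omega> =
     distr (PiM UNIV (\<lambda>n. digit_measure (k (\<omega> n)) (p (\<omega> n)))) borel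
       (\<lambda>u. \<Sum>n. (\<Prod>j<n. lam (\<omega> j)) * t (\<omega> n) (u n))"

definition fourier_transform :: "complex measure \<Rightarrow> complex \<Rightarrow> complex" where
  "fourier_transform \<mu> \<xi> = (\<integral>z. cis (2 * pi * Re (z * cnj \<xi>)) \<partial>\<mu>)"

definition D2_sigma :: "real \<Rightarrow> complex measure set" where
  "D2_sigma \<sigma> = {\<mu>. \<exists>C. \<forall>\<xi>. 1 \<le> cmod \<xi> \<longrightarrow> cmod (fourier_transform \<mu> \<xi>) \<le> C * cmod \<xi> powr (- \<sigma>)}"

definition D2 :: "complex measure set" where
  "D2 = (\<Union>\<sigma>\<in>{0<..}. D2_sigma \<sigma>)"

end

theory Submission
  imports Defs
begin

text \<open>
  The proof is a planar Erdos--Kahane argument. Put \<open>s = log \<lambda>\<close>. The Fourier transform of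
  \<open>\<eta>\<close> at \<open>\<xi>\<close> is a product of factors whose modulus stays away from \<open>1\<close> whenever the letter is
  \<open>i0\<close> and \<open>Re (\<zeta> * exp (s * S n))\<close> is not close to an integer, where \<open>\<zeta>\<close> is a fixed multiple of
  the conjugate of \<open>\<xi>\<close> and \<open>S n\<close> is the sum of the first \<open>n\<close> exponents. If \<open>z = exp (\<beta> i0 * s)\<close> is
  not real, four consecutive values \<open>Re (u * z ^ j)\<close> determine \<open>z\<close> (hence \<open>s\<close>) and \<open>u\<close> stably, by
  the second order recurrence they satisfy. Cut the time axis into long blocks; almost surely, all
  but a small proportion of them contain four consecutive letters \<open>i0\<close>. Running from small to large
  frequencies, the nearest integers observed in a block determine those of the next block uniquely
  if both blocks are close to integers, and up to boundedly many choices otherwise. So the parameters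
  for which most blocks are close to integers are covered by few sets of exponentially small
  diameter. What remains are the curves on which some \<open>\<lambda> powr \<beta> i\<close> is real, and these
  have dimension one.
\<close>

section \<open>Null sets of Hausdorff measures\<close>

text \<open>The exceptional parameters may depend neither on the translations nor on the weights.
  The translations enter an observation only through \<open>\<zeta>\<close>, so
  \<open>\<zeta>\<close> is quantified inside the exceptional set; the weights affect only the
  factor gained at each observation far from the integers. The crux is the order in which constants
  are chosen. The number of continuations of a history over one superblock of length
  \<open>b\<close> grows exponentially in \<open>b\<close>, since it absorbs the inverse contraction
  over two superblocks, while each superblock shrinks the diameter by \<open>c ^ (4 * b)\<close>.
  Hence the admissible proportion \<open>\<kappa>\<close> of irregular superblocks can be fixed from
  the exponential rates alone, before \<open>b\<close>. Then \<open>b\<close> is taken so large that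
  the factor 2 per superblock, paid for choosing which superblocks are irregular, is absorbed both
  in the covering and in the probability estimate. All constants are local in \<open>s\<close>; a
  local piece may not depend on \<open>\<omega>\<close>, and countably many pieces must suffice,
  because each of them discards a null set of \<open>\<omega>\<close>.\<close>

definition hausdorff_null :: "real \<Rightarrow> 'a::metric_space set \<Rightarrow> bool" where
  "hausdorff_null s A \<longleftrightarrow> (\<forall>e>0. \<exists>C::nat \<Rightarrow> 'a set. A \<subseteq> (\<Union>n. C n) \<and>
     (\<forall>n. bounded (C n) \<and> diameter (C n) \<le> e) \<and> (\<Sum>n. ennreal (diameter (C n) powr s)) \<le> ennreal e)"

lemma hausdorff_nullE:
  assumes "hausdorff_null s A" "0 < e"
  obtains C :: "nat \<Rightarrow> 'a::metric_space set" where "A \<subseteq> (\<Union>n. C n)" "\<And>n. bounded (C n)"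
    "\<And>n. diameter (C n) \<le> e" "(\<Sum>n. ennreal (diameter (C n) powr s)) \<le> ennreal e"
proof -
  from assms(1)[unfolded hausdorff_null_def, rule_format, OF assms(2)]
  obtain C :: "nat \<Rightarrow> 'a set" where C: "A \<subseteq> (\<Union>n. C n) \<and>
     (\<forall>n. bounded (C n) \<and> diameter (C n) \<le> e) \<and> (\<Sum>n. ennreal (diameter (C n) powr s)) \<le> ennreal e"
    by (elim exE)
  show thesis by (rule that[of C]) (use C in simp_all)
qed

text \<open>A single \<open>e\<close> bounds both the mesh and the sum in
  \<open>hausdorff_null\<close>, so \<open>min \<delta> e\<close> makes the premeasure at every mesh
  \<open>\<delta>\<close> smaller than any positive number.\<close>

lemma hausdorff_measure_eq_0:
  assumes "hausdorff_null s A"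
  shows "hausdorff_measure s A = 0"
proof -
  have "hausdorff_pre s \<delta> A \<le> 0" if "0 < \<delta>" for \<delta>
  proof (rule ennreal_le_epsilon)
    fix e :: real assume "0 < e"
    then have "0 < min \<delta> e" using that by simp
    then obtain C where C: "A \<subseteq> (\<Union>n. C n)" "\<And>n. bounded (C n)" "\<And>n. diameter (C n) \<le> min \<delta> e"
      "(\<Sum>n. ennreal (diameter (C n) powr s)) \<le> ennreal (min \<delta> e)"
      using hausdorff_nullE[OF assms] by metis
    have "hausdorff_pre s \<delta> A \<le> (\<Sum>n. ennreal (diameter (C n) powr s))"
      unfolding hausdorff_pre_def using C by (intro INF_lower) auto
    also have "\<dots> \<le> ennreal e" using C(4) by (rule order_trans) (simp add: ennreal_leI)
    finally show "hausdorff_pre s \<delta> A \<le> 0 + ennreal e" by simp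
  qed
  then show ?thesis unfolding hausdorff_measure_def by (auto simp: SUP_eq_iff)
qed

lemma hausdorff_dim_le:
  assumes "0 \<le> d" and "\<And>s. d < s \<Longrightarrow> hausdorff_null s A"
  shows "hausdorff_dim A \<le> ereal d"
proof (rule ereal_le_epsilon2)
  fix e :: real assume "0 < e"
  then have "hausdorff_measure (d + e) A = 0"
    by (intro hausdorff_measure_eq_0 assms) simp
  then have "hausdorff_dim A \<le> ereal (d + e)"
    unfolding hausdorff_dim_def using \<open>0 < e\<close> assms(1) by (intro INF_lower) auto
  then show "hausdorff_dim A \<le> ereal d + ereal e" by simp
qed

text \<open>Countable unions and limsup sets produce doubly indexed covers; the pairing bijection
  merges them into one sequence without changing the sum.\<close>

lemma hausdorff_nullI_double:
  fixes C :: "real \<Rightarrow> nat \<Rightarrow> nat \<Rightarrow> 'a::metric_space set"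
  assumes "\<And>e. 0 < e \<Longrightarrow> A \<subseteq> (\<Union>n k. C e n k)"
    and "\<And>e n k. 0 < e \<Longrightarrow> bounded (C e n k)"
    and "\<And>e n k. 0 < e \<Longrightarrow> diameter (C e n k) \<le> e"
    and "\<And>e. 0 < e \<Longrightarrow> (\<Sum>n. \<Sum>k. ennreal (diameter (C e n k) powr s)) \<le> ennreal e"
  shows "hausdorff_null s A"
  unfolding hausdorff_null_def
proof (intro allI impI)
  fix e :: real assume "0 < e"
  define D where "D = (\<lambda>i. case prod_decode i of (n, k) \<Rightarrow> C e n k)"
  have "(\<Sum>i. ennreal (diameter (D i) powr s)) = (\<Sum>n. \<Sum>k. ennreal (diameter (C e n k) powr s))"
    unfolding D_def prod.case_distrib[where h = "\<lambda>A. ennreal (diameter A powr s)"]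
    by (rule suminf_ennreal_2dimen) simp
  then have "(\<Sum>i. ennreal (diameter (D i) powr s)) \<le> ennreal e"
    using assms(4)[OF \<open>0 < e\<close>] by simp
  moreover have "A \<subseteq> (\<Union>i. D i)"
  proof
    fix x assume "x \<in> A"
    then obtain n k where "x \<in> C e n k" using assms(1)[OF \<open>0 < e\<close>] by blast
    then have "x \<in> D (prod_encode (n, k))" by (simp add: D_def)
    then show "x \<in> (\<Union>i. D i)" by blast
  qed
  moreover have "\<forall>i. bounded (D i) \<and> diameter (D i) \<le> e"
    using assms(2,3)[OF \<open>0 < e\<close>] by (auto simp: D_def split: prod.split)
  ultimately show "\<exists>C::nat \<Rightarrow> 'a set. A \<subseteq> (\<Union>n. C n) \<and>
     (\<forall>n. bounded (C n) \<and> diameter (C n) \<le> e) \<and> (\<Sum>n. ennreal (diameter (C n) powr s)) \<le> ennreal e"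
    by blast
qed

lemma hausdorff_null_UN_nat:
  fixes A :: "nat \<Rightarrow> 'a::metric_space set"
  assumes "\<And>n. hausdorff_null s (A n)"
  shows "hausdorff_null s (\<Union>n. A n)"
proof -
  let ?P = "\<lambda>e n (C::nat \<Rightarrow> 'a set). 0 < e \<longrightarrow> A n \<subseteq> (\<Union>k. C k) \<and>
     (\<forall>k. bounded (C k)) \<and> (\<forall>k. diameter (C k) \<le> e * (1/2) ^ Suc n) \<and>
     (\<Sum>k. ennreal (diameter (C k) powr s)) \<le> ennreal (e * (1/2) ^ Suc n)"
  have "\<exists>C. ?P e n C" for e n
  proof (cases "0 < e")
    case True
    then have "0 < e * (1/2) ^ Suc n" by simp
    then show ?thesis by (rule hausdorff_nullE[OF assms[of n]]) blast
  qed simp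
  then have "\<exists>C. \<forall>e n. ?P e n (C e n)" by (intro choice allI)
  then obtain C :: "real \<Rightarrow> nat \<Rightarrow> nat \<Rightarrow> 'a set" where C: "\<And>e n. 0 < e \<Longrightarrow> A n \<subseteq> (\<Union>k. C e n k)"
    "\<And>e n k. 0 < e \<Longrightarrow> bounded (C e n k)"
    "\<And>e n k. 0 < e \<Longrightarrow> diameter (C e n k) \<le> e * (1/2) ^ Suc n"
    "\<And>e n. 0 < e \<Longrightarrow> (\<Sum>k. ennreal (diameter (C e n k) powr s)) \<le> ennreal (e * (1/2) ^ Suc n)"
    by blast
  show ?thesis
  proof (rule hausdorff_nullI_double[where C = C])
    fix e :: real assume e: "0 < e"
    show "(\<Union>n. A n) \<subseteq> (\<Union>n k. C e n k)" using C(1)[OF e] by blast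
    show "bounded (C e n k)" for n k using C(2)[OF e] .
    show "diameter (C e n k) \<le> e" for n k
    proof -
      have "(1/2::real) ^ Suc n \<le> 1" by (rule power_le_one) auto
      then have "e * (1/2) ^ Suc n \<le> e * 1" using e by (intro mult_left_mono) auto
      then show ?thesis using C(3)[OF e, of n k] by simp
    qed
    have s: "(\<lambda>n. e * (1/2) ^ Suc n) sums (e * 1)"
      by (intro sums_mult power_half_series)
    have "(\<Sum>n. \<Sum>k. ennreal (diameter (C e n k) powr s)) \<le> (\<Sum>n. ennreal (e * (1/2) ^ Suc n))"
      by (intro suminf_le C(4)[OF e]) auto
    also have "\<dots> = ennreal (\<Sum>n. e * (1/2) ^ Suc n)"
      using e s by (intro suminf_ennreal2) (auto simp: sums_iff)
    also have "\<dots> = ennreal e" using s by (simp add: sums_iff)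
    finally show "(\<Sum>n. \<Sum>k. ennreal (diameter (C e n k) powr s)) \<le> ennreal e" .
  qed
qed

lemma hausdorff_null_subset:
  "hausdorff_null s B \<Longrightarrow> A \<subseteq> B \<Longrightarrow> hausdorff_null s A"
  unfolding hausdorff_null_def by (meson subset_trans)

lemma hausdorff_null_empty [simp]: "hausdorff_null s {}"
  unfolding hausdorff_null_def by (intro allI impI exI[of _ "\<lambda>_. {}"]) auto

lemma hausdorff_null_UN:
  assumes "countable I" and "\<And>i. i \<in> I \<Longrightarrow> hausdorff_null s (A i)"
  shows "hausdorff_null s (\<Union>i\<in>I. A i)"
proof (cases "I = {}")
  case False
  have "hausdorff_null s (\<Union>n. A (from_nat_into I n))"
    using assms(2) from_nat_into[OF False] by (intro hausdorff_null_UN_nat) auto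
  moreover have "(\<Union>i\<in>I. A i) \<subseteq> (\<Union>n. A (from_nat_into I n))"
    using range_from_nat_into[OF False assms(1)] by (metis SUP_upper image_image order_refl)
  ultimately show ?thesis by (rule hausdorff_null_subset)
qed simp

lemma hausdorff_null_Un:
  "hausdorff_null s A \<Longrightarrow> hausdorff_null s B \<Longrightarrow> hausdorff_null s (A \<union> B)"
  using hausdorff_null_UN[of "{A, B}" s "\<lambda>x. x"] by auto

lemma diameter_leI:
  fixes S :: "'a::metric_space set"
  assumes "0 \<le> d" "\<And>x y. x \<in> S \<Longrightarrow> y \<in> S \<Longrightarrow> dist x y \<le> d"
  shows "diameter S \<le> d"
  unfolding diameter_def using assms by (auto intro!: cSUP_least)

lemma hausdorff_null_lipschitz_image:
  assumes A: "hausdorff_null s A" and s: "0 < s"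
    and L: "\<And>x y. x \<in> A \<Longrightarrow> y \<in> A \<Longrightarrow> dist (f x) (f y) \<le> L * dist x y"
  shows "hausdorff_null s (f ` A)"
proof -
  \<comment> \<open>\<open>L\<close> may be zero or negative; a constant that is at least one can be
    divided by below.\<close>
  define K where "K = max L 1"
  have K: "1 \<le> K" "\<And>x y. x \<in> A \<Longrightarrow> y \<in> A \<Longrightarrow> dist (f x) (f y) \<le> K * dist x y"
    unfolding K_def using L by (auto intro: order_trans[OF _ mult_right_mono[of L "max L 1"]])
  show ?thesis unfolding hausdorff_null_def
  proof (intro allI impI)
    fix e :: real assume e: "0 < e"
    \<comment> \<open>Diameters grow by the factor \<open>K\<close> and their powers by
      \<open>K powr s\<close>; both losses have to fit into \<open>e\<close>.\<close>
    define e' where "e' = min (e / K) (e / K powr s)"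
    have e': "0 < e'" "K * e' \<le> e" "K powr s * e' \<le> e"
      using e K(1) by (auto simp: e'_def min_def field_simps)
    obtain C where C: "A \<subseteq> (\<Union>n. C n)" "\<And>n. bounded (C n)" "\<And>n. diameter (C n) \<le> e'"
      "(\<Sum>n. ennreal (diameter (C n) powr s)) \<le> ennreal e'"
      using hausdorff_nullE[OF A e'(1)] by metis
    define D where "D n = f ` (C n \<inter> A)" for n
    have dist: "dist x y \<le> K * diameter (C n)" if "x \<in> D n" "y \<in> D n" for x y n
    proof -
      obtain a b where ab: "a \<in> C n" "a \<in> A" "b \<in> C n" "b \<in> A" "x = f a" "y = f b"
        using \<open>x \<in> D n\<close> \<open>y \<in> D n\<close> unfolding D_def by blast
      have "dist a b \<le> diameter (C n)" using diameter_bounded_bound[OF C(2)] ab by blast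
      then show ?thesis using K(2)[OF ab(2,4)] K(1) ab
        by (metis (no_types, lifting) mult_left_mono order_trans zero_le_one)
    qed
    have dC: "0 \<le> diameter (C n)" for n using diameter_ge_0[OF C(2)] .
    have diam: "diameter (D n) \<le> K * diameter (C n)" for n
      using dist K(1) dC by (intro diameter_leI) auto
    have bdd: "bounded (D n)" for n using dist unfolding bounded_two_points by blast
    have "K * diameter (C n) \<le> K * e'" for n using C(3)[of n] K(1) by (intro mult_left_mono) auto
    then have 1: "diameter (D n) \<le> e" for n using diam[of n] e'(2) by (meson order_trans)
    have "(\<Sum>n. ennreal (diameter (D n) powr s)) \<le> (\<Sum>n. ennreal (K powr s) * ennreal (diameter (C n) powr s))"
    proof (intro suminf_le allI)
      fix n
      have "diameter (D n) powr s \<le> (K * diameter (C n)) powr s"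
        using diam[of n] diameter_ge_0[OF bdd] s by (intro powr_mono2) auto
      then show "ennreal (diameter (D n) powr s) \<le> ennreal (K powr s) * ennreal (diameter (C n) powr s)"
        using K(1) dC by (simp add: powr_mult flip: ennreal_mult)
    qed auto
    also have "\<dots> \<le> ennreal (K powr s) * ennreal e'" using C(4) by (simp add: mult_left_mono)
    also have "\<dots> \<le> ennreal e" using e' by (simp add: ennreal_leI flip: ennreal_mult)
    finally have 2: "(\<Sum>n. ennreal (diameter (D n) powr s)) \<le> ennreal e" .
    have 3: "f ` A \<subseteq> (\<Union>n. D n)" using C(1) unfolding D_def by blast
    show "\<exists>C. f ` A \<subseteq> (\<Union>n. C n) \<and> (\<forall>n. bounded (C n) \<and> diameter (C n) \<le> e) \<and>
      (\<Sum>n. ennreal (diameter (C n) powr s)) \<le> ennreal e"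
      using 1 2 3 bdd by blast
  qed
qed

text \<open>A Borel-Cantelli argument for covers: a point of the limsup lies in some
  \<open>E N\<close> beyond any given index, so the covers of a tail suffice. Once
  \<open>r N \<le> 1\<close>, an exponent \<open>s \<ge> 1\<close> only shrinks the terms, and the
  summable bound on the first powers handles all such \<open>s\<close> at once.\<close>

lemma hausdorff_null_limsup:
  fixes E :: "nat \<Rightarrow> 'a::metric_space set"
  assumes s: "1 \<le> s" and r0: "\<And>N. 0 \<le> r N" and a: "summable a"
    and ra: "\<And>N. r N \<le> a N"
    and cover: "\<And>N. n0 \<le> N \<Longrightarrow> \<exists>\<F>. finite \<F> \<and> E N \<subseteq> \<Union>\<F> \<and> real (card \<F>) * r N \<le> a N \<and>
        (\<forall>F\<in>\<F>. \<forall>x\<in>F. \<forall>y\<in>F. dist x y \<le> r N)"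
  shows "hausdorff_null s (\<Inter>n. \<Union>N\<in>{n..}. E N)"
proof -
  have a0: "0 \<le> a N" for N using r0 ra order_trans by blast
  have "\<exists>n1\<ge>n0. (\<forall>N\<ge>n1. a N \<le> min e 1) \<and> (\<Sum>N. a (N + n1)) \<le> e" if "0 < e" for e
  proof -
    have "eventually (\<lambda>N. a N < min e 1) sequentially"
      using order_tendstoD(2)[OF summable_LIMSEQ_zero[OF a], of "min e 1"] that by simp
    moreover have "eventually (\<lambda>n. norm (\<Sum>N. a (N + n)) < e) sequentially"
      using suminf_exist_split[OF that a] unfolding eventually_sequentially .
    ultimately have "eventually (\<lambda>n. a n < min e 1 \<and> norm (\<Sum>N. a (N + n)) < e \<and> n0 \<le> n) sequentially"
      using eventually_ge_at_top[of n0] by eventually_elim auto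
    then obtain n1 where "\<forall>n\<ge>n1. a n < min e 1 \<and> norm (\<Sum>N. a (N + n)) < e \<and> n0 \<le> n"
      unfolding eventually_sequentially by blast
    then show ?thesis by (intro exI[of _ n1]) (force intro: less_imp_le)
  qed
  then obtain n1 where n1: "\<And>e. 0 < e \<Longrightarrow> n0 \<le> n1 e" "\<And>e N. 0 < e \<Longrightarrow> n1 e \<le> N \<Longrightarrow> a N \<le> min e 1"
    "\<And>e. 0 < e \<Longrightarrow> (\<Sum>N. a (N + n1 e)) \<le> e" by metis
  obtain \<F> where \<F>: "\<And>N. n0 \<le> N \<Longrightarrow> finite (\<F> N)" "\<And>N. n0 \<le> N \<Longrightarrow> E N \<subseteq> \<Union>(\<F> N)"
    "\<And>N. n0 \<le> N \<Longrightarrow> real (card (\<F> N)) * r N \<le> a N"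
    "\<And>N F x y. n0 \<le> N \<Longrightarrow> F \<in> \<F> N \<Longrightarrow> x \<in> F \<Longrightarrow> y \<in> F \<Longrightarrow> dist x y \<le> r N"
    using cover by metis
  have "\<exists>g. \<F> N = g ` {..<card (\<F> N)}" if "n0 \<le> N" for N
    using ex_bij_betw_nat_finite[OF \<F>(1)[OF that]] unfolding bij_betw_def lessThan_atLeast0 by metis
  then obtain g where g: "\<And>N. n0 \<le> N \<Longrightarrow> \<F> N = g N ` {..<card (\<F> N)}" by metis
  \<comment> \<open>The finite families are padded with empty sets, which have diameter 0 and
    contribute nothing.\<close>
  define C where "C e n k = (if k < card (\<F> (n + n1 e)) then g (n + n1 e) k else {})" for e n k
  have CF: "C e n k = {} \<or> C e n k \<in> \<F> (n + n1 e)" if "0 < e" for e n k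
    using g[of "n + n1 e"] n1(1)[OF that] unfolding C_def by auto
  have Cd: "dist x y \<le> r (n + n1 e)" if "0 < e" "x \<in> C e n k" "y \<in> C e n k" for e n k x y
    using CF[OF that(1), of n k] \<F>(4)[of "n + n1 e"] n1(1)[OF that(1)] that by auto
  have bdd: "bounded (C e n k)" if "0 < e" for e n k
    unfolding bounded_two_points using Cd[OF that] by blast
  have diam: "diameter (C e n k) \<le> r (n + n1 e)" if "0 < e" for e n k
    by (intro diameter_leI r0 Cd that)
  show ?thesis
  proof (rule hausdorff_nullI_double[where C = C])
    fix e :: real assume e: "0 < e"
    show "(\<Inter>n. \<Union>N\<in>{n..}. E N) \<subseteq> (\<Union>n k. C e n k)"
    proof
      fix x assume "x \<in> (\<Inter>n. \<Union>N\<in>{n..}. E N)"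
      then obtain N where N: "n1 e \<le> N" "x \<in> E N" by auto
      then have N0: "n0 \<le> N" using n1(1)[OF e] by simp
      then obtain k where "k < card (\<F> N)" "x \<in> g N k" using \<F>(2)[OF N0] N(2) g[OF N0] by blast
      then have "x \<in> C e (N - n1 e) k" using N(1) by (simp add: C_def)
      then show "x \<in> (\<Union>n k. C e n k)" by blast
    qed
    show "bounded (C e n k)" for n k by (rule bdd[OF e])
    show "diameter (C e n k) \<le> e" for n k
      using diam[OF e, of n k] ra[of "n + n1 e"] n1(2)[OF e, of "n + n1 e"] by simp
    have "(\<Sum>n. \<Sum>k. ennreal (diameter (C e n k) powr s)) \<le> (\<Sum>n. ennreal (a (n + n1 e)))"
    proof (intro suminf_le allI)
      fix n
      let ?N = "n + n1 e"
      have r1: "r ?N \<le> 1" using ra[of ?N] n1(2)[OF e, of ?N] by simp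
      have rs: "r ?N powr s \<le> r ?N"
        using r0[of ?N] r1 s powr_mono'[of 1 s "r ?N"] by simp
      have "(\<Sum>k. ennreal (diameter (C e n k) powr s)) = (\<Sum>k<card (\<F> ?N). ennreal (diameter (C e n k) powr s))"
        using s by (intro suminf_finite) (auto simp: C_def)
      also have "\<dots> \<le> (\<Sum>k<card (\<F> ?N). ennreal (r ?N))"
      proof (intro sum_mono ennreal_leI)
        fix k
        have "diameter (C e n k) powr s \<le> r ?N powr s"
          using s diam[OF e] diameter_ge_0[OF bdd[OF e]] by (intro powr_mono2) auto
        then show "diameter (C e n k) powr s \<le> r ?N" using rs by simp
      qed
      also have "\<dots> = ennreal (real (card (\<F> ?N)) * r ?N)"
        using r0 by (simp add: ennreal_mult ennreal_of_nat_eq_real_of_nat)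
      also have "\<dots> \<le> ennreal (a ?N)" using \<F>(3)[of ?N] n1(1)[OF e] by (intro ennreal_leI) auto
      finally show "(\<Sum>k. ennreal (diameter (C e n k) powr s)) \<le> ennreal (a ?N)" .
    qed auto
    also have "\<dots> = ennreal (\<Sum>n. a (n + n1 e))"
      using a a0 by (intro suminf_ennreal2) (auto simp: summable_iff_shift)
    also have "\<dots> \<le> ennreal e" using n1(3)[OF e] by (rule ennreal_leI)
    finally show "(\<Sum>n. \<Sum>k. ennreal (diameter (C e n k) powr s)) \<le> ennreal e" .
  qed
qed

text \<open>A unit interval cut into \<open>N\<close> equal pieces costs
  \<open>N * (1 / N) powr s = N powr (1 - s)\<close>, which tends to 0 for
  \<open>s > 1\<close>.\<close>

lemma hausdorff_null_real_UNIV: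
  assumes "1 < s"
  shows "hausdorff_null s (UNIV :: real set)"
proof -
  have unit: "hausdorff_null s {a..a+1::real}" for a
    unfolding hausdorff_null_def
  proof (intro allI impI)
    fix e :: real assume e: "0 < e"
    have "((\<lambda>x::real. 1 / x) \<longlongrightarrow> 0) at_top" by (rule tendsto_divide_0[OF tendsto_const filterlim_at_top_imp_at_infinity[OF filterlim_ident]])
    moreover have "((\<lambda>x::real. x powr (1 - s)) \<longlongrightarrow> 0) at_top"
      using assms tendsto_neg_powr[of "1 - s" "\<lambda>x. x" at_top] by (simp add: filterlim_ident)
    ultimately have "eventually (\<lambda>x::real. 1 / x < e \<and> x powr (1 - s) < e \<and> 1 \<le> x) at_top"
      using e by (intro eventually_conj order_tendstoD eventually_ge_at_top) auto
    then have "eventually (\<lambda>n. 1 / real n < e \<and> real n powr (1 - s) < e \<and> 1 \<le> real n) sequentially"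
      using filterlim_real_sequentially unfolding filterlim_iff by blast
    then obtain N where N: "1 / real N < e" "real N powr (1 - s) < e" "1 \<le> real N"
      unfolding eventually_sequentially by blast
    define C where "C k = (if k < N then {a + k / N .. a + (k+1) / N} else {})" for k
    have d: "diameter (C k) = (if k < N then 1 / N else 0)" for k
      using N(3) by (simp add: C_def diameter_closed_interval add_divide_distrib)
    have "{a..a+1} \<subseteq> (\<Union>k. C k)"
    proof
      fix x assume x: "x \<in> {a..a+1}"
      show "x \<in> (\<Union>k. C k)"
      \<comment> \<open>At the right endpoint the floor below would give the index \<open>N\<close>,
        one too many; that point belongs to the last piece.\<close>
      proof (cases "x = a + 1")
        case True
        have "x \<in> C (N - 1)" using True N(3) by (auto simp: C_def field_simps of_nat_diff)
        then show ?thesis by blast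
      next
        case False
        define k where "k = nat \<lfloor>(x - a) * N\<rfloor>"
        have k: "real k \<le> (x - a) * N" "(x - a) * N < real k + 1"
          using x unfolding k_def by (auto simp: of_nat_nat)
        have "(x - a) * N < 1 * real N" using x False N(3) by (intro mult_strict_right_mono) auto
        then have "k < N" using k(1) by simp
        then have "x \<in> C k" using k N(3) by (auto simp: C_def field_simps)
        then show ?thesis by blast
      qed
    qed
    moreover have "bounded (C k) \<and> diameter (C k) \<le> e" for k
      using e N(1) unfolding d by (auto simp: C_def)
    moreover have "(\<Sum>k. ennreal (diameter (C k) powr s)) \<le> ennreal e"
    proof -
      have "(\<Sum>k. ennreal (diameter (C k) powr s)) = (\<Sum>k<N. ennreal (diameter (C k) powr s))"
        using assms by (intro suminf_finite) (auto simp: d)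
      also have "\<dots> = ennreal (real N * (1 / N) powr s)"
        by (simp add: d ennreal_mult ennreal_of_nat_eq_real_of_nat)
      also have "real N * (1 / N) powr s = real N powr (1 - s)"
        using N(3) by (simp add: powr_diff powr_divide)
      also have "ennreal \<dots> \<le> ennreal e" using N(2) by (intro ennreal_leI) simp
      finally show ?thesis .
    qed
    ultimately show "\<exists>C. {a..a+1} \<subseteq> (\<Union>n. C n) \<and> (\<forall>n. bounded (C n) \<and> diameter (C n) \<le> e) \<and>
      (\<Sum>n. ennreal (diameter (C n) powr s)) \<le> ennreal e"
      by blast
  qed
  have "hausdorff_null s (\<Union>j::int. {of_int j..of_int j + 1::real})"
    by (intro hausdorff_null_UN unit) auto
  moreover have "x \<in> (\<Union>j::int. {of_int j..of_int j + 1::real})" for x :: real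
    by (intro UN_I[of "\<lfloor>x\<rfloor>"]) (auto simp: less_imp_le)
  ultimately show ?thesis by (auto elim: hausdorff_null_subset)
qed

section \<open>Stability and counting\<close>

text \<open>This is the recurrence attached to the real quadratic polynomial with roots
  \<open>z\<close> and its conjugate; its coefficients are the trace \<open>2 * Re z\<close> and the
  norm \<open>(cmod z)^2\<close>.\<close>

lemma Re_mult_square:
  "Re (w * z^2) = 2 * Re z * Re (w * z) - (cmod z)^2 * Re w"
  unfolding cmod_power2 by (simp add: power2_eq_square algebra_simps)

text \<open>The Hankel determinant of three consecutive observations. It vanishes exactly when
  \<open>w\<close> or \<open>Im z\<close> does, which is why real multipliers have to be
  excluded.\<close>

lemma Re_mult_det:
  "(Re (w * z))^2 - Re w * Re (w * z^2) = (cmod w)^2 * (Im z)^2"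
  unfolding cmod_power2 by (simp add: power2_eq_square algebra_simps)

text \<open>Comparing the recurrences of the two sequences gives a linear system for the differences
  of trace and norm, with determinant at least \<open>(cmod u')^2 * \<delta>^2\<close>. Cramer's
  rule returns one factor \<open>cmod u'\<close> through the matrix entries, so the error in
  \<open>z\<close> has order \<open>e / cmod u'\<close>. Trace and norm see \<open>z\<close> only up
  to conjugation, hence the sign hypothesis.\<close>

lemma observability:
  fixes z z' u u' :: complex and \<delta> e :: real
  assumes z: "cmod z \<le> 1" "cmod z' \<le> 1" and \<delta>: "0 < \<delta>" "\<delta> \<le> \<bar>Im z\<bar>" "\<delta> \<le> \<bar>Im z'\<bar>"
    and sgn: "0 < Im z * Im z'"
    and e: "\<And>j. j < 4 \<Longrightarrow> \<bar>Re (u * z^j) - Re (u' * z'^j)\<bar> \<le> e"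
  shows "cmod (z - z') * cmod u' \<le> 12 * e / \<delta>^3" and "cmod (u - u') \<le> 15 * e / \<delta>^4"
proof -
  define x where "x j = Re (u * z^j)" for j
  define y where "y j = Re (u' * z'^j)" for j
  have xy: "\<bar>x j - y j\<bar> \<le> e" if "j < 4" for j using e[OF that] by (simp add: x_def y_def)
  have e0: "0 \<le> e" using xy[of 0] by simp
  have \<delta>1: "\<delta> \<le> 1" using \<delta>(2) abs_Im_le_cmod[of z] z(1) by linarith
  define T where "T = 2 * Re z" define T' where "T' = 2 * Re z'"
  define D where "D = (cmod z)^2" define D' where "D' = (cmod z')^2"
  have T: "\<bar>T\<bar> \<le> 2" using abs_Re_le_cmod[of z] z(1) unfolding T_def by linarith
  have D: "0 \<le> D" "D \<le> 1" using z(1) unfolding D_def by (auto simp: power_le_one)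
  have rx: "x 2 = T * x 1 - D * x 0" "x 3 = T * x 2 - D * x 1"
    using Re_mult_square[of u z] Re_mult_square[of "u * z" z]
    by (simp_all add: x_def T_def D_def power2_eq_square power3_eq_cube mult.assoc)
  have ry: "y 2 = T' * y 1 - D' * y 0" "y 3 = T' * y 2 - D' * y 1"
    using Re_mult_square[of u' z'] Re_mult_square[of "u' * z'" z']
    by (simp_all add: y_def T'_def D'_def power2_eq_square power3_eq_cube mult.assoc)
  \<comment> \<open>\<open>E1\<close> and \<open>E2\<close> are the defects of \<open>y\<close> in
    the recurrence of \<open>x\<close>. As \<open>y\<close> is \<open>e\<close>-close to
    \<open>x\<close>, \<open>\<bar>T\<bar> \<le> 2\<close> and \<open>D \<le> 1\<close>, they are at
    most \<open>4 * e\<close>.\<close>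
  define E1 where "E1 = (T - T') * y 1 - (D - D') * y 0"
  define E2 where "E2 = (T - T') * y 2 - (D - D') * y 1"
  have E_aux: "\<bar>a - T * b + D * d\<bar> \<le> 4 * e" if "\<bar>a\<bar> \<le> e" "\<bar>b\<bar> \<le> e" "\<bar>d\<bar> \<le> e" for a b d
  proof -
    have "\<bar>T * b\<bar> \<le> 2 * e" unfolding abs_mult using T that by (intro mult_mono) auto
    moreover have "\<bar>D * d\<bar> \<le> 1 * e" unfolding abs_mult using D that by (intro mult_mono) auto
    ultimately show ?thesis using that by linarith
  qed
  have "E1 = (x 2 - y 2) - T * (x 1 - y 1) + D * (x 0 - y 0)"
    unfolding E1_def rx ry by (simp add: algebra_simps)
  then have E1: "\<bar>E1\<bar> \<le> 4 * e" using E_aux xy by simp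
  have "E2 = (x 3 - y 3) - T * (x 2 - y 2) + D * (x 1 - y 1)"
    unfolding E2_def rx(2) ry(2) by (simp add: algebra_simps)
  then have E2: "\<bar>E2\<bar> \<le> 4 * e" using E_aux xy by simp
  define U where "U = cmod u'"
  have U0: "0 \<le> U" by (simp add: U_def)
  have yU: "\<bar>y j\<bar> \<le> U" for j
  proof -
    have "\<bar>y j\<bar> \<le> cmod (u' * z'^j)" unfolding y_def by (rule abs_Re_le_cmod)
    also have "\<dots> \<le> cmod u' * 1" using z(2) by (simp add: norm_mult norm_power power_le_one mult_left_le)
    finally show ?thesis by (simp add: U_def)
  qed
  have det: "(y 1)^2 - y 0 * y 2 = U^2 * (Im z')^2"
    using Re_mult_det[of u' z'] by (simp add: y_def U_def)
  have \<delta>2: "\<delta>^2 \<le> (Im z')^2" using \<delta> by (metis abs_ge_zero less_imp_le power2_abs power_mono)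
  \<comment> \<open>Cramer's rule for either unknown \<open>q\<close>: the determinant is quadratic
    in \<open>U\<close> and the numerator linear, so one factor \<open>U\<close> survives on the
    left.\<close>
  have key: "\<bar>q\<bar> * U \<le> 8 * e / \<delta>^2"
    if q: "q * ((y 1)^2 - y 0 * y 2) = a * E1 - b * E2" "\<bar>a\<bar> \<le> U" "\<bar>b\<bar> \<le> U" for q a b
  proof (cases "U = 0")
    case False
    then have "0 < U" using U0 by simp
    have "\<bar>q\<bar> * U * \<delta>^2 * U \<le> \<bar>q\<bar> * U * (Im z')^2 * U"
      using \<delta>2 U0 by (intro mult_right_mono mult_left_mono) auto
    also have "\<dots> = \<bar>a * E1 - b * E2\<bar>"
      unfolding q(1)[symmetric] det by (simp add: abs_mult power2_eq_square)
    also have "\<dots> \<le> \<bar>a\<bar> * \<bar>E1\<bar> + \<bar>b\<bar> * \<bar>E2\<bar>" by (metis abs_mult abs_triangle_ineq4)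
    also have "\<dots> \<le> U * (4 * e) + U * (4 * e)" using q E1 E2 U0 by (intro add_mono mult_mono) auto
    finally have "\<bar>q\<bar> * U * \<delta>^2 \<le> 8 * e" using \<open>0 < U\<close> by (simp add: field_simps)
    then show ?thesis using \<delta>(1) by (simp add: field_simps)
  qed (use e0 in simp)
  have kT: "\<bar>T - T'\<bar> * U \<le> 8 * e / \<delta>^2"
    by (rule key[of _ "y 1" "y 0"]) (auto simp: E1_def E2_def yU algebra_simps power2_eq_square)
  have kD: "\<bar>D - D'\<bar> * U \<le> 8 * e / \<delta>^2"
    by (rule key[of _ "y 2" "y 1"]) (auto simp: E1_def E2_def yU algebra_simps power2_eq_square)
  have p1: "e / \<delta>^2 \<le> e / \<delta>^3"
    using \<delta>(1) \<delta>1 e0 by (intro divide_left_mono power_decreasing) auto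
  have p3: "e \<le> e / \<delta>^4"
    using \<delta>(1) \<delta>1 e0 divide_left_mono[of "\<delta>^4" 1 e] by (simp add: power_le_one)
  have kRe: "\<bar>Re (z - z')\<bar> * U \<le> 4 * e / \<delta>^2"
    using kT unfolding T_def T'_def right_diff_distrib[symmetric] abs_mult by simp
  \<comment> \<open>The imaginary parts are compared through their squares, which trace and norm
    determine.\<close>
  have "(Im z + Im z') * (Im z - Im z') = (D - D') - (Re z + Re z') * (Re z - Re z')"
    unfolding D_def D'_def cmod_power2 by (simp add: power2_eq_square algebra_simps)
  then have "\<bar>Im z + Im z'\<bar> * \<bar>Im z - Im z'\<bar> \<le> \<bar>D - D'\<bar> + \<bar>Re z + Re z'\<bar> * \<bar>Re z - Re z'\<bar>"
    by (metis abs_mult abs_triangle_ineq4)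
  also have "\<dots> \<le> \<bar>D - D'\<bar> + 2 * \<bar>Re z - Re z'\<bar>"
  proof -
    have "\<bar>Re z + Re z'\<bar> \<le> 2"
      using abs_Re_le_cmod[of z] abs_Re_le_cmod[of z'] z by linarith
    then show ?thesis by (intro add_left_mono mult_right_mono) auto
  qed
  finally have i1: "\<bar>Im z + Im z'\<bar> * \<bar>Im z - Im z'\<bar> \<le> \<bar>D - D'\<bar> + 2 * \<bar>Re z - Re z'\<bar>" .
  \<comment> \<open>Equal signs rule out cancellation, that is, the confusion of \<open>z\<close>
    with a conjugate.\<close>
  have "2 * \<delta> \<le> \<bar>Im z + Im z'\<bar>" using \<delta> sgn by (auto simp: zero_less_mult_iff)
  then have "2 * \<delta> * \<bar>Im z - Im z'\<bar> \<le> \<bar>D - D'\<bar> + 2 * \<bar>Re z - Re z'\<bar>"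
    using i1 mult_right_mono[of "2 * \<delta>" "\<bar>Im z + Im z'\<bar>" "\<bar>Im z - Im z'\<bar>"] by linarith
  then have "2 * \<delta> * \<bar>Im z - Im z'\<bar> * U \<le> (\<bar>D - D'\<bar> + 2 * \<bar>Re z - Re z'\<bar>) * U"
    using U0 by (rule mult_right_mono)
  also have "\<dots> \<le> 16 * e / \<delta>^2" using kD kRe unfolding distrib_right mult.assoc by simp
  finally have kIm: "\<bar>Im (z - z')\<bar> * U \<le> 8 * e / \<delta>^3"
    using \<delta>(1) by (simp add: field_simps power2_eq_square power3_eq_cube)
  have "cmod (z - z') * U \<le> (\<bar>Re (z - z')\<bar> + \<bar>Im (z - z')\<bar>) * U"
    using U0 by (intro mult_right_mono cmod_le)
  also have "\<dots> \<le> 4 * e / \<delta>^2 + 8 * e / \<delta>^3" using kRe kIm by (simp add: algebra_simps)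
  also have "\<dots> \<le> 12 * e / \<delta>^3" using p1 by simp
  finally show 1: "cmod (z - z') * cmod u' \<le> 12 * e / \<delta>^3" by (simp add: U_def)
  have r0: "\<bar>Re (u - u')\<bar> \<le> e" using xy[of 0] by (simp add: x_def y_def)
  \<comment> \<open>The observation at 0 controls the real part of \<open>u - u'\<close>; the one at
    1 yields the imaginary part, because \<open>Im z\<close> is bounded below.\<close>
  have "Re (u - u') * Re z - Im (u - u') * Im z = (x 1 - y 1) - Re (u' * (z - z'))"
    by (simp add: x_def y_def algebra_simps)
  then have "Im (u - u') * Im z = Re (u - u') * Re z - (x 1 - y 1) + Re (u' * (z - z'))" by linarith
  then have "\<bar>Im (u - u')\<bar> * \<bar>Im z\<bar> \<le> \<bar>Re (u - u')\<bar> * \<bar>Re z\<bar> + \<bar>x 1 - y 1\<bar> + \<bar>Re (u' * (z - z'))\<bar>"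
    unfolding abs_mult[symmetric] by linarith
  also have "\<bar>Re (u - u')\<bar> * \<bar>Re z\<bar> \<le> e * 1"
    using r0 abs_Re_le_cmod[of z] z(1) e0 by (intro mult_mono) auto
  also have "\<bar>Re (u' * (z - z'))\<bar> \<le> 12 * e / \<delta>^3"
    using abs_Re_le_cmod[of "u' * (z - z')"] 1 by (simp add: norm_mult mult.commute)
  also have "\<bar>x 1 - y 1\<bar> \<le> e" using xy by simp
  finally have "\<bar>Im (u - u')\<bar> * \<bar>Im z\<bar> \<le> 2 * e + 12 * e / \<delta>^3" by simp
  moreover have "\<delta> * \<bar>Im (u - u')\<bar> \<le> \<bar>Im (u - u')\<bar> * \<bar>Im z\<bar>"
    using \<delta> by (subst mult.commute) (intro mult_left_mono, auto)
  moreover have "e \<le> e / \<delta>^3"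
    using \<delta>(1) \<delta>1 e0 divide_left_mono[of "\<delta>^3" 1 e] by (simp add: power_le_one)
  ultimately have "\<delta> * \<bar>Im (u - u')\<bar> \<le> 14 * e / \<delta>^3" by simp
  then have "\<bar>Im (u - u')\<bar> \<le> 14 * e / \<delta>^4"
    using \<delta>(1) by (simp add: field_simps eval_nat_numeral)
  then show "cmod (u - u') \<le> 15 * e / \<delta>^4"
    using cmod_le[of "u - u'"] r0 p3 by simp
qed

text \<open>The prefixes of histories form a tree in which a vertex at level \<open>n\<close> has at
  most \<open>w n\<close> children, so the leaves number at most the product. The bound is asked for
  only conditionally on the past, which later permits \<open>w n = 1\<close> at most levels.\<close>

lemma card_histories:
  fixes K :: "nat \<Rightarrow> 'p \<Rightarrow> 'k" and w :: "nat \<Rightarrow> real"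
  assumes fin: "\<And>n p. n < N \<Longrightarrow> p \<in> F \<Longrightarrow> finite (K n ` {p'\<in>F. \<forall>i<n. K i p' = K i p})"
    and card: "\<And>n p. n < N \<Longrightarrow> p \<in> F \<Longrightarrow> real (card (K n ` {p'\<in>F. \<forall>i<n. K i p' = K i p})) \<le> w n"
    and w: "\<And>n. 0 \<le> w n"
  shows "finite ((\<lambda>p. map (\<lambda>i. K i p) [0..<N]) ` F) \<and>
    real (card ((\<lambda>p. map (\<lambda>i. K i p) [0..<N]) ` F)) \<le> (\<Prod>n<N. w n)"
  using fin card
proof (induction N)
  case 0
  have sub: "(\<lambda>p. map (\<lambda>i. K i p) [0..<0]) ` F \<subseteq> {[]}" by auto
  show ?case using finite_subset[OF sub] card_mono[OF _ sub] by simp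
next
  case (Suc N)
  let ?h = "\<lambda>n p. map (\<lambda>i. K i p) [0..<n]"
  let ?X = "\<lambda>l. K N ` {p'\<in>F. ?h N p' = l}"
  have h_eq: "?h N p' = ?h N p \<longleftrightarrow> (\<forall>i<N. K i p' = K i p)" for p p' by (auto simp: list_eq_iff_nth_eq)
  have IH: "finite (?h N ` F)" "real (card (?h N ` F)) \<le> (\<Prod>n<N. w n)"
    using Suc.IH Suc.prems by auto
  have X: "finite (?X l)" "real (card (?X l)) \<le> w N" if l: "l \<in> ?h N ` F" for l
  proof -
    obtain p where p: "p \<in> F" "l = ?h N p" using l by blast
    have "?X l = K N ` {p'\<in>F. \<forall>i<N. K i p' = K i p}" unfolding p(2) h_eq ..
    then show "finite (?X l)" "real (card (?X l)) \<le> w N" using Suc.prems p(1) by auto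
  qed
  let ?U = "\<Union>l\<in>?h N ` F. (\<lambda>v. l @ [v]) ` ?X l"
  have sub: "?h (Suc N) ` F \<subseteq> ?U" by auto
  have finU: "finite ?U" by (intro finite_UN_I IH(1) finite_imageI X(1))
  have "real (card ?U) \<le> (\<Sum>l\<in>?h N ` F. real (card ((\<lambda>v. l @ [v]) ` ?X l)))"
    using card_UN_le[OF IH(1), of "\<lambda>l. (\<lambda>v. l @ [v]) ` ?X l"] by (simp flip: of_nat_sum)
  also have "\<dots> \<le> (\<Sum>l\<in>?h N ` F. w N)"
  proof (rule sum_mono)
    fix l assume l: "l \<in> ?h N ` F"
    have "real (card ((\<lambda>v. l @ [v]) ` ?X l)) \<le> real (card (?X l))"
      using card_image_le[OF X(1)[OF l]] by simp
    then show "real (card ((\<lambda>v. l @ [v]) ` ?X l)) \<le> w N" using X(2)[OF l] by linarith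
  qed
  also have "\<dots> \<le> (\<Prod>n<N. w n) * w N" using IH(2) w by (simp add: mult_right_mono)
  finally have "real (card ?U) \<le> (\<Prod>n<Suc N. w n)" by simp
  moreover have "card (?h (Suc N) ` F) \<le> card ?U" by (rule card_mono[OF finU sub])
  ultimately show ?case using finite_subset[OF sub finU] by auto
qed

lemma card_int_near:
  fixes y h :: real
  assumes "0 \<le> h"
  shows "finite {k::int. \<bar>of_int k - y\<bar> \<le> h}" and "real (card {k::int. \<bar>of_int k - y\<bar> \<le> h}) \<le> 2 * h + 1"
proof -
  have eq: "{k::int. \<bar>of_int k - y\<bar> \<le> h} = {\<lceil>y - h\<rceil>..\<lfloor>y + h\<rfloor>}"
    by (auto simp: abs_le_iff ceiling_le_iff le_floor_iff)
  show "finite {k::int. \<bar>of_int k - y\<bar> \<le> h}" unfolding eq by simp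
  have "real (card {\<lceil>y - h\<rceil>..\<lfloor>y + h\<rfloor>}) \<le> max 0 (of_int \<lfloor>y + h\<rfloor> - of_int \<lceil>y - h\<rceil> + 1)"
    by (simp add: of_nat_nat max_def)
  also have "\<dots> \<le> 2 * h + 1"
    using assms of_int_floor_le[of "y + h"] le_of_int_ceiling[of "y - h"] by (simp only: max.bounded_iff) linarith
  finally show "real (card {k::int. \<bar>of_int k - y\<bar> \<le> h}) \<le> 2 * h + 1" unfolding eq .
qed

lemma card_quads_near:
  fixes y :: "nat \<Rightarrow> real" and S :: "(int \<times> int \<times> int \<times> int) set"
  assumes "0 \<le> h"
    and "\<And>k0 k1 k2 k3. (k0, k1, k2, k3) \<in> S \<Longrightarrow>
      \<bar>of_int k0 - y 0\<bar> \<le> h \<and> \<bar>of_int k1 - y 1\<bar> \<le> h \<and> \<bar>of_int k2 - y 2\<bar> \<le> h \<and> \<bar>of_int k3 - y 3\<bar> \<le> h"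
  shows "finite S" and "real (card S) \<le> (2 * h + 1)^4"
proof -
  let ?A = "\<lambda>j. {k::int. \<bar>of_int k - y j\<bar> \<le> h}"
  have sub: "S \<subseteq> ?A 0 \<times> ?A 1 \<times> ?A 2 \<times> ?A 3" using assms(2) by fastforce
  have fin: "finite (?A 0 \<times> ?A 1 \<times> ?A 2 \<times> ?A 3)" using card_int_near(1)[OF assms(1)] by blast
  show "finite S" using finite_subset[OF sub fin] .
  have "real (card S) \<le> real (card (?A 0 \<times> ?A 1 \<times> ?A 2 \<times> ?A 3))"
    using card_mono[OF fin sub] by simp
  also have "\<dots> = real (card (?A 0)) * (real (card (?A 1)) * (real (card (?A 2)) * real (card (?A 3))))"
    by (simp only: card_cartesian_product of_nat_mult)
  also have "\<dots> \<le> (2 * h + 1) * ((2 * h + 1) * ((2 * h + 1) * (2 * h + 1)))"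
    using assms(1) by (intro mult_mono card_int_near(2)) auto
  finally show "real (card S) \<le> (2 * h + 1)^4" by (simp add: eval_nat_numeral mult.assoc)
qed

section \<open>The Fourier transform as a product\<close>

lemma sets_digit_measure [measurable_cong]: "sets (digit_measure m w) = sets (count_space UNIV)"
  by (simp add: digit_measure_def)

lemma space_digit_measure [simp]: "space (digit_measure m w) = UNIV"
  by (simp add: digit_measure_def)

context
  fixes m :: nat and w :: "nat \<Rightarrow> real"
  assumes w: "\<And>j. j < m \<Longrightarrow> 0 < w j" "(\<Sum>j<m. w j) = 1"
begin

lemma prob_space_digit_measure: "prob_space (digit_measure m w)"
proof (rule prob_spaceI)
  have "emeasure (digit_measure m w) (space (digit_measure m w)) =
      (\<integral>\<^sup>+j. (if j < m then ennreal (w j) else 0) \<partial>count_space UNIV)"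
    by (simp add: digit_measure_def emeasure_density)
  also have "\<dots> = (\<Sum>j<m. ennreal (w j))"
    by (subst nn_integral_count_space'[where A = "{..<m}"]) auto
  also have "\<dots> = 1" using w by (subst sum_ennreal) (auto intro: less_imp_le)
  finally show "emeasure (digit_measure m w) (space (digit_measure m w)) = 1" .
qed

lemma AE_digit_measure: "AE j in digit_measure m w. j < m"
  unfolding digit_measure_def by (subst AE_density) (auto simp: AE_count_space)

lemma integral_digit_measure:
  fixes f :: "nat \<Rightarrow> complex"
  shows "(\<integral>j. f j \<partial>digit_measure m w) = (\<Sum>j<m. w j * f j)"
proof -
  have "digit_measure m w = density (count_space UNIV) (\<lambda>j. ennreal (if j < m then w j else 0))"
    unfolding digit_measure_def by (intro arg_cong2[where f = density]) auto
  then have "(\<integral>j. f j \<partial>digit_measure m w) = (\<integral>j. (if j < m then w j else 0) *\<^sub>R f j \<partial>count_space UNIV)"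
    using w by (simp only:) (subst integral_density, auto simp: less_imp_le)
  also have "\<dots> = (\<Sum>j | j \<in> UNIV \<and> (if j < m then w j else 0) *\<^sub>R f j \<noteq> 0. (if j < m then w j else 0) *\<^sub>R f j)"
    by (rule lebesgue_integral_count_space_finite_support, rule finite_subset[of _ "{..<m}"]) auto
  also have "\<dots> = (\<Sum>j<m. (if j < m then w j else 0) *\<^sub>R f j)"
    by (rule sum.mono_neutral_left) auto
  also have "\<dots> = (\<Sum>j<m. w j * f j)" by (intro sum.cong) (auto simp: scaleR_conv_of_real)
  finally show ?thesis .
qed

lemma norm_digit_sum_le_1: "cmod (\<Sum>j<m. w j * cis (y j)) \<le> 1"
proof -
  have "cmod (\<Sum>j<m. w j * cis (y j)) \<le> (\<Sum>j<m. cmod (w j * cis (y j)))" by (rule norm_sum)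
  also have "\<dots> = (\<Sum>j<m. w j)" using w(1) by (intro sum.cong) (auto simp: norm_mult less_imp_le)
  finally show ?thesis using w(2) by simp
qed

text \<open>If two phases differ by at least \<open>\<epsilon>\<close> modulo one, the law of
  cosines keeps the sum of their terms strictly below \<open>p1 + p2\<close>, and the remaining
  terms cannot make up for the loss. The bound is uniform in the phases.\<close>

lemma digit_sum_gap:
  assumes j: "j1 < m" "j2 < m" "j1 \<noteq> j2" and \<epsilon>: "0 < \<epsilon>" "\<epsilon> \<le> 1/2"
  shows "\<exists>\<gamma>. 0 < \<gamma> \<and> \<gamma> < 1 \<and> (\<forall>y. \<epsilon> \<le> \<bar>(y j1 - y j2) - of_int (round (y j1 - y j2))\<bar> \<longrightarrow>
           cmod (\<Sum>j<m. w j * cis (2 * pi * y j)) \<le> \<gamma>)"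
proof -
  define p1 p2 where "p1 = w j1" and "p2 = w j2"
  have p: "0 < p1" "0 < p2" using w(1) j by (auto simp: p1_def p2_def)
  have cos1: "cos (2 * pi * \<epsilon>) < 1"
  proof -
    have "cos (2 * pi * \<epsilon>) < cos 0" using \<epsilon> by (intro cos_monotone_0_pi) auto
    then show ?thesis by simp
  qed
  define g where "g = sqrt ((p1 + p2)^2 - 2 * p1 * p2 * (1 - cos (2 * pi * \<epsilon>)))"
  have "g < p1 + p2"
  proof -
    have "g < sqrt ((p1 + p2)^2)" unfolding g_def using cos1 p by (intro real_sqrt_less_mono) simp
    then show ?thesis using p by simp
  qed
  \<comment> \<open>The maximum keeps the bound positive even if the two terms can cancel
    completely, so that it can be raised to real powers.\<close>
  define \<gamma> where "\<gamma> = max (1/2) (1 - (p1 + p2) + g)"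
  have "cmod (\<Sum>j<m. w j * cis (2 * pi * y j)) \<le> \<gamma>"
    if y: "\<epsilon> \<le> \<bar>(y j1 - y j2) - of_int (round (y j1 - y j2))\<bar>" for y
  proof -
    define d where "d = y j1 - y j2"
    let ?R = "{..<m} - {j1} - {j2}"
    have split: "(\<Sum>j<m. f j) = f j1 + (f j2 + (\<Sum>j\<in>?R. f j))" for f :: "nat \<Rightarrow> 'z::comm_monoid_add"
      using j by (simp add: sum.remove[of _ j1] sum.remove[of _ j2])
    have "cos (2 * pi * d) = cos (2 * pi * \<bar>d - of_int (round d)\<bar>)"
    proof -
      have "cos (2 * pi * d) = cos (2 * pi * (d - of_int (round d)) + 2 * pi * of_int (round d))"
        by (simp add: algebra_simps)
      also have "\<dots> = cos (2 * pi * (d - of_int (round d)))"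
        unfolding cos_add by simp
      also have "\<dots> = cos \<bar>2 * pi * (d - of_int (round d))\<bar>" by (simp only: cos_abs_real)
      also have "\<bar>2 * pi * (d - of_int (round d))\<bar> = 2 * pi * \<bar>d - of_int (round d)\<bar>" by (simp add: abs_mult)
      finally show ?thesis .
    qed
    also have "\<dots> \<le> cos (2 * pi * \<epsilon>)"
      using y \<epsilon> of_int_round_abs_le[of d] unfolding d_def[symmetric]
      by (intro cos_monotone_0_pi_le) (auto simp: abs_minus_commute)
    finally have cosd: "cos (2 * pi * d) \<le> cos (2 * pi * \<epsilon>)" .
    have "(cmod (p1 * cis (2 * pi * y j1) + p2 * cis (2 * pi * y j2)))^2
        = p1^2 * ((cos (2*pi*y j1))^2 + (sin (2*pi*y j1))^2) + p2^2 * ((cos (2*pi*y j2))^2 + (sin (2*pi*y j2))^2)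
          + 2 * p1 * p2 * (cos (2*pi*y j1) * cos (2*pi*y j2) + sin (2*pi*y j1) * sin (2*pi*y j2))"
    proof -
      have "(p1 * a + p2 * b)^2 + (p1 * a' + p2 * b')^2 =
        p1^2 * (a^2 + a'^2) + p2^2 * (b^2 + b'^2) + 2 * p1 * p2 * (a * b + a' * b')" for a b a' b' :: real
        by algebra
      then show ?thesis unfolding cmod_power2 by (simp del: sin_cos_squared_add sin_cos_squared_add2)
    qed
    also have "\<dots> = p1^2 + p2^2 + 2 * p1 * p2 * cos (2 * pi * d)"
      by (simp add: d_def cos_diff right_diff_distrib)
    also have "\<dots> \<le> p1^2 + p2^2 + 2 * p1 * p2 * cos (2 * pi * \<epsilon>)" using cosd p by simp
    also have "\<dots> = (p1 + p2)^2 - 2 * p1 * p2 * (1 - cos (2 * pi * \<epsilon>))"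
      by (simp add: power2_eq_square algebra_simps)
    finally have two: "cmod (p1 * cis (2 * pi * y j1) + p2 * cis (2 * pi * y j2)) \<le> g"
      unfolding g_def by (rule real_le_rsqrt)
    have "cmod (\<Sum>j\<in>?R. w j * cis (2 * pi * y j)) \<le> (\<Sum>j\<in>?R. cmod (w j * cis (2 * pi * y j)))"
      by (rule norm_sum)
    also have "\<dots> = (\<Sum>j\<in>?R. w j)" using w(1) by (intro sum.cong) (auto simp: norm_mult less_imp_le)
    also have "\<dots> = 1 - (p1 + p2)" using w(2) split[of w] by (simp add: p1_def p2_def)
    finally have rest: "cmod (\<Sum>j\<in>?R. w j * cis (2 * pi * y j)) \<le> 1 - (p1 + p2)" .
    have "(\<Sum>j<m. w j * cis (2 * pi * y j)) = (p1 * cis (2 * pi * y j1) + p2 * cis (2 * pi * y j2)) +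
       (\<Sum>j\<in>?R. w j * cis (2 * pi * y j))"
      by (subst split) (simp add: p1_def p2_def)
    then have "cmod (\<Sum>j<m. w j * cis (2 * pi * y j)) \<le> g + (1 - (p1 + p2))"
      using two rest norm_triangle_le by (metis (no_types, lifting) add_mono)
    then show ?thesis by (simp add: \<gamma>_def)
  qed
  then show ?thesis using \<open>g < p1 + p2\<close> by (intro exI[of _ \<gamma>]) (auto simp: \<gamma>_def)
qed

end

lemma (in product_prob_space) indep_vars_coordinates:
  assumes "I \<noteq> {}"
  shows "prob_space.indep_vars (PiM I M) M (\<lambda>i x. x i) I"
proof -
  interpret P: prob_space "PiM I M" by (rule prob_space_PiM) (rule M.prob_space_axioms)
  show ?thesis
  proof (subst P.indep_vars_iff_distr_eq_PiM'[OF assms])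
    have "distr (PiM I M) (PiM I M) (\<lambda>x. \<lambda>i\<in>I. x i) = distr (PiM I M) (PiM I M) (\<lambda>x. x)"
      by (intro distr_cong) (auto simp: space_PiM PiE_def extensional_restrict)
    also have "\<dots> = PiM I M" by (simp add: distr_id)
    also have "\<dots> = PiM I (\<lambda>i. distr (PiM I M) (M i) (\<lambda>x. x i))"
      by (intro PiM_cong) (auto simp: PiM_component)
    finally show "distr (PiM I M) (PiM I M) (\<lambda>x. \<lambda>i\<in>I. x i) = PiM I (\<lambda>i. distr (PiM I M) (M i) (\<lambda>x. x i))" .
  qed auto
qed

text \<open>By independence the partial sums have a finite product as Fourier transform, and
  dominated convergence passes to the limit. Every factor has modulus at most one, so truncating the
  product at any \<open>N\<close> gives an upper bound.\<close>

lemma norm_fourier_eta_le: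
  fixes k :: "'i::finite \<Rightarrow> nat"
  assumes model: "planar_model k t p lam"
  shows "cmod (fourier_transform (eta k t p lam \<omega>) \<xi>) \<le> (\<Prod>n<N. cmod (\<Sum>j<k (\<omega> n). p (\<omega> n) j *
           cis (2 * pi * Re ((\<Prod>j<n. lam (\<omega> j)) * t (\<omega> n) j * cnj \<xi>))))"
proof -
  have p: "\<And>i j. j < k i \<Longrightarrow> 0 < p i j" "\<And>i. (\<Sum>j<k i. p i j) = 1" "\<And>i. cmod (lam i) < 1"
    using model by (auto simp: planar_model_def)
  define M where "M n = digit_measure (k (\<omega> n)) (p (\<omega> n))" for n
  define \<Lambda> where "\<Lambda> n = (\<Prod>j<n. lam (\<omega> j))" for n
  have M: "prob_space (M n)" for n unfolding M_def using p by (intro prob_space_digit_measure) auto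
  interpret product_prob_space M UNIV
    using M by (simp add: product_prob_space_def product_prob_space_axioms_def product_sigma_finite_def prob_space_imp_sigma_finite)
  let ?P = "PiM UNIV M"
  interpret P: prob_space ?P by (rule prob_space_PiM) (rule M)
  define X where "X n x = cis (2 * pi * Re (\<Lambda> n * t (\<omega> n) x * cnj \<xi>))" for n and x :: nat
  have [measurable_cong]: "sets (M n) = sets (count_space UNIV)" for n
    by (simp add: M_def sets_digit_measure)
  have meas: "(\<lambda>x. f (x n)) \<in> borel_measurable ?P" for n and f :: "nat \<Rightarrow> complex"
    by measurable
  define \<phi> where "\<phi> n = (\<Sum>j<k (\<omega> n). p (\<omega> n) j * X n j)" for n
  have int_X: "(\<integral>u. X n (u n) \<partial>?P) = \<phi> n" for n
  proof -
    have "(\<integral>x. X n x \<partial>M n) = (\<integral>x. X n x \<partial>distr ?P (M n) (\<lambda>u. u n))" by (simp add: PiM_component)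
    also have "\<dots> = (\<integral>u. X n (u n) \<partial>?P)"
      by (rule integral_distr) (auto simp: M_def sets_digit_measure intro: measurable_component_singleton)
    finally show ?thesis unfolding M_def \<phi>_def using p by (simp add: integral_digit_measure)
  qed
  have prod_int: "(\<integral>u. (\<Prod>n<N. X n (u n)) \<partial>?P) = (\<Prod>n<N. \<phi> n)" for N
  proof -
    have "P.indep_vars M (\<lambda>n u. u n) {..<N}"
      using P.indep_vars_subset[OF indep_vars_coordinates] by blast
    then have ind: "P.indep_vars (\<lambda>_. borel) (\<lambda>n u. X n (u n)) {..<N}"
      by (rule P.indep_vars_compose2) (auto simp: M_def)
    have "(\<integral>u. (\<Prod>n<N. X n (u n)) \<partial>?P) = (\<Prod>n<N. \<integral>u. X n (u n) \<partial>?P)"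
    proof (rule P.indep_vars_lebesgue_integral[OF _ ind])
      show "integrable ?P (\<lambda>u. X n (u n))" for n
        by (rule P.integrable_const_bound[of _ 1]) (auto simp: X_def meas)
    qed simp
    then show ?thesis by (simp add: int_X)
  qed
  have summable: "summable (\<lambda>n. \<Lambda> n * t (\<omega> n) (u n))" if u: "\<And>n. u n < k (\<omega> n)" for u
  proof -
    define c where "c = Max (range (\<lambda>i. cmod (lam i)))"
    have c: "cmod (lam i) \<le> c" for i unfolding c_def by (rule Max_ge) auto
    have c1: "c < 1" unfolding c_def using p(3) by (subst Max_less_iff) auto
    have c0: "0 \<le> c" using c norm_ge_zero order_trans by blast
    define T where "T = (\<Sum>i\<in>UNIV. \<Sum>j<k i. cmod (t i j))"
    have T: "cmod (t i j) \<le> T" if "j < k i" for i j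
    proof -
      have "cmod (t i j) \<le> (\<Sum>j<k i. cmod (t i j))" using that by (intro member_le_sum) auto
      also have "\<dots> \<le> T" unfolding T_def by (rule member_le_sum[of i UNIV]) (auto intro: sum_nonneg)
      finally show ?thesis .
    qed
    have le: "cmod (\<Lambda> n * t (\<omega> n) (u n)) \<le> c ^ n * T" for n
    proof -
      have "cmod (\<Lambda> n) \<le> (\<Prod>j<n. c)"
        unfolding \<Lambda>_def prod_norm[symmetric] by (intro prod_mono) (auto simp: c)
      then show ?thesis using T[OF u] c0 unfolding norm_mult by (intro mult_mono) auto
    qed
    have "summable (\<lambda>n. c ^ n * T)" using c0 c1 by (intro summable_mult2 summable_geometric) auto
    then show ?thesis by (rule summable_comparison_test'[of _ 0]) (rule le)
  qed
  let ?S = "\<lambda>u. \<Sum>n. \<Lambda> n * t (\<omega> n) (u n)"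
  have lim: "(\<lambda>N. \<Prod>n<N. X n (u n)) \<longlonglongrightarrow> cis (2 * pi * Re (?S u * cnj \<xi>))" if "\<And>n. u n < k (\<omega> n)" for u
  proof -
    have "(\<lambda>N. \<Sum>n<N. \<Lambda> n * t (\<omega> n) (u n)) \<longlonglongrightarrow> ?S u"
      using summable[OF that] by (rule summable_LIMSEQ)
    then have "(\<lambda>N. cis (2 * pi * Re ((\<Sum>n<N. \<Lambda> n * t (\<omega> n) (u n)) * cnj \<xi>))) \<longlonglongrightarrow> cis (2 * pi * Re (?S u * cnj \<xi>))"
      by (intro tendsto_intros)
    moreover have "cis (2 * pi * Re ((\<Sum>n<N. \<Lambda> n * t (\<omega> n) (u n)) * cnj \<xi>)) = (\<Prod>n<N. X n (u n))" for N
      by (induction N) (simp_all add: X_def distrib_right distrib_left cis_mult[symmetric] mult.commute)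
    ultimately show ?thesis by simp
  qed
  \<comment> \<open>Digits outside the alphabet index unrestricted translations, so convergence of
    the series is known only on this set of full measure.\<close>
  have AE_u: "AE u in ?P. \<forall>n. u n < k (\<omega> n)"
  proof (subst AE_all_countable, rule)
    fix n
    have "AE j in M n. j < k (\<omega> n)" unfolding M_def by (rule AE_digit_measure) (use p in auto)
    then show "AE u in ?P. u n < k (\<omega> n)" by (rule AE_component[OF UNIV_I])
  qed
  have S_meas: "?S \<in> borel_measurable ?P"
    using meas by (intro borel_measurable_suminf) auto
  have cis_meas: "(\<lambda>z. cis (2 * pi * Re (z * cnj \<xi>))) \<in> borel_measurable borel"
    by (intro borel_measurable_continuous_onI continuous_intros)
  have "fourier_transform (eta k t p lam \<omega>) \<xi> = (\<integral>u. cis (2 * pi * Re (?S u * cnj \<xi>)) \<partial>?P)"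
    unfolding fourier_transform_def eta_def M_def[symmetric] \<Lambda>_def[symmetric]
    by (rule integral_distr[OF S_meas cis_meas])
  moreover have "(\<lambda>N. \<integral>u. (\<Prod>n<N. X n (u n)) \<partial>?P) \<longlonglongrightarrow> (\<integral>u. cis (2 * pi * Re (?S u * cnj \<xi>)) \<partial>?P)"
  proof (rule integral_dominated_convergence[where w = "\<lambda>_. 1"])
    show "(\<lambda>u. cis (2 * pi * Re (?S u * cnj \<xi>))) \<in> borel_measurable ?P"
      by (rule measurable_compose[OF S_meas cis_meas])
    show "(\<lambda>u. \<Prod>n<N. X n (u n)) \<in> borel_measurable ?P" for N
      using meas by (intro borel_measurable_prod) auto
    show "AE u in ?P. (\<lambda>N. \<Prod>n<N. X n (u n)) \<longlonglongrightarrow> cis (2 * pi * Re (?S u * cnj \<xi>))"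
      using AE_u by eventually_elim (rule lim, blast)
    show "AE u in ?P. norm (\<Prod>n<N. X n (u n)) \<le> 1" for N
      by (simp add: X_def prod_norm[symmetric])
  qed simp
  ultimately have conv: "(\<lambda>N. \<Prod>n<N. \<phi> n) \<longlonglongrightarrow> fourier_transform (eta k t p lam \<omega>) \<xi>"
    by (simp add: prod_int)
  have \<phi>1: "cmod (\<phi> n) \<le> 1" for n
    unfolding \<phi>_def X_def using p by (intro norm_digit_sum_le_1) auto
  have "cmod (\<Prod>n<N'. \<phi> n) \<le> (\<Prod>n<N. cmod (\<phi> n))" if "N \<le> N'" for N'
    using that
  proof (induction N' rule: dec_induct)
    case (step N')
    have "cmod (\<Prod>n<N'. \<phi> n) * cmod (\<phi> N') \<le> (\<Prod>n<N. cmod (\<phi> n)) * 1"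
      using step.IH \<phi>1 by (intro mult_mono) (auto intro: prod_nonneg)
    then show ?case by (simp add: norm_mult)
  qed (simp add: prod_norm)
  then have "cmod (fourier_transform (eta k t p lam \<omega>) \<xi>) \<le> (\<Prod>n<N. cmod (\<phi> n))"
    by (intro LIMSEQ_le_const2[OF tendsto_norm[OF conv]]) auto
  then show ?thesis by (simp add: \<phi>_def X_def \<Lambda>_def)
qed

section \<open>The Erdos--Kahane argument near a fixed exponent\<close>

text \<open>On a small piece \<open>V\<close> all estimates are uniform in the exponent
  \<open>s\<close>. Here \<open>c\<close> and \<open>1 / L\<close> bound the contraction per letter
  from above and below, \<open>\<delta>\<close> keeps the observed multiplier off the real line and
  \<open>same_side\<close> away from conjugates, \<open>C\<close> recovers \<open>s\<close> from the
  multiplier, and convexity serves the mean value inequality.\<close>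

locale exponent_piece =
  fixes \<beta> :: "'i::finite \<Rightarrow> complex" and i0 :: 'i and V :: "complex set" and c L M \<delta> C :: real
  assumes convex: "convex V"
    and M: "\<And>i. cmod (\<beta> i) \<le> M"
    and c: "0 < c" "c < 1"
    and L: "1 \<le> L"
    and C: "0 < C"
    and \<delta>: "0 < \<delta>"
    and contracting: "\<And>i s. s \<in> V \<Longrightarrow> cmod (exp (\<beta> i * s)) \<le> c"
    and expansion: "\<And>i s. s \<in> V \<Longrightarrow> cmod (exp (- \<beta> i * s)) \<le> L"
    and nonreal: "\<And>s. s \<in> V \<Longrightarrow> \<delta> \<le> \<bar>Im (exp (\<beta> i0 * s))\<bar>"
    and same_side: "\<And>s s'. s \<in> V \<Longrightarrow> s' \<in> V \<Longrightarrow> 0 < Im (exp (\<beta> i0 * s)) * Im (exp (\<beta> i0 * s'))"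
    and inverse_lipschitz: "\<And>s s'. s \<in> V \<Longrightarrow> s' \<in> V \<Longrightarrow>
      cmod (s - s') \<le> C * cmod (exp (\<beta> i0 * s) - exp (\<beta> i0 * s'))"
begin

section \<open>Frequencies, superblocks and observations\<close>

lemma M_nonneg: "0 \<le> M" using M norm_ge_zero order_trans by blast

lemma norm_power_le_1:
  assumes "s \<in> V" shows "cmod (exp (\<beta> i * s)) ^ j \<le> 1"
  using contracting[OF assms, of i] c by (intro power_le_one norm_ge_zero) linarith

text \<open>For \<open>s\<close> in \<open>V\<close> the modulus decreases in \<open>n\<close>:
  superblock 0 sees the highest frequency, and going back in time raises the frequency.\<close>

definition freq :: "(nat \<Rightarrow> 'i) \<Rightarrow> complex \<Rightarrow> complex \<Rightarrow> nat \<Rightarrow> complex" where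
  "freq \<omega> s \<zeta> n = \<zeta> * exp (s * (\<Sum>j<n. \<beta> (\<omega> j)))"

text \<open>Superblock \<open>m\<close> consists of the \<open>b\<close> consecutive quadruples of letters with indices in
  \<open>{m * b..<Suc m * b}\<close>. In a good superblock some quadruple is constantly \<open>i0\<close>, so that four
  consecutive Fourier factors can be observed there. In the other superblocks the observations
  \<open>obs\<close> are fictitious: they do not correspond to factors of the Fourier transform.\<close>

definition good :: "nat \<Rightarrow> (nat \<Rightarrow> 'i) \<Rightarrow> nat \<Rightarrow> bool" where
  "good b \<omega> m \<longleftrightarrow> (\<exists>k. m * b \<le> k \<and> k < Suc m * b \<and> (\<forall>j<4. \<omega> (4 * k + j) = i0))"

definition pos :: "nat \<Rightarrow> (nat \<Rightarrow> 'i) \<Rightarrow> nat \<Rightarrow> nat" where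
  "pos b \<omega> m = 4 * (if good b \<omega> m
     then LEAST k. m * b \<le> k \<and> k < Suc m * b \<and> (\<forall>j<4. \<omega> (4 * k + j) = i0) else m * b)"

definition obs :: "nat \<Rightarrow> (nat \<Rightarrow> 'i) \<Rightarrow> nat \<Rightarrow> complex \<times> complex \<Rightarrow> nat \<Rightarrow> real" where
  "obs b \<omega> m = (\<lambda>(s, \<zeta>) j. Re (freq \<omega> s \<zeta> (pos b \<omega> m) * exp (\<beta> i0 * s) ^ j))"

definition close :: "nat \<Rightarrow> real \<Rightarrow> (nat \<Rightarrow> 'i) \<Rightarrow> nat \<Rightarrow> complex \<times> complex \<Rightarrow> bool" where
  "close b \<epsilon> \<omega> m p \<longleftrightarrow> (\<forall>j<4. \<bar>obs b \<omega> m p j - of_int (round (obs b \<omega> m p j))\<bar> \<le> \<epsilon>)"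

text \<open>No model occurs here; it enters later through \<open>\<zeta>\<close>. The normalisation
  at time \<open>4*b*N\<close> ties \<open>N\<close> to the size of \<open>\<zeta>\<close>, and the
  window up to \<open>L^(4*b)\<close> is wide enough because one superblock shrinks the frequency by
  at most that factor.\<close>

definition exceptional :: "nat \<Rightarrow> real \<Rightarrow> real \<Rightarrow> nat \<Rightarrow> (nat \<Rightarrow> 'i) \<Rightarrow> complex set" where
  "exceptional b \<epsilon> \<kappa> N \<omega> = {s\<in>V. \<exists>\<zeta>. 1 \<le> cmod (freq \<omega> s \<zeta> (4*b*N)) \<and> cmod (freq \<omega> s \<zeta> (4*b*N)) \<le> L^(4*b) \<and>
     real (card {m. m < N \<and> good b \<omega> m \<and> \<not> close b \<epsilon> \<omega> m (s, \<zeta>)}) \<le> \<kappa> * N}"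

lemma pos_good:
  assumes "good b \<omega> m" "j < 4"
  shows "\<omega> (pos b \<omega> m + j) = i0"
proof -
  have "\<exists>k. m * b \<le> k \<and> k < Suc m * b \<and> (\<forall>j<4. \<omega> (4 * k + j) = i0)"
    using assms(1) unfolding good_def .
  from LeastI_ex[OF this] show ?thesis using assms by (simp add: pos_def)
qed

lemma pos_bounds:
  assumes "1 \<le> b"
  shows "4 * b * m \<le> pos b \<omega> m" and "pos b \<omega> m + 4 \<le> 4 * b * Suc m"
proof -
  have "4 * b * m \<le> pos b \<omega> m \<and> pos b \<omega> m + 4 \<le> 4 * b * Suc m"
  proof (cases "good b \<omega> m")
    case True
    then have "\<exists>k. m * b \<le> k \<and> k < Suc m * b \<and> (\<forall>j<4. \<omega> (4 * k + j) = i0)"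
      unfolding good_def .
    from LeastI_ex[OF this] obtain k where "pos b \<omega> m = 4 * k" "m * b \<le> k" "k < Suc m * b"
      using True by (auto simp: pos_def)
    then show ?thesis by (simp add: algebra_simps)
  qed (use assms in \<open>simp add: pos_def algebra_simps\<close>)
  then show "4 * b * m \<le> pos b \<omega> m" and "pos b \<omega> m + 4 \<le> 4 * b * Suc m" by auto
qed

lemma norm_exp_sum_le:
  assumes "s \<in> V" "finite A"
  shows "cmod (exp (s * (\<Sum>j\<in>A. \<beta> (\<omega> j)))) \<le> c ^ card A"
    and "cmod (exp (s * (- (\<Sum>j\<in>A. \<beta> (\<omega> j))))) \<le> L ^ card A"
proof -
  have "exp (s * (\<Sum>j\<in>A. \<beta> (\<omega> j))) = (\<Prod>j\<in>A. exp (\<beta> (\<omega> j) * s))"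
    using assms(2) by (simp add: sum_distrib_left exp_sum mult.commute)
  then show "cmod (exp (s * (\<Sum>j\<in>A. \<beta> (\<omega> j)))) \<le> c ^ card A"
    using prod_mono[of A "\<lambda>j. cmod (exp (\<beta> (\<omega> j) * s))" "\<lambda>_. c"] contracting[OF assms(1)]
    by (simp add: prod_norm[symmetric])
  have "exp (s * (- (\<Sum>j\<in>A. \<beta> (\<omega> j)))) = (\<Prod>j\<in>A. exp (- \<beta> (\<omega> j) * s))"
    using assms(2) by (simp add: sum_distrib_left exp_sum mult.commute flip: sum_negf)
  then show "cmod (exp (s * (- (\<Sum>j\<in>A. \<beta> (\<omega> j))))) \<le> L ^ card A"
    using prod_mono[of A "\<lambda>j. cmod (exp (- \<beta> (\<omega> j) * s))" "\<lambda>_. L"] expansion[OF assms(1)]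
    by (simp add: prod_norm[symmetric])
qed

lemma freq_later:
  assumes "n \<le> n'"
  shows "freq \<omega> s \<zeta> n' = freq \<omega> s \<zeta> n * exp (s * (\<Sum>j\<in>{n..<n'}. \<beta> (\<omega> j)))"
proof -
  have "(\<Sum>j<n'. \<beta> (\<omega> j)) = (\<Sum>j<n. \<beta> (\<omega> j)) + (\<Sum>j\<in>{n..<n'}. \<beta> (\<omega> j))"
    using sum.atLeastLessThan_concat[of 0 n n' "\<lambda>j. \<beta> (\<omega> j)"] assms by (simp add: lessThan_atLeast0)
  then show ?thesis by (simp add: freq_def distrib_left exp_add)
qed

lemma freq_earlier:
  assumes "n \<le> n'"
  shows "freq \<omega> s \<zeta> n = freq \<omega> s \<zeta> n' * exp (s * (- (\<Sum>j\<in>{n..<n'}. \<beta> (\<omega> j))))"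
  unfolding freq_later[OF assms] by (simp add: mult.assoc flip: exp_add)

lemma freq_later_le:
  assumes "s \<in> V" "n \<le> n'"
  shows "cmod (freq \<omega> s \<zeta> n') \<le> cmod (freq \<omega> s \<zeta> n) * c ^ (n' - n)"
  unfolding freq_later[OF assms(2)] norm_mult
  using norm_exp_sum_le(1)[OF assms(1), of "{n..<n'}" \<omega>] by (intro mult_left_mono) auto

lemma freq_earlier_le:
  assumes "s \<in> V" "n \<le> n'"
  shows "cmod (freq \<omega> s \<zeta> n) \<le> cmod (freq \<omega> s \<zeta> n') * L ^ (n' - n)"
  unfolding freq_earlier[OF assms(2)] norm_mult
  using norm_exp_sum_le(2)[OF assms(1), of "{n..<n'}" \<omega>] by (intro mult_left_mono) auto

text \<open>For \<open>\<delta> \<le> 1\<close> this dominates both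
  \<open>C * 12 / \<delta>^3\<close>, the error in \<open>s\<close>, and
  \<open>15 / \<delta>^4\<close>, the error in the frequency.\<close>

definition K :: real where "K = 15 * max 1 C / \<delta>^4"

lemma \<delta>_le_1: assumes "s \<in> V" shows "\<delta> \<le> 1"
  using nonreal[OF assms] abs_Im_le_cmod[of "exp (\<beta> i0 * s)"] contracting[OF assms, of i0] c by linarith

lemma K_ge_1: assumes "s \<in> V" shows "1 \<le> K"
proof -
  have "\<delta>^4 \<le> 1" using \<delta> \<delta>_le_1[OF assms] by (simp add: power_le_one)
  then show ?thesis unfolding K_def using \<delta> by (simp add: le_divide_eq)
qed

text \<open>The difference of the parameters is bounded only when weighted by the frequency. That
  form is the useful one: the weight matches the derivative in \<open>obs_step\<close>, and at
  superblock 0 it is exponentially large, which makes the covering sets small.\<close>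

lemma obs_control:
  assumes s: "s \<in> V" "s' \<in> V"
    and e: "\<And>j. j < 4 \<Longrightarrow> \<bar>obs b \<omega> m (s, \<zeta>) j - obs b \<omega> m (s', \<zeta>') j\<bar> \<le> e"
  shows "cmod (s - s') * cmod (freq \<omega> s' \<zeta>' (pos b \<omega> m)) \<le> K * e"
    and "cmod (freq \<omega> s \<zeta> (pos b \<omega> m) - freq \<omega> s' \<zeta>' (pos b \<omega> m)) \<le> K * e"
proof -
  let ?z = "exp (\<beta> i0 * s)" and ?z' = "exp (\<beta> i0 * s')"
  let ?u = "freq \<omega> s \<zeta> (pos b \<omega> m)" and ?u' = "freq \<omega> s' \<zeta>' (pos b \<omega> m)"
  have le1: "cmod ?z \<le> 1" "cmod ?z' \<le> 1"
    using contracting[OF s(1), of i0] contracting[OF s(2), of i0] c by linarith+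
  have e': "\<bar>Re (?u * ?z^j) - Re (?u' * ?z'^j)\<bar> \<le> e" if "j < 4" for j
    using e[OF that] by (simp add: obs_def)
  note ob = observability[OF le1 \<delta> nonreal[OF s(1)] nonreal[OF s(2)] same_side[OF s] e']
  have e0: "0 \<le> e" using e'[of 0] by simp
  have "cmod (s - s') * cmod ?u' \<le> C * (cmod (?z - ?z') * cmod ?u')"
    using mult_right_mono[OF inverse_lipschitz[OF s], of "cmod ?u'"] by (simp add: mult.assoc)
  also have "\<dots> \<le> C * (12 * e / \<delta>^3)" using ob(1) C by (intro mult_left_mono) auto
  also have "\<dots> \<le> max 1 C * (15 * e / \<delta>^4)"
  proof (intro mult_mono frac_le)
    show "\<delta>^4 \<le> \<delta>^3" using \<delta> \<delta>_le_1[OF s(1)] by (intro power_decreasing) auto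
  qed (use e0 \<delta> C in auto)
  finally show "cmod (s - s') * cmod ?u' \<le> K * e" by (simp add: K_def mult_ac)
  have "15 * e / \<delta>^4 \<le> max 1 C * (15 * e / \<delta>^4)" using e0 \<delta> mult_right_mono[of 1 "max 1 C" "15 * e / \<delta>^4"] by simp
  then show "cmod (?u - ?u') \<le> K * e" using ob(2) by (simp add: K_def mult_ac)
qed

text \<open>The factor by which a discrepancy may grow from one superblock to the preceding one. Two
  consecutive positions are at most \<open>8 * b\<close> letters apart, and up to three further
  letters \<open>i0\<close> come from the power \<open>j\<close>.\<close>

definition H :: "nat \<Rightarrow> real" where "H b = K * (1 + (8 * b + 3) * M) * L ^ (8 * b)"

lemma H_ge: assumes "s \<in> V" shows "L ^ (8 * b) \<le> H b" and "1 \<le> H b"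
proof -
  have "1 * 1 * L ^ (8 * b) \<le> K * (1 + (8 * b + 3) * M) * L ^ (8 * b)"
    using K_ge_1[OF assms] M_nonneg L by (intro mult_mono) auto
  then show "L ^ (8 * b) \<le> H b" unfolding H_def by simp
  then show "1 \<le> H b" using one_le_power[OF L, of "8 * b"] by linarith
qed

text \<open>An observation at superblock \<open>m\<close> is \<open>Re (u * exp (s * w))\<close>,
  where \<open>u\<close> is the frequency at the next position and \<open>w\<close> a bounded
  exponent. Although \<open>u\<close> may be huge, \<open>obs_control\<close> bounds both
  \<open>u - u'\<close> and the product of \<open>s - s'\<close> with \<open>u'\<close>. Fictitious
  observations are covered as well, since they are given by the same formula.\<close>

lemma obs_step:
  assumes b: "1 \<le> b" and s: "s \<in> V" "s' \<in> V"
    and e: "\<And>j. j < 4 \<Longrightarrow> \<bar>obs b \<omega> (Suc m) (s, \<zeta>) j - obs b \<omega> (Suc m) (s', \<zeta>') j\<bar> \<le> e"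
    and j: "j < 4"
  shows "\<bar>obs b \<omega> m (s, \<zeta>) j - obs b \<omega> m (s', \<zeta>') j\<bar> \<le> H b * e"
proof -
  let ?n = "pos b \<omega> m" and ?n' = "pos b \<omega> (Suc m)"
  have nn: "?n \<le> ?n'" "?n' - ?n \<le> 8 * b"
    using pos_bounds[OF b, where m = m and \<omega> = \<omega>] pos_bounds[OF b, where m = "Suc m" and \<omega> = \<omega>] by (auto simp: algebra_simps)
  let ?A = "{?n..<?n'}"
  \<comment> \<open>\<open>w\<close> undoes the letters between the two positions and adds the
    \<open>j\<close> multiplications by \<open>exp (\<beta> i0 * s)\<close>.\<close>
  define w where "w = of_nat j * \<beta> i0 - (\<Sum>i\<in>?A. \<beta> (\<omega> i))"
  let ?u = "freq \<omega> s \<zeta> ?n'" and ?u' = "freq \<omega> s' \<zeta>' ?n'"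
  have obs_eq: "obs b \<omega> m (s, \<zeta>) j = Re (freq \<omega> s \<zeta> ?n' * exp (s * w))" for s \<zeta>
  proof -
    have "exp (\<beta> i0 * s) ^ j = exp (s * (of_nat j * \<beta> i0))"
      by (simp add: exp_of_nat_mult[symmetric] mult_ac)
    moreover have "exp (s * w) = exp (s * (- (\<Sum>i\<in>?A. \<beta> (\<omega> i)))) * exp (s * (of_nat j * \<beta> i0))"
      by (simp add: w_def exp_add[symmetric] algebra_simps)
    ultimately show ?thesis
      unfolding obs_def prod.case freq_earlier[OF nn(1), of \<omega> s \<zeta>] by (simp only: mult.assoc)
  qed
  have ew: "cmod (exp (s * w)) \<le> L ^ (8 * b)" if "s \<in> V" for s
  proof -
    have "exp (s * w) = exp (s * (- (\<Sum>i\<in>?A. \<beta> (\<omega> i)))) * exp (\<beta> i0 * s) ^ j"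
      by (simp add: w_def exp_of_nat_mult[symmetric] exp_add[symmetric] algebra_simps)
    then have "cmod (exp (s * w)) = cmod (exp (s * (- (\<Sum>i\<in>?A. \<beta> (\<omega> i))))) * cmod (exp (\<beta> i0 * s)) ^ j"
      by (simp add: norm_mult norm_power)
    also have "\<dots> \<le> L ^ card ?A * 1"
      using norm_exp_sum_le(2)[OF that, of ?A \<omega>] L
      by (intro mult_mono norm_power_le_1[OF that]) auto
    also have "\<dots> \<le> L ^ (8 * b)" using nn(2) L by (simp add: power_increasing)
    finally show ?thesis .
  qed
  have wM: "cmod w \<le> (8 * b + 3) * M"
  proof -
    have "cmod w \<le> j * cmod (\<beta> i0) + (\<Sum>i\<in>?A. cmod (\<beta> (\<omega> i)))"
      unfolding w_def using norm_triangle_ineq4[of "of_nat j * \<beta> i0" "\<Sum>i\<in>?A. \<beta> (\<omega> i)"] norm_sum[of "\<lambda>i. \<beta> (\<omega> i)" ?A]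
      by (simp add: norm_mult)
    also have "\<dots> \<le> 3 * M + (\<Sum>i\<in>?A. M)"
      using j M M_nonneg by (intro add_mono mult_mono sum_mono) auto
    also have "\<dots> = (3 + real (?n' - ?n)) * M" by (simp add: algebra_simps)
    also have "\<dots> \<le> (3 + real (8 * b)) * M" using nn(2) M_nonneg by (intro mult_right_mono add_left_mono) (auto simp only: of_nat_le_iff)
    finally show ?thesis by (simp add: algebra_simps)
  qed
  have lip: "cmod (exp (s * w) - exp (s' * w)) \<le> (8 * b + 3) * M * L ^ (8 * b) * cmod (s - s')"
  proof (rule field_differentiable_bound[OF convex _ _ s(1,2)])
    fix z assume "z \<in> V"
    show "((\<lambda>z. exp (z * w)) has_field_derivative exp (z * w) * w) (at z within V)"
      by (auto intro!: derivative_eq_intros)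
    show "cmod (exp (z * w) * w) \<le> (8 * b + 3) * M * L ^ (8 * b)"
      using ew[OF \<open>z \<in> V\<close>] wM M_nonneg L unfolding norm_mult
      by (subst mult.commute) (intro mult_mono, auto)
  qed
  have ctrl: "cmod (s - s') * cmod ?u' \<le> K * e" "cmod (?u - ?u') \<le> K * e"
    using obs_control[OF s e] by auto
  have "\<bar>obs b \<omega> m (s, \<zeta>) j - obs b \<omega> m (s', \<zeta>') j\<bar> \<le> cmod (?u * exp (s * w) - ?u' * exp (s' * w))"
    unfolding obs_eq using abs_Re_le_cmod[of "?u * exp (s * w) - ?u' * exp (s' * w)"] by simp
  \<comment> \<open>In this splitting the large frequency \<open>?u'\<close> meets only the
    difference of the exponentials, hence a multiple of \<open>s - s'\<close>.\<close>
  also have "?u * exp (s * w) - ?u' * exp (s' * w) = (?u - ?u') * exp (s * w) + ?u' * (exp (s * w) - exp (s' * w))"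
    by (simp add: algebra_simps)
  also have "cmod \<dots> \<le> cmod (?u - ?u') * cmod (exp (s * w)) + cmod ?u' * cmod (exp (s * w) - exp (s' * w))"
    by (metis norm_mult norm_triangle_ineq)
  also have "\<dots> \<le> (K * e) * L ^ (8 * b) + cmod ?u' * ((8 * b + 3) * M * L ^ (8 * b) * cmod (s - s'))"
    using ctrl(2) ew[OF s(1)] lip L order_trans[OF norm_ge_zero ctrl(2)] by (intro add_mono mult_mono) auto
  also have "cmod ?u' * ((8 * b + 3) * M * L ^ (8 * b) * cmod (s - s'))
      = (8 * b + 3) * M * L ^ (8 * b) * (cmod (s - s') * cmod ?u')"
    by (simp only: mult_ac)
  also have "\<dots> \<le> (8 * b + 3) * M * L ^ (8 * b) * (K * e)"
    using ctrl(1) M_nonneg L by (intro mult_left_mono) auto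
  finally show ?thesis by (simp add: H_def algebra_simps)
qed

section \<open>Counting the nearest integers along a history\<close>

definition code :: "nat \<Rightarrow> (nat \<Rightarrow> 'i) \<Rightarrow> nat \<Rightarrow> complex \<times> complex \<Rightarrow> int \<times> int \<times> int \<times> int" where
  "code b \<omega> m p = (round (obs b \<omega> m p 0), round (obs b \<omega> m p 1), round (obs b \<omega> m p 2), round (obs b \<omega> m p 3))"

lemma code_eqD:
  assumes "code b \<omega> m p = code b \<omega> m p'" "j < 4"
  shows "round (obs b \<omega> m p j) = round (obs b \<omega> m p' j)"
proof -
  have "j = 0 \<or> j = 1 \<or> j = 2 \<or> j = 3" using assms(2) by linarith
  then show ?thesis using assms(1) by (auto simp: code_def)
qed

lemma same_code_obs:
  assumes "code b \<omega> m p = code b \<omega> m p'" "j < 4"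
  shows "\<bar>obs b \<omega> m p j - obs b \<omega> m p' j\<bar> \<le> 1"
  using code_eqD[OF assms] of_int_round_abs_le[of "obs b \<omega> m p j"] of_int_round_abs_le[of "obs b \<omega> m p' j"]
  by (simp only: abs_le_iff) linarith

text \<open>Four integers, each in a window of radius \<open>H b + 1/2\<close>, which holds at most
  \<open>2 * H b + 2\<close> of them.\<close>

definition W :: "nat \<Rightarrow> real" where "W b = (2 * H b + 2)^4"

text \<open>Equal codes keep the observations within 1 of each other; one step back they are within
  \<open>H b\<close>, and rounding adds another half.\<close>

lemma card_next_code:
  assumes b: "1 \<le> b" and G: "\<And>p. p \<in> G \<Longrightarrow> fst p \<in> V"
    and same: "\<And>p p'. p \<in> G \<Longrightarrow> p' \<in> G \<Longrightarrow> code b \<omega> (Suc m) p = code b \<omega> (Suc m) p'"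
    and ne: "p0 \<in> G"
  shows "finite (code b \<omega> m ` G)" and "real (card (code b \<omega> m ` G)) \<le> W b"
proof -
  have H: "1 \<le> H b" using H_ge(2) G[OF ne] by blast
  have near: "\<bar>of_int (round (obs b \<omega> m p j)) - obs b \<omega> m p0 j\<bar> \<le> H b + 1/2" if "p \<in> G" "j < 4" for p j
  proof -
    have "\<bar>obs b \<omega> m p j - obs b \<omega> m p0 j\<bar> \<le> H b * 1"
      using obs_step[OF b, of "fst p" "fst p0" \<omega> m "snd p" "snd p0" 1 j] same_code_obs[OF same[OF that(1) ne]]
        G that ne by simp
    then show ?thesis using of_int_round_abs_le[of "obs b \<omega> m p j"] by (simp only: abs_le_iff) linarith
  qed
  have *: "\<bar>of_int k0 - obs b \<omega> m p0 0\<bar> \<le> H b + 1/2 \<and> \<bar>of_int k1 - obs b \<omega> m p0 1\<bar> \<le> H b + 1/2 \<and>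
      \<bar>of_int k2 - obs b \<omega> m p0 2\<bar> \<le> H b + 1/2 \<and> \<bar>of_int k3 - obs b \<omega> m p0 3\<bar> \<le> H b + 1/2"
    if "(k0, k1, k2, k3) \<in> code b \<omega> m ` G" for k0 k1 k2 k3
    using that near by (auto simp: code_def)
  note q = card_quads_near[of "H b + 1/2" "code b \<omega> m ` G" "obs b \<omega> m p0", OF _ *]
  show "finite (code b \<omega> m ` G)" using q(1) H by simp
  show "real (card (code b \<omega> m ` G)) \<le> W b" using q(2) H by (simp add: W_def algebra_simps)
qed

text \<open>Observations close to the same integers differ by at most \<open>2 * \<epsilon>\<close>,
  hence by at most \<open>H b * (2 * \<epsilon>)\<close> one step back. If those are close to
  integers too, the integers differ by at most \<open>2 * \<epsilon> * (H b + 1) = 1/2\<close>, so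
  they agree; this equation is where \<open>\<epsilon>\<close> comes from.\<close>

lemma unique_next_code:
  assumes b: "1 \<le> b" and s: "fst p \<in> V" "fst p' \<in> V"
    and same: "code b \<omega> (Suc m) p = code b \<omega> (Suc m) p'"
    and \<epsilon>: "\<epsilon> = 1 / (4 * (H b + 1))"
    and close: "close b \<epsilon> \<omega> (Suc m) p" "close b \<epsilon> \<omega> (Suc m) p'" "close b \<epsilon> \<omega> m p" "close b \<epsilon> \<omega> m p'"
  shows "code b \<omega> m p = code b \<omega> m p'"
proof -
  have H: "1 \<le> H b" using H_ge(2) s by blast
  have "round (obs b \<omega> m p j) = round (obs b \<omega> m p' j)" if j: "j < 4" for j
  proof -
    have "\<bar>obs b \<omega> (Suc m) p i - obs b \<omega> (Suc m) p' i\<bar> \<le> 2 * \<epsilon>" if "i < 4" for i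
      using close(1,2) code_eqD[OF same that] that unfolding close_def by fastforce
    then have "\<bar>obs b \<omega> m p j - obs b \<omega> m p' j\<bar> \<le> H b * (2 * \<epsilon>)"
      using obs_step[OF b, of "fst p" "fst p'" \<omega> m "snd p" "snd p'" "2 * \<epsilon>" j] s j by simp
    moreover have "\<bar>obs b \<omega> m p j - of_int (round (obs b \<omega> m p j))\<bar> \<le> \<epsilon>"
      "\<bar>obs b \<omega> m p' j - of_int (round (obs b \<omega> m p' j))\<bar> \<le> \<epsilon>"
      using close(3,4) j unfolding close_def by auto
    ultimately have "\<bar>of_int (round (obs b \<omega> m p j)) - of_int (round (obs b \<omega> m p' j)) :: real\<bar> \<le> H b * (2 * \<epsilon>) + 2 * \<epsilon>"
      by linarith
    also have "\<dots> = 2 * \<epsilon> * (H b + 1)" by (simp add: algebra_simps)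
    also have "\<dots> < 1" unfolding \<epsilon> using H by (simp add: divide_simps)
    finally have "\<bar>round (obs b \<omega> m p j) - round (obs b \<omega> m p' j)\<bar> < 1"
      by (metis of_int_abs of_int_diff of_int_less_1_iff)
    then show ?thesis by simp
  qed
  then show ?thesis by (simp add: code_def)
qed

text \<open>The start of a history, at the lowest frequency: the normalisation bounds the frequency
  by \<open>L^(8*b)\<close> throughout this superblock, so the integers lie near 0.\<close>

lemma card_first_code:
  assumes b: "1 \<le> b" and G: "\<And>s \<zeta>. (s, \<zeta>) \<in> G \<Longrightarrow> s \<in> V \<and> cmod (freq \<omega> s \<zeta> (4*b*Suc m)) \<le> L^(4*b)"
    and ne: "p0 \<in> G"
  shows "finite (code b \<omega> m ` G)" and "real (card (code b \<omega> m ` G)) \<le> W b"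
proof -
  have V0: "fst p0 \<in> V" using G[of "fst p0" "snd p0"] ne by simp
  have H: "1 \<le> H b" using H_ge(2) V0 by blast
  have near: "\<bar>of_int (round (obs b \<omega> m (s, \<zeta>) j)) - 0\<bar> \<le> H b + 1/2" if "(s, \<zeta>) \<in> G" "j < 4" for s \<zeta> j
  proof -
    have s: "s \<in> V" "cmod (freq \<omega> s \<zeta> (4*b*Suc m)) \<le> L^(4*b)" using G[OF that(1)] by auto
    let ?n = "pos b \<omega> m"
    have n: "?n \<le> 4*b*Suc m" "4*b*Suc m - ?n \<le> 4*b" using pos_bounds[OF b, where m = m and \<omega> = \<omega>] by (auto simp: algebra_simps)
    have "\<bar>obs b \<omega> m (s, \<zeta>) j\<bar> \<le> cmod (freq \<omega> s \<zeta> ?n) * cmod (exp (\<beta> i0 * s)) ^ j"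
      unfolding obs_def prod.case norm_power[symmetric] norm_mult[symmetric] by (rule abs_Re_le_cmod)
    also have "\<dots> \<le> cmod (freq \<omega> s \<zeta> ?n) * 1"
      by (intro mult_left_mono norm_power_le_1[OF s(1)]) auto
    also have "\<dots> \<le> cmod (freq \<omega> s \<zeta> (4*b*Suc m)) * L ^ (4*b*Suc m - ?n)"
      using freq_earlier_le[OF s(1) n(1)] by simp
    also have "\<dots> \<le> L^(4*b) * L^(4*b)"
      using s(2) n(2) L by (intro mult_mono power_increasing) auto
    also have "\<dots> = L^(8*b)" by (simp flip: power_add)
    also have "\<dots> \<le> H b" using H_ge(1)[OF s(1)] .
    finally show ?thesis using of_int_round_abs_le[of "obs b \<omega> m (s, \<zeta>) j"] by (simp only: abs_le_iff) linarith
  qed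
  have *: "\<bar>of_int k0 - 0\<bar> \<le> H b + 1/2 \<and> \<bar>of_int k1 - 0\<bar> \<le> H b + 1/2 \<and>
      \<bar>of_int k2 - 0\<bar> \<le> H b + 1/2 \<and> \<bar>of_int k3 - 0\<bar> \<le> H b + 1/2"
    if "(k0, k1, k2, k3) \<in> code b \<omega> m ` G" for k0 k1 k2 k3
    using that near by (auto simp: code_def)
  note q = card_quads_near[of "H b + 1/2" "code b \<omega> m ` G" "\<lambda>_. 0", OF _ *]
  show "finite (code b \<omega> m ` G)" using q(1) H by simp
  show "real (card (code b \<omega> m ` G)) \<le> W b" using q(2) H by (simp add: W_def algebra_simps)
qed

lemma W_ge_1: assumes "s \<in> V" shows "1 \<le> W b"
  unfolding W_def using H_ge(2)[OF assms, of b] by (intro one_le_power) simp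

text \<open>Once the set \<open>Q\<close> of irregular superblocks is fixed, at most
  \<open>2^N\<close> ways, a history branches only next to \<open>Q\<close>, and two parameters with
  the same history agree in their code at superblock 0, where the frequency is exponentially
  large.\<close>

lemma exceptional_cover:
  fixes \<kappa> :: real
  assumes b: "1 \<le> b" and N: "1 \<le> N" and \<epsilon>: "\<epsilon> = 1 / (4 * (H b + 1))"
    and bad: "real (card {m. m < N \<and> \<not> good b \<omega> m}) \<le> \<kappa> * N"
  shows "\<exists>\<F>. finite \<F> \<and> exceptional b \<epsilon> \<kappa> N \<omega> \<subseteq> \<Union>\<F> \<and>
    real (card \<F>) \<le> 2^N * W b powr (1 + 4 * \<kappa> * N) \<and>
    (\<forall>F\<in>\<F>. \<forall>x\<in>F. \<forall>y\<in>F. dist x y \<le> K * c^(4*b*(N - 1)))"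
proof (cases "V = {}")
  case True
  then have "exceptional b \<epsilon> \<kappa> N \<omega> = {}" unfolding exceptional_def by blast
  then show ?thesis by (intro exI[of _ "{}"]) auto
next
  case False
  then have W1: "1 \<le> W b" using W_ge_1 by blast
  define nc where "nc p = {m. m < N \<and> \<not> (good b \<omega> m \<and> close b \<epsilon> \<omega> m p)}" for p
  define F where "F Q = {(s, \<zeta>). s \<in> V \<and> 1 \<le> cmod (freq \<omega> s \<zeta> (4*b*N)) \<and> cmod (freq \<omega> s \<zeta> (4*b*N)) \<le> L^(4*b) \<and>
    nc (s, \<zeta>) = Q}" for Q
  \<comment> \<open>At most \<open>\<kappa> * N\<close> superblocks are not good, and at most as
    many are good but not close; together these give \<open>2 * \<kappa> * N\<close>.\<close>
  define \<Q> where "\<Q> = {Q. Q \<subseteq> {..<N} \<and> real (card Q) \<le> 2 * \<kappa> * N}"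
  \<comment> \<open>Time is reversed: entry \<open>i\<close> belongs to superblock
    \<open>N - 1 - i\<close>, so histories run from low to high frequency.\<close>
  define hist where "hist p = map (\<lambda>i. code b \<omega> (N - 1 - i) p) [0..<N]" for p
  define \<F> where "\<F> Q = (\<lambda>h. fst ` {p\<in>F Q. hist p = h}) ` hist ` F Q" for Q
  have fin\<Q>: "finite \<Q>" by (rule finite_subset[of _ "Pow {..<N}"]) (auto simp: \<Q>_def)
  have card\<Q>: "card \<Q> \<le> 2^N"
    using card_mono[of "Pow {..<N}" \<Q>] by (auto simp: \<Q>_def card_Pow)
  have count: "finite (hist ` F Q) \<and> real (card (hist ` F Q)) \<le> W b ^ (1 + 2 * card Q)" if Q: "Q \<subseteq> {..<N}" for Q
  proof -
    \<comment> \<open>The levels at which a history may branch: the start, and each transition with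
      one of its two superblocks in \<open>Q\<close>. Each element of \<open>Q\<close> spoils at
      most two transitions.\<close>
    define B where "B = {i. i < N \<and> (i = 0 \<or> N - 1 - i \<in> Q \<or> N - i \<in> Q)}"
    define w where "w i = (if i \<in> B then W b else 1)" for i
    let ?code = "\<lambda>i. code b \<omega> (N - 1 - i)"
    have finQ: "finite Q" using Q finite_subset by blast
    have step: "finite (?code n ` {p'\<in>F Q. \<forall>i<n. ?code i p' = ?code i p}) \<and>
        real (card (?code n ` {p'\<in>F Q. \<forall>i<n. ?code i p' = ?code i p})) \<le> w n"
      if n: "n < N" and p: "p \<in> F Q" for n p
    proof -
      let ?G = "{p'\<in>F Q. \<forall>i<n. ?code i p' = ?code i p}"
      have pG: "p \<in> ?G" using p by simp
      have GV: "fst p' \<in> V" if "p' \<in> ?G" for p' using that by (auto simp: F_def)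
      show ?thesis
      proof (cases "n = 0")
        case True
        have "N - 1 - n = N - 1" "Suc (N - 1) = N" using True N by auto
        then show ?thesis using card_first_code[OF b _ pG, of \<omega> "N - 1"] True N
          by (auto simp: F_def w_def B_def)
      next
        case False
        have Suc_eq: "Suc (N - 1 - n) = N - 1 - (n - 1)" "Suc (N - 1 - n) = N - n" using False n by auto
        have same: "code b \<omega> (Suc (N - 1 - n)) q = code b \<omega> (Suc (N - 1 - n)) q'" if "q \<in> ?G" "q' \<in> ?G" for q q'
        proof -
          have "n - 1 < n" using False by simp
          then show ?thesis using that unfolding Suc_eq(1) by fastforce
        qed
        note cn = card_next_code[OF b GV same pG]
        show ?thesis
        proof (cases "n \<in> B")
          case True
          then show ?thesis using cn by (simp add: w_def)
        next
          case nB: False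
          then have nQ: "N - 1 - n \<notin> Q" "N - n \<notin> Q" using n by (auto simp: B_def)
          have cl: "close b \<epsilon> \<omega> m q" if "q \<in> ?G" "m < N" "m \<notin> Q" for q m
            using that by (auto simp: F_def nc_def)
          have "?code n q = ?code n p" if q: "q \<in> ?G" for q
          proof (rule unique_next_code[OF b GV[OF q] GV[OF pG] same[OF q pG] \<epsilon>])
            have *: "Suc (N - 1 - n) < N" "Suc (N - 1 - n) \<notin> Q" using Suc_eq False n nQ by auto
            show "close b \<epsilon> \<omega> (Suc (N - 1 - n)) q" using cl[OF q *] .
            show "close b \<epsilon> \<omega> (Suc (N - 1 - n)) p" using cl[OF pG *] .
            show "close b \<epsilon> \<omega> (N - 1 - n) q" using cl[OF q _ nQ(1)] n by simp
            show "close b \<epsilon> \<omega> (N - 1 - n) p" using cl[OF pG _ nQ(1)] n by simp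
          qed
          then have sub: "?code n ` ?G \<subseteq> {?code n p}" by blast
          have "card (?code n ` ?G) \<le> 1" using card_mono[OF _ sub] by simp
          moreover have "finite (?code n ` ?G)" using finite_subset[OF sub] by simp
          ultimately show ?thesis using nB by (simp add: w_def)
        qed
      qed
    qed
    have "finite (hist ` F Q) \<and> real (card (hist ` F Q)) \<le> (\<Prod>n<N. w n)"
      unfolding hist_def using step W1 by (intro card_histories) (auto simp: w_def)
    moreover have "(\<Prod>n<N. w n) = W b ^ card B"
    proof -
      have "(\<Prod>n<N. w n) = (\<Prod>n\<in>{n\<in>{..<N}. n \<in> B}. W b)"
        unfolding w_def by (subst prod.inter_filter) auto
      also have "{n\<in>{..<N}. n \<in> B} = B" by (auto simp: B_def)
      finally show ?thesis by simp
    qed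
    moreover have "card B \<le> 1 + 2 * card Q"
    proof -
      have "B \<subseteq> {0} \<union> ((\<lambda>m. N - 1 - m) ` Q \<union> (\<lambda>m. N - m) ` Q)" (is "_ \<subseteq> ?R")
      proof
        fix i assume i: "i \<in> B"
        then have "i < N" by (simp add: B_def)
        then have "i = N - 1 - (N - 1 - i)" "i = N - (N - i)" by auto
        then show "i \<in> ?R" using i unfolding B_def by blast
      qed
      then have "card B \<le> card ?R" using finQ by (intro card_mono) auto
      also have "\<dots> \<le> card {0::nat} + (card ((\<lambda>m. N - 1 - m) ` Q) + card ((\<lambda>m. N - m) ` Q))"
        by (meson add_left_mono card_Un_le order_trans)
      also have "\<dots> \<le> 1 + (card Q + card Q)" using finQ by (intro add_mono card_image_le) auto
      finally show ?thesis by simp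
    qed
    ultimately show ?thesis using power_increasing[OF _ W1, of "card B" "1 + 2 * card Q"] by auto
  qed
  have count': "finite (\<F> Q) \<and> real (card (\<F> Q)) \<le> W b powr (1 + 4 * \<kappa> * N)" if Q: "Q \<in> \<Q>" for Q
  proof -
    have Q': "Q \<subseteq> {..<N}" "real (card Q) \<le> 2 * \<kappa> * N" using Q by (auto simp: \<Q>_def)
    have "real (card (\<F> Q)) \<le> real (card (hist ` F Q))"
      unfolding \<F>_def using count[OF Q'(1)] by (simp add: card_image_le)
    also have "\<dots> \<le> W b ^ (1 + 2 * card Q)" using count[OF Q'(1)] by simp
    also have "\<dots> = W b powr (1 + 2 * card Q)" using W1 powr_realpow[of "W b" "1 + 2 * card Q"] by simp
    also have "\<dots> \<le> W b powr (1 + 4 * \<kappa> * N)" using W1 Q'(2) by (intro powr_mono) auto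
    finally show ?thesis using count[OF Q'(1)] by (simp add: \<F>_def)
  qed
  have fin: "finite (\<Union>Q\<in>\<Q>. \<F> Q)" using fin\<Q> count' by blast
  have "real (card (\<Union>Q\<in>\<Q>. \<F> Q)) \<le> (\<Sum>Q\<in>\<Q>. real (card (\<F> Q)))"
    using card_UN_le[OF fin\<Q>, of \<F>] by (simp flip: of_nat_sum)
  also have "\<dots> \<le> (\<Sum>Q\<in>\<Q>. W b powr (1 + 4 * \<kappa> * N))" using count' by (intro sum_mono) auto
  also have "\<dots> \<le> 2^N * W b powr (1 + 4 * \<kappa> * N)"
    using card\<Q> by (simp add: mult_right_mono numeral_power_le_of_nat_cancel_iff of_nat_le_numeral_power_cancel_iff)
  finally have card: "real (card (\<Union>Q\<in>\<Q>. \<F> Q)) \<le> 2^N * W b powr (1 + 4 * \<kappa> * N)" .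
  have sub: "exceptional b \<epsilon> \<kappa> N \<omega> \<subseteq> \<Union>(\<Union>Q\<in>\<Q>. \<F> Q)"
  proof
    fix s assume "s \<in> exceptional b \<epsilon> \<kappa> N \<omega>"
    then obtain \<zeta> where s: "s \<in> V" "1 \<le> cmod (freq \<omega> s \<zeta> (4*b*N))" "cmod (freq \<omega> s \<zeta> (4*b*N)) \<le> L^(4*b)"
      and few: "real (card {m. m < N \<and> good b \<omega> m \<and> \<not> close b \<epsilon> \<omega> m (s, \<zeta>)}) \<le> \<kappa> * N"
      unfolding exceptional_def by blast
    let ?Q = "nc (s, \<zeta>)"
    have "?Q = {m. m < N \<and> \<not> good b \<omega> m} \<union> {m. m < N \<and> good b \<omega> m \<and> \<not> close b \<epsilon> \<omega> m (s, \<zeta>)}"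
      by (auto simp: nc_def)
    then have "card ?Q \<le> card {m. m < N \<and> \<not> good b \<omega> m} + card {m. m < N \<and> good b \<omega> m \<and> \<not> close b \<epsilon> \<omega> m (s, \<zeta>)}"
      by (metis card_Un_le)
    then have "?Q \<in> \<Q>" using few bad by (auto simp: \<Q>_def nc_def)
    moreover have "(s, \<zeta>) \<in> F ?Q" using s by (simp add: F_def)
    ultimately show "s \<in> \<Union>(\<Union>Q\<in>\<Q>. \<F> Q)" unfolding \<F>_def by force
  qed
  have diam: "dist x y \<le> K * c^(4*b*(N - 1))" if X: "X \<in> (\<Union>Q\<in>\<Q>. \<F> Q)" "x \<in> X" "y \<in> X" for X x y
  proof -
    obtain Q \<zeta> \<zeta>' where F: "(x, \<zeta>) \<in> F Q" "(y, \<zeta>') \<in> F Q" and h: "hist (x, \<zeta>) = hist (y, \<zeta>')"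
      using X unfolding \<F>_def by auto
    have V: "x \<in> V" "y \<in> V" "1 \<le> cmod (freq \<omega> y \<zeta>' (4*b*N))" using F by (auto simp: F_def)
    have "hist (x, \<zeta>) ! (N - 1) = hist (y, \<zeta>') ! (N - 1)" using h by simp
    then have code0: "code b \<omega> 0 (x, \<zeta>) = code b \<omega> 0 (y, \<zeta>')" using N by (simp add: hist_def)
    let ?u = "cmod (freq \<omega> y \<zeta>' (pos b \<omega> 0))"
    have 1: "cmod (x - y) * ?u \<le> K"
      using obs_control(1)[OF V(1,2) same_code_obs[OF code0]] by simp
    have "4 * b * N = 4 * b * (N - 1) + 4 * b" using N by (cases N) auto
    \<comment> \<open>The position in superblock 0 is followed by at least \<open>N - 1\<close> full
      superblocks, all contracting, before the frequency has come down to its normalised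
      size.\<close>
    then have p: "pos b \<omega> 0 \<le> 4*b*N" "4*b*(N - 1) \<le> 4*b*N - pos b \<omega> 0"
      using pos_bounds(2)[OF b, where m = 0 and \<omega> = \<omega>] by simp_all
    have "1 \<le> ?u * c ^ (4*b*N - pos b \<omega> 0)" using V(3) freq_later_le[OF V(2) p(1), of \<omega> \<zeta>'] by linarith
    also have "\<dots> \<le> ?u * c ^ (4*b*(N - 1))" using p(2) c by (intro mult_left_mono power_decreasing) auto
    finally have "cmod (x - y) * 1 \<le> cmod (x - y) * (?u * c ^ (4*b*(N - 1)))" by (intro mult_left_mono) auto
    also have "\<dots> = (cmod (x - y) * ?u) * c ^ (4*b*(N - 1))" by simp
    also have "\<dots> \<le> K * c ^ (4*b*(N - 1))" using 1 c by (intro mult_right_mono) auto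
    finally show ?thesis by (simp add: dist_norm)
  qed
  show ?thesis using fin sub card diam by (intro exI[of _ "\<Union>Q\<in>\<Q>. \<F> Q"]) blast
qed

text \<open>For a given \<open>\<xi>\<close>, \<open>N\<close> is chosen so that \<open>N\<close>
  superblocks bring the frequency down to order one, so \<open>N\<close> is at least of order
  \<open>ln (cmod \<xi>)\<close>. Off the exceptional sets more than \<open>\<kappa> * N\<close> of
  these superblocks contain a factor of modulus at most \<open>\<gamma>\<close>.\<close>

lemma Fourier_decay:
  fixes \<kappa> :: real
  assumes s: "s \<in> V" and b: "1 \<le> b" and \<epsilon>: "0 < \<epsilon>" "\<epsilon> \<le> 1/2" and \<kappa>: "0 < \<kappa>"
    and not_exc: "\<And>N. N0 \<le> N \<Longrightarrow> s \<notin> exceptional b \<epsilon> \<kappa> N \<omega>"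
    and model: "planar_model k t p (\<lambda>i. exp (\<beta> i * s))"
    and j: "j1 < k i0" "j2 < k i0" "t i0 j1 \<noteq> t i0 j2"
  shows "eta k t p (\<lambda>i. exp (\<beta> i * s)) \<omega> \<in> D2"
proof -
  let ?\<eta> = "eta k t p (\<lambda>i. exp (\<beta> i * s)) \<omega>"
  have p: "\<And>i j. j < k i \<Longrightarrow> 0 < p i j" "\<And>i. (\<Sum>j<k i. p i j) = 1"
    using model by (auto simp: planar_model_def)
  define a where "a = t i0 j1 - t i0 j2"
  have a: "a \<noteq> 0" using j(3) by (simp add: a_def)
  have "j1 \<noteq> j2" using j(3) by auto
  then obtain \<gamma> where \<gamma>: "0 < \<gamma>" "\<gamma> < 1" and gap: "\<And>y. \<epsilon> \<le> \<bar>(y j1 - y j2) - of_int (round (y j1 - y j2))\<bar> \<Longrightarrow>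
           cmod (\<Sum>j<k i0. p i0 j * cis (2 * pi * y j)) \<le> \<gamma>"
    using digit_sum_gap[of "k i0" "p i0" j1 j2 \<epsilon>] p j \<epsilon> by blast
  have L1: "1 < L"
  proof -
    have "1 = cmod (exp (- \<beta> i0 * s)) * cmod (exp (\<beta> i0 * s))" by (simp flip: norm_mult exp_add)
    also have "\<dots> \<le> L * c" using expansion[OF s, of i0] contracting[OF s, of i0] L by (intro mult_mono) auto
    also have "\<dots> < L * 1" using c L by (intro mult_strict_left_mono) auto
    finally show ?thesis by simp
  qed
  \<comment> \<open>The most by which one superblock can shrink a frequency.\<close>
  define R where "R = L ^ (4 * b)"
  have R: "1 < R" unfolding R_def using L1 b by (intro one_less_power) auto
  define \<Lambda> where "\<Lambda> n = (\<Prod>j<n. exp (\<beta> (\<omega> j) * s))" for n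
  have \<Lambda>: "\<zeta> * \<Lambda> n = freq \<omega> s \<zeta> n" for \<zeta> n
    by (simp add: \<Lambda>_def freq_def sum_distrib_left exp_sum mult.commute)
  define \<phi> where "\<phi> \<xi> n = (\<Sum>j<k (\<omega> n). p (\<omega> n) j * cis (2 * pi * Re (\<Lambda> n * t (\<omega> n) j * cnj \<xi>)))" for \<xi> n
  have prod_bound: "cmod (fourier_transform ?\<eta> \<xi>) \<le> (\<Prod>n<N. cmod (\<phi> \<xi> n))" for \<xi> N
    unfolding \<phi>_def \<Lambda>_def by (rule norm_fourier_eta_le[OF model])
  have le1: "cmod (fourier_transform ?\<eta> \<xi>) \<le> 1" for \<xi> using prod_bound[of \<xi> 0] by simp
  have \<phi>1: "cmod (\<phi> \<xi> n) \<le> 1" for \<xi> n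
    unfolding \<phi>_def using p by (intro norm_digit_sum_le_1) auto
  have block: "cmod (fourier_transform ?\<eta> \<xi>) \<le> \<gamma> powr (\<kappa> * N)"
    if N: "N0 \<le> N" and \<zeta>: "\<zeta> = a * cnj \<xi>" and scale: "1 \<le> cmod (freq \<omega> s \<zeta> (4*b*N))" "cmod (freq \<omega> s \<zeta> (4*b*N)) \<le> R" for N \<xi> \<zeta>
  proof -
    define A where "A = {m. m < N \<and> good b \<omega> m \<and> \<not> close b \<epsilon> \<omega> m (s, \<zeta>)}"
    have finA: "finite A" by (simp add: A_def)
    have cardA: "\<kappa> * N < card A"
      using not_exc[OF N] s scale unfolding exceptional_def A_def R_def by force
    \<comment> \<open>Goodness makes the observation genuine: the letters are \<open>i0\<close>, so
      the observed value is the difference between the phases of the maps \<open>j1\<close> and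
      \<open>j2\<close> at that time.\<close>
    have "\<exists>n. 4*b*m \<le> n \<and> n < 4*b*Suc m \<and> cmod (\<phi> \<xi> n) \<le> \<gamma>" if m: "m \<in> A" for m
    proof -
      obtain j where j': "j < 4" "\<epsilon> \<le> \<bar>obs b \<omega> m (s, \<zeta>) j - of_int (round (obs b \<omega> m (s, \<zeta>) j))\<bar>"
        using m unfolding A_def close_def by force
      have gm: "good b \<omega> m" using m by (simp add: A_def)
      let ?n = "pos b \<omega> m + j"
      have i0: "\<omega> ?n = i0" using pos_good[OF gm j'(1)] .
      have "(\<Sum>i\<in>{pos b \<omega> m..<?n}. \<beta> (\<omega> i)) = (\<Sum>i\<in>{pos b \<omega> m..<?n}. \<beta> i0)"
      proof (rule sum.cong[OF refl])
        fix i assume "i \<in> {pos b \<omega> m..<?n}"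
        then have "i = pos b \<omega> m + (i - pos b \<omega> m)" "i - pos b \<omega> m < 4" using j'(1) by auto
        then show "\<beta> (\<omega> i) = \<beta> i0" using pos_good[OF gm] by metis
      qed
      then have "freq \<omega> s \<zeta> ?n = freq \<omega> s \<zeta> (pos b \<omega> m) * exp (\<beta> i0 * s) ^ j"
        using freq_later[of "pos b \<omega> m" ?n \<omega> s \<zeta>] by (simp add: exp_of_nat_mult[symmetric] mult_ac)
      then have "obs b \<omega> m (s, \<zeta>) j = Re (\<zeta> * \<Lambda> ?n)" by (simp add: obs_def \<Lambda>)
      also have "\<dots> = Re (\<Lambda> ?n * t i0 j1 * cnj \<xi>) - Re (\<Lambda> ?n * t i0 j2 * cnj \<xi>)"
        unfolding \<zeta> a_def by (simp add: algebra_simps)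
      finally have "cmod (\<phi> \<xi> ?n) \<le> \<gamma>"
        using j'(2) unfolding \<phi>_def i0 by (intro gap) simp
      moreover have "4*b*m \<le> ?n" "?n < 4*b*Suc m"
        using pos_bounds[OF b, where m = m and \<omega> = \<omega>] j'(1) by auto
      ultimately show ?thesis by blast
    qed
    then obtain n where n: "\<And>m. m \<in> A \<Longrightarrow> 4*b*m \<le> n m" "\<And>m. m \<in> A \<Longrightarrow> n m < 4*b*Suc m"
      "\<And>m. m \<in> A \<Longrightarrow> cmod (\<phi> \<xi> (n m)) \<le> \<gamma>" by metis
    \<comment> \<open>The superblock is recovered from \<open>n m\<close>, so different superblocks
      contribute different factors and the gains multiply.\<close>
    have n_div: "n m div (4*b) = m" if "m \<in> A" for m
      using n(1,2)[OF that] by (intro div_nat_eqI) (auto simp: mult.commute)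
    then have inj: "inj_on n A" by (metis inj_onI)
    have sub: "n ` A \<subseteq> {..<4*b*N}"
    proof
      fix x assume "x \<in> n ` A"
      then obtain m where m: "m \<in> A" "x = n m" by blast
      then have "Suc m \<le> N" by (simp add: A_def)
      then have "4*b*Suc m \<le> 4*b*N" by (rule mult_le_mono2)
      then show "x \<in> {..<4*b*N}" using n(2)[OF m(1)] m(2) by simp
    qed
    have "cmod (fourier_transform ?\<eta> \<xi>) \<le> (\<Prod>n<4*b*N. cmod (\<phi> \<xi> n))" by (rule prod_bound)
    also have "\<dots> \<le> (\<Prod>i<4*b*N. if i \<in> n ` A then \<gamma> else 1)"
      using n(3) \<phi>1 by (intro prod_mono) auto
    also have "\<dots> = (\<Prod>i\<in>{i\<in>{..<4*b*N}. i \<in> n ` A}. \<gamma>)"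
      by (subst prod.inter_filter) auto
    also have "{i\<in>{..<4*b*N}. i \<in> n ` A} = n ` A" using sub by blast
    also have "(\<Prod>i\<in>n ` A. \<gamma>) = \<gamma> powr card A" using \<gamma>(1) by (simp add: card_image[OF inj] powr_realpow)
    also have "\<dots> \<le> \<gamma> powr (\<kappa> * N)" using cardA \<gamma> by (intro powr_mono') auto
    finally show ?thesis .
  qed
  \<comment> \<open>The shift by \<open>N0\<close> makes the estimate trivial for small
    \<open>N\<close>: its right side is then at least 1.\<close>
  have scale: "\<exists>N. cmod (a * cnj \<xi>) \<le> R ^ Suc N \<and> cmod (fourier_transform ?\<eta> \<xi>) \<le> \<gamma> powr (\<kappa> * (real N - real N0))" for \<xi>
  proof (cases "cmod (a * cnj \<xi>) < 1")
    case True
    have "1 \<le> \<gamma> powr (\<kappa> * (real 0 - real N0))"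
      using powr_mono'[of "\<kappa> * (real 0 - real N0)" 0 \<gamma>] \<gamma> \<kappa> by (simp add: mult_nonneg_nonpos)
    then show ?thesis using True R le1[of \<xi>] by (intro exI[of _ 0]) auto
  next
    case False
    define \<zeta> where "\<zeta> = a * cnj \<xi>"
    let ?f = "\<lambda>N. cmod (freq \<omega> s \<zeta> (4*b*N))"
    have "\<exists>N. ?f N < 1"
    proof -
      have "(\<lambda>n. cmod \<zeta> * c ^ n) \<longlonglongrightarrow> cmod \<zeta> * 0"
        using c by (intro tendsto_intros LIMSEQ_power_zero) auto
      then have "eventually (\<lambda>n. cmod \<zeta> * c ^ n < 1) sequentially" by (intro order_tendstoD) auto
      then obtain n where "\<forall>n'\<ge>n. cmod \<zeta> * c ^ n' < 1" unfolding eventually_sequentially by blast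
      moreover have "n \<le> 4 * b * n" using b by simp
      moreover have "?f n \<le> cmod \<zeta> * c ^ (4*b*n)"
        using freq_later_le[OF s, of 0 "4*b*n" \<omega> \<zeta>] by (simp add: freq_def)
      ultimately show ?thesis by (meson le_less_trans)
    qed
    \<comment> \<open>The first superblock boundary with frequency below one. One boundary earlier
      the frequency lies between 1 and \<open>R\<close>.\<close>
    define N' where "N' = (LEAST N. ?f N < 1)"
    have N': "?f N' < 1" unfolding N'_def by (rule LeastI_ex) fact
    have "?f 0 \<ge> 1" using False by (simp add: freq_def \<zeta>_def)
    then obtain N where N: "N' = Suc N" using N' by (cases N') auto
    have fN: "1 \<le> ?f N" using not_less_Least[of N "\<lambda>N. ?f N < 1"] N unfolding N'_def by force
    have "?f N \<le> ?f N' * L ^ (4*b*N' - 4*b*N)" using N by (intro freq_earlier_le[OF s]) simp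
    also have "4*b*N' - 4*b*N = 4*b" using N by simp
    also have "?f N' * L ^ (4*b) \<le> 1 * R" unfolding R_def using N' L by (intro mult_right_mono) auto
    finally have fN': "?f N \<le> R" by simp
    have "cmod \<zeta> \<le> ?f N * L ^ (4*b*N - 0)"
      using freq_earlier_le[OF s, of 0 "4*b*N" \<omega> \<zeta>] by (simp add: freq_def)
    also have "\<dots> \<le> R * L ^ (4*b*N)" using fN' L R by (intro mult_mono) auto
    also have "\<dots> = R ^ Suc N" by (simp add: R_def power_mult)
    finally have 1: "cmod \<zeta> \<le> R ^ Suc N" .
    have 2: "cmod (fourier_transform ?\<eta> \<xi>) \<le> \<gamma> powr (\<kappa> * (real N - real N0))"
    proof (cases "N0 \<le> N")
      case True
      have "cmod (fourier_transform ?\<eta> \<xi>) \<le> \<gamma> powr (\<kappa> * N)"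
        by (rule block[OF True \<zeta>_def fN fN'])
      also have "\<dots> \<le> \<gamma> powr (\<kappa> * (real N - real N0))"
        using \<gamma> \<kappa> by (intro powr_mono') auto
      finally show ?thesis .
    next
      case False
      have "1 \<le> \<gamma> powr (\<kappa> * (real N - real N0))"
        using powr_mono'[of "\<kappa> * (real N - real N0)" 0 \<gamma>] \<gamma> \<kappa> False by (simp add: mult_nonneg_nonpos)
      then show ?thesis using le1[of \<xi>] by linarith
    qed
    show ?thesis using 1 2 unfolding \<zeta>_def by blast
  qed
  \<comment> \<open>\<open>R ^ Suc N\<close> bounds the frequency, so \<open>N\<close> is at least
    its logarithm to base \<open>R\<close> minus one; substituting this into
    \<open>\<gamma> powr (\<kappa> * N)\<close> gives the exponent.\<close>
  define \<sigma> where "\<sigma> = - \<kappa> * ln \<gamma> / ln R"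
  have \<sigma>: "0 < \<sigma>" unfolding \<sigma>_def using \<kappa> \<gamma> R by (intro divide_pos_pos) (auto simp: mult_pos_neg)
  have "cmod (fourier_transform ?\<eta> \<xi>) \<le> \<gamma> powr (- \<kappa> * (1 + real N0)) * cmod a powr (- \<sigma>) * cmod \<xi> powr (- \<sigma>)"
    if \<xi>: "1 \<le> cmod \<xi>" for \<xi>
  proof -
    obtain N where N: "cmod (a * cnj \<xi>) \<le> R ^ Suc N" "cmod (fourier_transform ?\<eta> \<xi>) \<le> \<gamma> powr (\<kappa> * (real N - real N0))"
      using scale by blast
    define x where "x = cmod (a * cnj \<xi>)"
    have x: "0 < x" "x = cmod a * cmod \<xi>" using a \<xi> by (auto simp: x_def norm_mult intro!: mult_pos_pos)
    have "ln x \<le> ln (R ^ Suc N)" using N(1) x R unfolding x_def[symmetric] by (subst ln_le_cancel_iff) auto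
    also have "\<dots> = (1 + real N) * ln R" using R by (subst ln_realpow) auto
    finally have "ln x / ln R - 1 \<le> real N" using R by (simp add: field_simps)
    then have "\<kappa> * (ln x / ln R - 1 - N0) \<le> \<kappa> * (real N - real N0)" using \<kappa> by (intro mult_left_mono) auto
    then have "\<gamma> powr (\<kappa> * (real N - real N0)) \<le> \<gamma> powr (\<kappa> * (ln x / ln R - 1 - N0))"
      using \<gamma> by (intro powr_mono') auto
    also have "\<kappa> * (ln x / ln R - 1 - N0) = - \<kappa> * (1 + real N0) + \<kappa> * (ln x / ln R)" by (simp add: algebra_simps)
    also have "\<gamma> powr \<dots> = \<gamma> powr (- \<kappa> * (1 + real N0)) * \<gamma> powr (\<kappa> * (ln x / ln R))" by (rule powr_add)
    also have "\<gamma> powr (\<kappa> * (ln x / ln R)) = x powr (- \<sigma>)"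
      using \<gamma> x(1) by (simp add: powr_def \<sigma>_def)
    also have "x powr (- \<sigma>) = cmod a powr (- \<sigma>) * cmod \<xi> powr (- \<sigma>)" unfolding x(2) by (simp add: powr_mult)
    finally show ?thesis using N(2) by (simp add: mult.assoc)
  qed
  then have "?\<eta> \<in> D2_sigma \<sigma>" unfolding D2_sigma_def by blast
  then show ?thesis unfolding D2_def using \<sigma> by blast
qed

end

section \<open>Few bad superblocks\<close>

lemma space_bernoulli_measure [simp]: "space (bernoulli_measure q) = UNIV"
  by (simp add: bernoulli_measure_def space_PiM)

lemma prob_space_bernoulli_measure: "prob_space (bernoulli_measure q)"
  unfolding bernoulli_measure_def by (intro prob_space_PiM prob_space_measure_pmf)

context
  fixes q :: "'i pmf" and i0 :: 'i and b :: nat and \<kappa> :: real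
  assumes b: "1 \<le> b" and \<kappa>: "0 < \<kappa>"
    and rate: "2 * ((1 - pmf q i0 ^ 4) ^ b) powr \<kappa> < 1"
begin

text \<open>A union bound over the at most \<open>2^N\<close> sets of more than
  \<open>\<kappa> * N\<close> superblocks, each failing with probability
  \<open>(1 - pmf q i0 ^ 4) ^ b\<close> independently of the others. The hypothesis
  \<open>rate\<close> makes the bound geometric, and Borel-Cantelli concludes.\<close>

lemma AE_few_bad:
  "AE \<omega> in bernoulli_measure q. \<forall>\<^sub>F N in sequentially.
     real (card {m. m < N \<and> \<not> (\<exists>k. m * b \<le> k \<and> k < Suc m * b \<and> (\<forall>j<4. \<omega> (4 * k + j) = i0))}) \<le> \<kappa> * N"
proof -
  let ?M = "bernoulli_measure q"
  interpret P: prob_space ?M by (rule prob_space_bernoulli_measure)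
  interpret C: product_prob_space "\<lambda>_::nat. measure_pmf q" UNIV
    by (simp add: product_prob_space_def product_prob_space_axioms_def product_sigma_finite_def
        prob_space_measure_pmf prob_space_imp_sigma_finite)
  \<comment> \<open>The event that quadruple \<open>k\<close> is not constantly \<open>i0\<close>.
    Quadruples use disjoint sets of letters, hence the independence.\<close>
  define D where "D k = {\<omega>. \<not> (\<forall>j<4. \<omega> (4 * k + j) = i0)}" for k :: nat
  let ?K = "\<lambda>k::nat. {4 * k..<4 * k + 4}"
  have ind: "P.indep_events D UNIV"
  proof -
    have "P.indep_vars (\<lambda>_. measure_pmf q) (\<lambda>n \<omega>. \<omega> n) UNIV"
      unfolding bernoulli_measure_def by (rule C.indep_vars_coordinates) simp
    then have "P.indep_vars (\<lambda>k. PiM (?K k) (\<lambda>_. measure_pmf q)) (\<lambda>k \<omega>. restrict (\<lambda>n. \<omega> n) (?K k)) UNIV"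
      by (rule P.indep_vars_restrict) (auto simp: disjoint_family_on_def)
    then have "P.indep_events (\<lambda>k. {\<omega> \<in> space ?M. \<not> (\<forall>j<4. restrict (\<lambda>n. \<omega> n) (?K k) (4 * k + j) = i0)}) UNIV"
    proof (rule P.indep_eventsI_indep_vars)
      fix k
      let ?N = "PiM (?K k) (\<lambda>_. measure_pmf q)"
      have "{x \<in> space ?N. x (4 * k + j) = i0} \<in> sets ?N" if "j < 4" for j
      proof -
        have "(\<lambda>x. x (4 * k + j)) \<in> measurable ?N (measure_pmf q)"
          using that by (intro measurable_component_singleton) auto
        from measurable_sets[OF this, of "{i0}"] show ?thesis
          by (simp add: vimage_def Int_def conj_commute)
      qed
      then have "{x \<in> space ?N. \<forall>j\<in>{..<4}. x (4 * k + j) = i0} \<in> sets ?N"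
        by (intro sets.sets_Collect_finite_All) auto
      then have "{x \<in> space ?N. \<not> (\<forall>j\<in>{..<4}. x (4 * k + j) = i0)} \<in> sets ?N"
        by (rule sets.sets_Collect_neg)
      then show "{x \<in> space ?N. \<not> (\<forall>j<4. x (4 * k + j) = i0)} \<in> sets ?N" by (simp add: Ball_def)
    qed
    moreover have "{\<omega> \<in> space ?M. \<not> (\<forall>j<4. restrict (\<lambda>n. \<omega> n) (?K k) (4 * k + j) = i0)} = D k" for k
      by (auto simp: D_def)
    ultimately show ?thesis by simp
  qed
  have D_sets: "D k \<in> sets ?M" for k using ind unfolding P.indep_events_def by auto
  have D_prob: "P.prob (D k) = 1 - pmf q i0 ^ 4" for k
  proof -
    have "emeasure ?M {x \<in> space ?M. \<forall>i\<in>?K k. x i \<in> {i0}} = (\<Prod>i\<in>?K k. emeasure (measure_pmf q) {i0})"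
      unfolding bernoulli_measure_def by (rule C.emeasure_PiM_Collect) auto
    also have "\<dots> = ennreal (pmf q i0 ^ 4)" by (simp add: emeasure_pmf_single ennreal_power)
    also have "{x \<in> space ?M. \<forall>i\<in>?K k. x i \<in> {i0}} = space ?M - D k"
    proof -
      have "(\<forall>i\<in>?K k. x i \<in> {i0}) \<longleftrightarrow> (\<forall>j<4. x (4 * k + j) = i0)" for x :: "nat \<Rightarrow> 'i"
      proof
        assume *: "\<forall>j<4. x (4 * k + j) = i0"
        show "\<forall>i\<in>?K k. x i \<in> {i0}"
        proof
          fix i assume "i \<in> ?K k"
          then have "i = 4 * k + (i - 4 * k)" "i - 4 * k < 4" by auto
          then show "x i \<in> {i0}" using * by (metis singletonI)
        qed
      qed auto
      then show ?thesis by (auto simp: D_def)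
    qed
    finally have "P.prob (space ?M - D k) = pmf q i0 ^ 4" by (simp add: measure_def)
    then show ?thesis using P.prob_compl[OF D_sets, of k] by simp
  qed
  have D_Int: "P.prob (\<Inter>k\<in>T. D k) = (1 - pmf q i0 ^ 4) ^ card T" if "finite T" "T \<noteq> {}" for T
    using ind that unfolding P.indep_events_def by (simp add: D_prob)
  define x where "x = (1 - pmf q i0 ^ 4) ^ b"
  have x: "0 \<le> x" "x \<le> 1"
    unfolding x_def by (auto intro!: zero_le_power power_le_one simp: pmf_le_1)
  define T where "T Q = (\<Union>m\<in>Q. {m * b..<Suc m * b})" for Q
  have T_card: "card (T Q) = b * card Q" if "finite Q" for Q
  proof -
    have "card (T Q) = (\<Sum>m\<in>Q. card {m * b..<Suc m * b})"
      unfolding T_def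
    proof (rule card_UN_disjoint)
      show "\<forall>i\<in>Q. \<forall>j\<in>Q. i \<noteq> j \<longrightarrow> {i * b..<Suc i * b} \<inter> {j * b..<Suc j * b} = {}"
      proof (intro ballI impI, rule ccontr)
        fix i j assume "i \<noteq> j" "{i * b..<Suc i * b} \<inter> {j * b..<Suc j * b} \<noteq> {}"
        then obtain y where "i * b \<le> y" "y < Suc i * b" "j * b \<le> y" "y < Suc j * b"
          by (metis (lifting) IntE atLeastLessThan_iff equals0I)
        then have "y div b = i" "y div b = j" by (auto intro!: div_nat_eqI simp: mult.commute)
        then show False using \<open>i \<noteq> j\<close> by simp
      qed
    qed (use that in auto)
    then show ?thesis by simp
  qed
  define \<Q> where "\<Q> N = {Q. Q \<subseteq> {..<N} \<and> \<kappa> * real N < card Q}" for N :: nat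
  have fin\<Q>: "finite (\<Q> N)" for N
    by (rule finite_subset[of _ "Pow {..<N}"]) (auto simp: \<Q>_def)
  have card\<Q>: "card (\<Q> N) \<le> 2^N" for N
    using card_mono[of "Pow {..<N}" "\<Q> N"] by (auto simp: \<Q>_def card_Pow)
  \<comment> \<open>If more than \<open>\<kappa> * N\<close> superblocks are bad, the set of all bad
    ones is itself a member of \<open>\<Q> N\<close>, and every quadruple in it fails.\<close>
  define E where "E N = (\<Union>Q\<in>\<Q> N. \<Inter>k\<in>T Q. D k)" for N
  have TQ: "finite Q" "finite (T Q)" "T Q \<noteq> {}" "0 < card Q" if "Q \<in> \<Q> N" for Q N
  proof -
    show "finite Q" using that finite_subset by (auto simp: \<Q>_def)
    then show "finite (T Q)" by (simp add: T_def)
    have "0 \<le> \<kappa> * N" using \<kappa> by simp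
    then have "0 < real (card Q)" using that unfolding \<Q>_def by simp
    then show "0 < card Q" by simp
    then have "0 < card (T Q)" using T_card[OF \<open>finite Q\<close>] b by simp
    then show "T Q \<noteq> {}" by auto
  qed
  have Int_sets: "(\<Inter>k\<in>T Q. D k) \<in> sets ?M" if "Q \<in> \<Q> N" for Q N
    using D_sets TQ[OF that] by (intro sets.finite_INT) auto
  have E_sets: "E N \<in> sets ?M" for N
    unfolding E_def using fin\<Q> Int_sets by (intro sets.finite_UN) auto
  have E_prob: "P.prob (E N) \<le> (2 * x powr \<kappa>) ^ N" for N
  proof -
    have "P.prob (E N) \<le> (\<Sum>Q\<in>\<Q> N. P.prob (\<Inter>k\<in>T Q. D k))"
      unfolding E_def using Int_sets by (intro P.finite_measure_subadditive_finite fin\<Q>) auto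
    also have "\<dots> \<le> (\<Sum>Q\<in>\<Q> N. x powr (\<kappa> * N))"
    proof (rule sum_mono)
      fix Q assume Q: "Q \<in> \<Q> N"
      have "P.prob (\<Inter>k\<in>T Q. D k) = x ^ card Q"
        using D_Int[OF TQ(2,3)[OF Q]] T_card[OF TQ(1)[OF Q]] by (simp add: x_def power_mult)
      also have "\<dots> \<le> x powr (\<kappa> * N)"
      \<comment> \<open>The case \<open>x = 0\<close> arises when \<open>i0\<close> has probability
        one; both sides are then 0, as \<open>Q\<close> is nonempty.\<close>
      proof (cases "x = 0")
        case False
        then have "x ^ card Q = x powr card Q" using x by (simp add: powr_realpow)
        also have "\<dots> \<le> x powr (\<kappa> * N)" using x False Q by (intro powr_mono') (auto simp: \<Q>_def)
        finally show ?thesis .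
      qed (use TQ(4)[OF Q] in \<open>simp add: zero_power\<close>)
      finally show "P.prob (\<Inter>k\<in>T Q. D k) \<le> x powr (\<kappa> * N)" .
    qed
    also have "\<dots> = card (\<Q> N) * x powr (\<kappa> * N)" by simp
    also have "\<dots> \<le> 2 ^ N * x powr (\<kappa> * N)"
      using card\<Q>[of N] by (intro mult_right_mono) (simp_all add: of_nat_le_numeral_power_cancel_iff)
    also have "x powr (\<kappa> * N) \<le> (x powr \<kappa>) ^ N"
    proof (cases "x = 0")
      case False
      then show ?thesis using x powr_realpow[of "x powr \<kappa>" N] by (simp add: powr_powr)
    qed simp
    finally show ?thesis by (simp add: power_mult_distrib mult_left_mono)
  qed
  have "summable (\<lambda>N. P.prob (E N))"
  proof (rule summable_comparison_test'[of "\<lambda>N. (2 * x powr \<kappa>) ^ N" 0])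
    show "summable (\<lambda>N. (2 * x powr \<kappa>) ^ N)" using rate by (intro summable_geometric) (simp add: x_def)
  qed (use E_prob in simp)
  then have "AE \<omega> in ?M. \<forall>\<^sub>F N in sequentially. \<omega> \<in> space ?M - E N"
    using E_sets by (intro borel_cantelli_AE1) (auto simp: P.emeasure_eq_measure)
  then show ?thesis
  proof eventually_elim
    case (elim \<omega>)
    then show ?case
    proof eventually_elim
      case (elim N)
      let ?Q = "{m. m < N \<and> \<not> (\<exists>k. m * b \<le> k \<and> k < Suc m * b \<and> (\<forall>j<4. \<omega> (4 * k + j) = i0))}"
      have "\<omega> \<in> (\<Inter>k\<in>T ?Q. D k)" by (auto simp: T_def D_def)
      then have "?Q \<notin> \<Q> N" using elim by (auto simp: E_def)
      then show ?case by (force simp: \<Q>_def)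
    qed
  qed
qed

end

section \<open>The exceptional set\<close>

text \<open>The derivative of the exponential has modulus below one on the left half plane. This
  carries covers from the logarithm \<open>s\<close> to the parameter itself without loss.\<close>

lemma dist_exp_le:
  assumes "Re s < 0" "Re s' < 0"
  shows "dist (exp s) (exp s') \<le> dist s s'"
proof -
  have "norm (exp s - exp s') \<le> 1 * norm (s - s')"
  proof (rule field_differentiable_bound[of "{z. Re z < 0}" exp exp])
    show "convex {z. Re z < 0}" by (rule convex_halfspace_Re_lt)
    show "(exp has_field_derivative exp z) (at z within {z. Re z < 0})" for z :: complex
      by (auto intro!: derivative_eq_intros)
  qed (use assms in auto)
  then show ?thesis by (simp add: dist_norm)
qed

text \<open>The power is real exactly when \<open>Im (\<beta> * Ln l)\<close> is an integer multiple
  of \<open>pi\<close>, so \<open>Ln l\<close> lies on one of countably many lines, inside the half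
  plane where the exponential is Lipschitz.\<close>

lemma hausdorff_null_real_power_curve:
  assumes \<beta>: "\<beta> \<noteq> 0" and s: "1 < s"
  shows "hausdorff_null s {l \<in> ball 0 1 - {0}. Im (l powr \<beta>) = 0}"
proof -
  define line where "line k x = (complex_of_real x + \<i> * of_real (pi * of_int k)) / \<beta>" for k :: int and x
  have lip: "dist (line k x) (line k y) \<le> 1 / cmod \<beta> * dist x y" for k x y
  proof -
    have "line k x - line k y = of_real (x - y) / \<beta>" by (simp add: line_def diff_divide_distrib add_divide_distrib)
    then show ?thesis by (simp add: dist_norm norm_divide del: of_real_diff)
  qed
  have "hausdorff_null s (\<Union>k. range (line k))"
    using s by (intro hausdorff_null_UN hausdorff_null_lipschitz_image[OF hausdorff_null_real_UNIV _ lip]) auto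
  then have "hausdorff_null s ((\<Union>k. range (line k)) \<inter> {z. Re z < 0})"
    by (rule hausdorff_null_subset) auto
  then have "hausdorff_null s (exp ` ((\<Union>k. range (line k)) \<inter> {z. Re z < 0}))"
    by (rule hausdorff_null_lipschitz_image[where L = 1]) (use s dist_exp_le in auto)
  then show ?thesis
  proof (rule hausdorff_null_subset, intro subsetI)
    fix l assume l: "l \<in> {l \<in> ball 0 1 - {0}. Im (l powr \<beta>) = 0}"
    then have "l \<noteq> 0" "cmod l < 1" by auto
    then have "sin (Im (\<beta> * Ln l)) = 0" using l by (simp add: powr_def Im_exp)
    then obtain k where k: "Im (\<beta> * Ln l) = of_int k * pi" by (auto simp: sin_zero_iff_int2)
    have "\<beta> * Ln l = of_real (Re (\<beta> * Ln l)) + \<i> * of_real (pi * of_int k)"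
      by (rule complex_eqI) (use k in auto)
    then have "Ln l = line k (Re (\<beta> * Ln l))" using \<beta> by (simp add: line_def field_simps)
    moreover have "Re (Ln l) < 0" using \<open>l \<noteq> 0\<close> \<open>cmod l < 1\<close> by simp
    moreover have "l = exp (Ln l)" using \<open>l \<noteq> 0\<close> by simp
    ultimately show "l \<in> exp ` ((\<Union>k. range (line k)) \<inter> {z. Re z < 0})" by blast
  qed
qed

lemma hausdorff_null_nonpos_Reals:
  assumes "1 < s" shows "hausdorff_null s (\<real>\<^sub>\<le>\<^sub>0 :: complex set)"
proof -
  have "hausdorff_null s (range complex_of_real)"
    by (rule hausdorff_null_lipschitz_image[OF hausdorff_null_real_UNIV[OF assms], where L = 1])
      (use assms in \<open>auto simp: dist_norm simp flip: of_real_diff\<close>)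
  then show ?thesis by (rule hausdorff_null_subset) (auto simp: nonpos_Reals_def)
qed

section \<open>Choice of the parameters and nullity of the limsup sets\<close>

context exponent_piece
begin

text \<open>Bernoulli's inequality absorbs the factor of \<open>H b\<close> that is linear in
  \<open>b\<close> into an exponential. Purely exponential growth is what permits
  \<open>\<kappa>\<close> to be chosen before \<open>b\<close>.\<close>

lemma W_growth:
  assumes "V \<noteq> {}"
  shows "\<exists>A Y. 1 \<le> A \<and> 1 \<le> Y \<and> (\<forall>b. W b \<le> A * Y ^ b)"
proof -
  obtain s where s: "s \<in> V" using assms by blast
  have K1: "1 \<le> K" using K_ge_1[OF s] .
  define A where "A = (4 * K * (1 + M) ^ 3) ^ 4"
  define Y where "Y = ((1 + M) * L) ^ 32"
  have M1: "1 \<le> (1 + M) ^ n" for n using M_nonneg by (intro one_le_power) auto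
  have "W b \<le> A * Y ^ b" for b
  proof -
    have "1 + real (8 * b + 3) * M \<le> (1 + M) ^ (8 * b + 3)"
      using M_nonneg Bernoulli_inequality[of M "8 * b + 3"] by linarith
    then have "H b \<le> K * (1 + M) ^ (8 * b + 3) * L ^ (8 * b)"
      unfolding H_def using K1 L by (intro mult_right_mono mult_left_mono) auto
    then have "2 * H b + 2 \<le> 4 * (K * (1 + M) ^ (8 * b + 3) * L ^ (8 * b))"
      using H_ge(2)[OF s, of b] by linarith
    also have "\<dots> = (4 * K * (1 + M) ^ 3) * ((1 + M) * L) ^ (8 * b)"
      by (simp add: power_add power_mult_distrib)
    finally have "W b \<le> ((4 * K * (1 + M) ^ 3) * ((1 + M) * L) ^ (8 * b)) ^ 4"
      unfolding W_def using H_ge(2)[OF s, of b] by (intro power_mono) auto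
    also have "\<dots> = A * Y ^ b"
      by (simp add: A_def Y_def power_mult_distrib flip: power_mult)
    finally show ?thesis .
  qed
  moreover have "1 \<le> A"
    unfolding A_def
  proof (intro one_le_power)
    have "1 * 1 \<le> 4 * K * (1 + M) ^ 3" using K1 M1[of 3] by (intro mult_mono) auto
    then show "1 \<le> 4 * K * (1 + M) ^ 3" by simp
  qed
  moreover have "1 \<le> Y"
    unfolding Y_def
  proof (intro one_le_power)
    have "1 * 1 \<le> (1 + M) * L" using M_nonneg L by (intro mult_mono) auto
    then show "1 \<le> (1 + M) * L" by simp
  qed
  ultimately show ?thesis by blast
qed

lemma exists_parameters:
  assumes V: "V \<noteq> {}" and \<rho>: "0 < \<rho>" "\<rho> \<le> (1::real)"
  shows "\<exists>b \<kappa>. 1 \<le> b \<and> 0 < \<kappa> \<and> 2 * ((1 - \<rho> ^ 4) ^ b) powr \<kappa> < 1 \<and> 2 * W b powr (4 * \<kappa>) * c ^ (4 * b) \<le> 1 / 2"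
proof -
  obtain A Y where AY: "1 \<le> A" "1 \<le> Y" "\<And>b. W b \<le> A * Y ^ b" using W_growth[OF V] by blast
  have W0: "0 \<le> W b" for b unfolding W_def by simp
  \<comment> \<open>Solves \<open>Y powr (4 * \<kappa>) \<le> 1 / c\<close>; the added one prevents
    division by zero when \<open>Y = 1\<close>.\<close>
  define \<kappa> where "\<kappa> = - ln c / (4 * (ln Y + 1))"
  have lnc: "ln c < 0" using c by simp
  have lnY: "0 \<le> ln Y" using AY(2) by simp
  have \<kappa>: "0 < \<kappa>" unfolding \<kappa>_def using lnc lnY by (intro divide_pos_pos) auto
  have Yc: "Y powr (4 * \<kappa>) \<le> 1 / c"
  proof -
    have "4 * \<kappa> * ln Y = - ln c * (ln Y / (ln Y + 1))" using lnY by (simp add: \<kappa>_def field_simps)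
    also have "\<dots> \<le> - ln c * 1" using lnc lnY by (intro mult_left_mono) auto
    finally have "exp (4 * \<kappa> * ln Y) \<le> exp (- ln c)" by simp
    then show ?thesis using AY(2) c by (simp add: powr_def exp_minus inverse_eq_divide)
  qed
  define x where "x = 1 - \<rho> ^ 4"
  have x: "0 \<le> x" "x < 1" unfolding x_def using \<rho> by (auto simp: power_le_one)
  have "x powr \<kappa> < 1" using x \<kappa> by (cases "x = 0") (auto simp: powr01_less_one)
  then have "(\<lambda>b. 2 * (x powr \<kappa>) ^ b) \<longlonglongrightarrow> 2 * 0"
    by (intro tendsto_intros LIMSEQ_power_zero) auto
  then have "eventually (\<lambda>b. 2 * (x powr \<kappa>) ^ b < 1) sequentially" by (rule order_tendstoD) simp
  moreover have "eventually (\<lambda>b. 2 * A powr (4 * \<kappa>) * c ^ b < 1/2) sequentially"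
  proof -
    have "(\<lambda>b. 2 * A powr (4 * \<kappa>) * c ^ b) \<longlonglongrightarrow> 2 * A powr (4 * \<kappa>) * 0"
      using c by (intro tendsto_intros LIMSEQ_power_zero) auto
    then show ?thesis by (rule order_tendstoD) simp
  qed
  ultimately have "eventually (\<lambda>b. 2 * (x powr \<kappa>) ^ b < 1 \<and> 2 * A powr (4 * \<kappa>) * c ^ b < 1/2 \<and> 1 \<le> b) sequentially"
    using eventually_ge_at_top[of 1] by eventually_elim auto
  then obtain b where b: "2 * (x powr \<kappa>) ^ b < 1" "2 * A powr (4 * \<kappa>) * c ^ b < 1/2" "1 \<le> b"
    unfolding eventually_sequentially by blast
  have 1: "2 * (x ^ b) powr \<kappa> < 1"
  proof (cases "x = 0")
    case True
    then show ?thesis using b(3) by (simp add: zero_power)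
  next
    case False
    then have "(x ^ b) powr \<kappa> = (x powr \<kappa>) ^ b"
      using x by (simp add: powr_realpow[symmetric] powr_powr mult.commute)
    then show ?thesis using b(1) by simp
  qed
  have "W b powr (4 * \<kappa>) \<le> (A * Y ^ b) powr (4 * \<kappa>)"
    using W0 AY(3) \<kappa> by (intro powr_mono2) auto
  also have "\<dots> = A powr (4 * \<kappa>) * (Y powr (4 * \<kappa>)) ^ b"
    using AY by (simp add: powr_mult powr_realpow[symmetric] powr_powr mult.commute)
  also have "\<dots> \<le> A powr (4 * \<kappa>) * (1 / c) ^ b"
    using Yc by (intro mult_left_mono power_mono) auto
  finally have "W b powr (4 * \<kappa>) * c ^ (4 * b) \<le> A powr (4 * \<kappa>) * (1 / c) ^ b * c ^ (4 * b)"
    using c by (intro mult_right_mono) auto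
  \<comment> \<open>Counting uses up one of the four factors \<open>c ^ b\<close>; what remains
    beats the constant and the factor 2 for large \<open>b\<close>.\<close>
  also have "\<dots> = A powr (4 * \<kappa>) * c ^ (3 * b)"
  proof -
    have "c ^ (4 * b) = c ^ b * c ^ (3 * b)" by (simp flip: power_add)
    then show ?thesis using c by (simp add: power_divide)
  qed
  also have "\<dots> \<le> A powr (4 * \<kappa>) * c ^ b" using c by (intro mult_left_mono power_decreasing) auto
  finally have 2: "2 * W b powr (4 * \<kappa>) * c ^ (4 * b) \<le> 1 / 2" using b(2) by simp
  show ?thesis using b(3) \<kappa> 1 2 unfolding x_def by blast
qed

text \<open>Frequencies, positions and goodness for the first \<open>N\<close> superblocks involve
  only letters before time \<open>4 * b * N\<close>.\<close>

lemma exceptional_prefix: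
  assumes b: "1 \<le> b" and eq: "\<And>j. j < 4 * b * N \<Longrightarrow> \<omega> j = \<omega>' j"
  shows "exceptional b \<epsilon> \<kappa> N \<omega> = exceptional b \<epsilon> \<kappa> N \<omega>'"
proof -
  have freq: "freq \<omega> s \<zeta> n = freq \<omega>' s \<zeta> n" if "n \<le> 4 * b * N" for s \<zeta> n
    unfolding freq_def using eq that by (intro arg_cong2[where f = "(*)"] arg_cong[where f = exp] sum.cong) auto
  have quad: "(m * b \<le> k \<and> k < Suc m * b \<and> (\<forall>j<4. \<omega> (4 * k + j) = i0)) \<longleftrightarrow>
      (m * b \<le> k \<and> k < Suc m * b \<and> (\<forall>j<4. \<omega>' (4 * k + j) = i0))" if m: "m < N" for m k
  proof (cases "k < Suc m * b")
    case True
    have "Suc m * b \<le> N * b" using m by (intro mult_le_mono1) simp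
    then have "\<omega> (4 * k + j) = \<omega>' (4 * k + j)" if "j < 4" for j
      using True that by (intro eq) (simp add: algebra_simps)
    then show ?thesis by simp
  qed simp
  have good: "good b \<omega> m = good b \<omega>' m" if "m < N" for m unfolding good_def quad[OF that] ..
  have pos: "pos b \<omega> m = pos b \<omega>' m" if "m < N" for m unfolding pos_def good[OF that] quad[OF that] ..
  have obs: "obs b \<omega> m = obs b \<omega>' m" if "m < N" for m
  proof -
    have "4 * b * Suc m \<le> 4 * b * N" using that by (intro mult_le_mono2) simp
    then have "pos b \<omega>' m \<le> 4 * b * N" using pos_bounds(2)[OF b, where m = m and \<omega> = \<omega>'] by linarith
    then show ?thesis unfolding obs_def pos[OF that] using freq by simp
  qed
  have "{m. m < N \<and> good b \<omega> m \<and> \<not> close b \<epsilon> \<omega> m p} = {m. m < N \<and> good b \<omega>' m \<and> \<not> close b \<epsilon> \<omega>' m p}" for p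
    using good obs by (auto simp: close_def)
  then show ?thesis unfolding exceptional_def using freq by simp
qed

text \<open>Number times diameter of the covering sets is a constant times the \<open>N\<close>-th
  power of the quantity bounded in \<open>rate\<close>, hence summable. Taking closures does not
  change diameters, so the closed sets needed for measurability cost nothing.\<close>

lemma exceptional_limsup_null:
  fixes \<kappa> :: real
  assumes b: "1 \<le> b" and rate: "2 * W b powr (4 * \<kappa>) * c ^ (4 * b) \<le> 1 / 2"
    and \<epsilon>: "\<epsilon> = 1 / (4 * (H b + 1))" and V: "V \<noteq> {}" "\<And>s. s \<in> V \<Longrightarrow> Re s < 0" and \<kappa>: "0 < \<kappa>"
    and bad: "\<forall>\<^sub>F N in sequentially. real (card {m. m < N \<and> \<not> good b \<omega> m}) \<le> \<kappa> * N"
    and s: "1 < s"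
  shows "hausdorff_null s (\<Inter>n. \<Union>N\<in>{n..}. closure (exp ` exceptional b \<epsilon> \<kappa> N \<omega>))"
proof -
  obtain n0 where n0: "\<And>N. n0 \<le> N \<Longrightarrow> real (card {m. m < N \<and> \<not> good b \<omega> m}) \<le> \<kappa> * N"
    using bad unfolding eventually_sequentially by blast
  obtain s0 where s0: "s0 \<in> V" using V(1) by blast
  have K1: "1 \<le> K" and W1: "1 \<le> W b" using K_ge_1[OF s0] W_ge_1[OF s0] by auto
  define r where "r N = K * c ^ (4 * b * (N - 1))" for N
  \<comment> \<open>Collects the two boundary losses: one extra branching \<open>W b\<close> at the
    start of a history, and one superblock of contraction missing in the exponent
    \<open>N - 1\<close>.\<close>
  define Z where "Z = W b * K / c ^ (4 * b)"
  have Z: "K \<le> Z"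
  proof -
    have "c ^ (4 * b) \<le> 1" using c by (simp add: power_le_one)
    then have "c ^ (4 * b) * K \<le> W b * K" using W1 K1 by (intro mult_right_mono) auto
    then show ?thesis using c by (simp add: Z_def pos_le_divide_eq mult.commute)
  qed
  have bound: "2^N * W b powr (1 + 4 * \<kappa> * N) * r N \<le> Z * (1/2) ^ N" if "1 \<le> N" for N
  proof -
    have "W b powr (1 + 4 * \<kappa> * N) = W b * (W b powr (4 * \<kappa>)) ^ N"
      using W1 by (simp add: powr_add powr_realpow[symmetric] powr_powr)
    moreover have "r N = K / c ^ (4 * b) * (c ^ (4 * b)) ^ N"
    proof -
      have "(c ^ (4 * b)) ^ N = c ^ (4 * b) * c ^ (4 * b * (N - 1))"
        using that by (cases N) (auto simp: power_mult)
      then show ?thesis using c by (simp add: r_def)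
    qed
    ultimately have "2^N * W b powr (1 + 4 * \<kappa> * N) * r N = Z * (2 * W b powr (4 * \<kappa>) * c ^ (4 * b)) ^ N"
      by (simp add: Z_def power_mult_distrib)
    also have "\<dots> \<le> Z * (1/2) ^ N"
      using rate c Z K1 by (intro mult_left_mono power_mono) auto
    finally show ?thesis .
  qed
  show ?thesis
  proof (rule hausdorff_null_limsup[where r = r and a = "\<lambda>N. Z * (1/2) ^ N" and ?n0.0 = "max 1 n0"])
    show "1 \<le> s" using s by simp
    show "0 \<le> r N" for N using K1 c by (simp add: r_def)
    show "summable (\<lambda>N. Z * (1 / 2) ^ N)" by (intro summable_mult summable_geometric) simp
    show "r N \<le> Z * (1 / 2) ^ N" for N
    proof (cases "N = 0")
      case True
      then show ?thesis using Z by (simp add: r_def)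
    next
      case False
      have "1 * 1 \<le> 2^N * W b powr (1 + 4 * \<kappa> * N)"
        using W1 \<kappa> by (intro mult_mono ge_one_powr_ge_zero) auto
      then have "1 * r N \<le> 2^N * W b powr (1 + 4 * \<kappa> * N) * r N"
        using K1 c by (intro mult_right_mono) (auto simp: r_def)
      then show ?thesis using bound[of N] False by simp
    qed
    fix N assume N: "max 1 n0 \<le> N"
    let ?E = "exceptional b \<epsilon> \<kappa> N \<omega>"
    from N have "1 \<le> N" "n0 \<le> N" by auto
    from exceptional_cover[OF b this(1) \<epsilon> n0[OF this(2)]] obtain \<F> where \<F>: "finite \<F>" "?E \<subseteq> \<Union>\<F>"
      "real (card \<F>) \<le> 2^N * W b powr (1 + 4 * \<kappa> * N)" "\<And>F x y. F \<in> \<F> \<Longrightarrow> x \<in> F \<Longrightarrow> y \<in> F \<Longrightarrow> dist x y \<le> r N"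
      unfolding r_def by blast
    \<comment> \<open>Intersecting with the exceptional set keeps the points in \<open>V\<close>,
      where the exponential is 1-Lipschitz.\<close>
    define \<G> where "\<G> = (\<lambda>F. closure (exp ` (F \<inter> ?E))) ` \<F>"
    have "exp ` ?E \<subseteq> \<Union>\<G>"
    proof
      fix z assume "z \<in> exp ` ?E"
      then obtain u F where "z = exp u" "u \<in> ?E" "F \<in> \<F>" "u \<in> F" using \<F>(2) by blast
      then have F: "F \<in> \<F>" and "z \<in> exp ` (F \<inter> ?E)" by auto
      then have "z \<in> closure (exp ` (F \<inter> ?E))" by (intro subsetD[OF closure_subset])
      then show "z \<in> \<Union>\<G>" unfolding \<G>_def by (intro UnionI[OF imageI[OF F]])
    qed
    moreover have "closed (\<Union>\<G>)" using \<F>(1) by (intro closed_Union) (auto simp: \<G>_def)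
    ultimately have "closure (exp ` ?E) \<subseteq> \<Union>\<G>" by (rule closure_minimal)
    moreover have "real (card \<G>) * r N \<le> Z * (1/2) ^ N"
    proof -
      have "real (card \<G>) \<le> 2^N * W b powr (1 + 4 * \<kappa> * N)"
        using card_image_le[OF \<F>(1), of "\<lambda>F. closure (exp ` (F \<inter> ?E))"] \<F>(3) unfolding \<G>_def by linarith
      then have "real (card \<G>) * r N \<le> 2^N * W b powr (1 + 4 * \<kappa> * N) * r N"
        using K1 c by (intro mult_right_mono) (auto simp: r_def)
      then show ?thesis using bound[OF \<open>1 \<le> N\<close>] by simp
    qed
    moreover have "dist x y \<le> r N" if G: "G \<in> \<G>" "x \<in> G" "y \<in> G" for G x y
    proof -
      obtain F where F: "F \<in> \<F>" "G = closure (exp ` (F \<inter> ?E))" using G(1) by (auto simp: \<G>_def)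
      have d: "dist x y \<le> r N" if xy: "x \<in> exp ` (F \<inter> ?E)" "y \<in> exp ` (F \<inter> ?E)" for x y
      proof -
        obtain u v where uv: "u \<in> F" "u \<in> ?E" "v \<in> F" "v \<in> ?E" "x = exp u" "y = exp v"
          using xy by blast
        have "Re u < 0" "Re v < 0" using uv V(2) unfolding exceptional_def by auto
        then show ?thesis using dist_exp_le[of u v] \<F>(4)[OF F(1) uv(1,3)] uv(5,6) by simp
      qed
      then have bdd: "bounded (exp ` (F \<inter> ?E))" unfolding bounded_two_points by blast
      have "dist x y \<le> diameter G"
        using G F(2) bdd by (intro diameter_bounded_bound) auto
      also have "\<dots> = diameter (exp ` (F \<inter> ?E))" unfolding F(2) by (rule diameter_closure[OF bdd])
      also have "\<dots> \<le> r N" using d K1 c by (intro diameter_leI) (auto simp: r_def)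
      finally show ?thesis .
    qed
    moreover have "finite \<G>" using \<F>(1) by (simp add: \<G>_def)
    ultimately show "\<exists>\<F>. finite \<F> \<and> closure (exp ` ?E) \<subseteq> \<Union>\<F> \<and> real (card \<F>) * r N \<le> Z * (1/2) ^ N \<and>
        (\<forall>F\<in>\<F>. \<forall>x\<in>F. \<forall>y\<in>F. dist x y \<le> r N)" by blast
  qed
qed

end

text \<open>All conditions are open at \<open>s0\<close>, so they hold with uniform constants on a
  small ball; only the inverse Lipschitz bound needs a quantitative inverse function
  argument.\<close>

lemma exists_exponent_piece:
  fixes \<beta> :: "'i::finite \<Rightarrow> complex"
  assumes \<beta>: "\<beta> i0 \<noteq> 0" and s0: "Re s0 < 0" "\<And>i. Re (\<beta> i * s0) < 0" "Im (exp (\<beta> i0 * s0)) \<noteq> 0"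
  shows "\<exists>V c L M \<delta> C. open V \<and> s0 \<in> V \<and> (\<forall>s\<in>V. Re s < 0) \<and> exponent_piece \<beta> i0 V c L M \<delta> C"
proof -
  define z0 where "z0 = exp (\<beta> i0 * s0)"
  define M where "M = Max (range (\<lambda>i. cmod (\<beta> i)))"
  define a where "a = Max (range (\<lambda>i. Re (\<beta> i * s0)))"
  \<comment> \<open>The added one makes the bound strict at \<open>s0\<close>, hence stable nearby;
    replacing the negative \<open>a\<close> by \<open>a / 2\<close> has the same effect for the
    contraction.\<close>
  define L0 where "L0 = Max (range (\<lambda>i. - Re (\<beta> i * s0))) + 1"
  \<comment> \<open>Within this distance of \<open>z0\<close> the imaginary part keeps its sign and
    a modulus of at least \<open>\<delta>\<close>, and the multiplier varies by at most
    \<open>cmod z0 / 2\<close>.\<close>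
  define \<delta> where "\<delta> = \<bar>Im z0\<bar> / 2"
  define C where "C = 2 / (cmod (\<beta> i0) * cmod z0)"
  have M: "cmod (\<beta> i) \<le> M" for i unfolding M_def by (rule Max_ge) auto
  have a: "Re (\<beta> i * s0) \<le> a" for i unfolding a_def by (rule Max_ge) auto
  have a0: "a < 0" unfolding a_def using s0(2) by (subst Max_less_iff) auto
  have L0: "- Re (\<beta> i * s0) \<le> L0 - 1" for i unfolding L0_def add_diff_cancel_right' by (rule Max_ge) auto
  have \<delta>0: "0 < \<delta>" using s0(3) by (simp add: \<delta>_def z0_def)
  have lim: "((\<lambda>s. Re (\<beta> i * s)) \<longlongrightarrow> Re (\<beta> i * s0)) (nhds s0)" for i
    by (intro tendsto_intros filterlim_ident)
  have "\<forall>\<^sub>F s in nhds s0. Re s < 0"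
    by (rule order_tendstoD(2)[OF _ s0(1)]) (intro tendsto_intros filterlim_ident)
  moreover have "\<forall>\<^sub>F s in nhds s0. \<forall>i. Re (\<beta> i * s) < a / 2"
    by (intro eventually_all_finite order_tendstoD(2)[OF lim]) (use a a0 in \<open>smt (verit) field_sum_of_halves\<close>)
  moreover have "\<forall>\<^sub>F s in nhds s0. \<forall>i. - L0 < Re (\<beta> i * s)"
    by (intro eventually_all_finite order_tendstoD(1)[OF lim]) (use L0 in \<open>smt (verit)\<close>)
  moreover have "\<forall>\<^sub>F s in nhds s0. dist (exp (\<beta> i0 * s)) z0 < \<delta>"
    unfolding z0_def by (rule tendstoD[OF _ \<delta>0]) (intro tendsto_intros filterlim_ident)
  ultimately have "\<forall>\<^sub>F s in nhds s0. Re s < 0 \<and> (\<forall>i. Re (\<beta> i * s) < a / 2) \<and> (\<forall>i. - L0 < Re (\<beta> i * s)) \<and>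
      dist (exp (\<beta> i0 * s)) z0 < \<delta>"
    by eventually_elim auto
  then obtain r where r: "0 < r" and V: "\<And>s. dist s s0 < r \<Longrightarrow> Re s < 0 \<and> (\<forall>i. Re (\<beta> i * s) < a / 2) \<and>
      (\<forall>i. - L0 < Re (\<beta> i * s)) \<and> dist (exp (\<beta> i0 * s)) z0 < \<delta>"
    unfolding eventually_nhds_metric by blast
  define V where "V = ball s0 r"
  have inV: "Re s < 0" "\<And>i. Re (\<beta> i * s) < a / 2" "\<And>i. - L0 < Re (\<beta> i * s)" "cmod (exp (\<beta> i0 * s) - z0) < \<delta>"
    if "s \<in> V" for s
    using V[of s] that by (auto simp: V_def dist_commute dist_norm[symmetric])
  have Im_near: "\<bar>Im (exp (\<beta> i0 * s)) - Im z0\<bar> < \<delta>" if "s \<in> V" for s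
    using inV(4)[OF that] abs_Im_le_cmod[of "exp (\<beta> i0 * s) - z0"] by simp
  have "exponent_piece \<beta> i0 V (exp (a / 2)) (exp L0) M \<delta> C"
  proof
    show "convex V" by (simp add: V_def)
    show "cmod (\<beta> i) \<le> M" for i by (rule M)
    show "exp (a / 2) < 1" using a0 by simp
    have "0 \<le> L0" using L0[of i0] s0(2)[of i0] by linarith
    then show "1 \<le> exp L0" by simp
    show "0 < C" unfolding C_def using \<beta> by (simp add: z0_def)
    show "0 < \<delta>" by fact
    show "cmod (exp (\<beta> i * s)) \<le> exp (a / 2)" if "s \<in> V" for i s
      unfolding norm_exp_eq_Re using inV(2)[OF that, of i] by simp
    show "cmod (exp (- \<beta> i * s)) \<le> exp L0" if "s \<in> V" for i s
      unfolding norm_exp_eq_Re using inV(3)[OF that, of i] by simp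
    show "\<delta> \<le> \<bar>Im (exp (\<beta> i0 * s))\<bar>" if "s \<in> V" for s
      using Im_near[OF that] unfolding \<delta>_def by linarith
    show "0 < Im (exp (\<beta> i0 * s)) * Im (exp (\<beta> i0 * s'))" if "s \<in> V" "s' \<in> V" for s s'
    proof (cases "0 < Im z0")
      case True
      then have "0 < Im (exp (\<beta> i0 * s))" "0 < Im (exp (\<beta> i0 * s'))"
        using Im_near[OF that(1)] Im_near[OF that(2)] unfolding \<delta>_def by linarith+
      then show ?thesis by (rule mult_pos_pos)
    next
      case False
      then have "Im (exp (\<beta> i0 * s)) < 0" "Im (exp (\<beta> i0 * s')) < 0"
        using Im_near[OF that(1)] Im_near[OF that(2)] unfolding \<delta>_def by linarith+
      then show ?thesis by (rule mult_neg_neg)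
    qed
    show "cmod (s - s') \<le> C * cmod (exp (\<beta> i0 * s) - exp (\<beta> i0 * s'))" if s: "s \<in> V" "s' \<in> V" for s s'
    proof -
      \<comment> \<open>After subtracting the linear part with slope \<open>z0 * \<beta> i0\<close>,
        the remainder has a Lipschitz constant at most half the slope, so the linear part
        dominates.\<close>
      define g where "g s = exp (\<beta> i0 * s) - z0 * \<beta> i0 * s" for s
      let ?B = "cmod (\<beta> i0) * cmod z0 / 2"
      have "cmod (g s - g s') \<le> ?B * cmod (s - s')"
      proof (rule field_differentiable_bound[OF _ _ _ s])
        fix z assume z: "z \<in> V"
        show "(g has_field_derivative (exp (\<beta> i0 * z) - z0) * \<beta> i0) (at z within V)"
          unfolding g_def by (auto intro!: derivative_eq_intros simp: algebra_simps)
        have "cmod (exp (\<beta> i0 * z) - z0) \<le> cmod z0 / 2"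
          using inV(4)[OF z] abs_Im_le_cmod[of z0] unfolding \<delta>_def by linarith
        then have "cmod (exp (\<beta> i0 * z) - z0) * cmod (\<beta> i0) \<le> cmod z0 / 2 * cmod (\<beta> i0)"
          by (rule mult_right_mono) simp
        then show "cmod ((exp (\<beta> i0 * z) - z0) * \<beta> i0) \<le> ?B"
          by (simp only: norm_mult) (simp only: mult.commute times_divide_eq_right)
      qed (simp add: V_def)
      moreover have "z0 * \<beta> i0 * (s - s') = (exp (\<beta> i0 * s) - exp (\<beta> i0 * s')) - (g s - g s')"
        by (simp add: g_def algebra_simps)
      then have "cmod (z0 * \<beta> i0 * (s - s')) \<le> cmod (exp (\<beta> i0 * s) - exp (\<beta> i0 * s')) + cmod (g s - g s')"
        by (metis norm_triangle_ineq4)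
      ultimately have "?B * cmod (s - s') \<le> cmod (exp (\<beta> i0 * s) - exp (\<beta> i0 * s'))"
        by (simp add: norm_mult mult.commute mult.left_commute)
      then show ?thesis using \<beta> by (simp add: C_def z0_def field_simps)
    qed
  qed simp
  then show ?thesis using r inV(1) unfolding V_def by (intro exI conjI) auto
qed

text \<open>Closedness and dependence on a finite prefix of \<open>\<omega>\<close> are what make the final set \<open>G\<close>
  measurable.\<close>

definition exceptional_family ::
  "('i \<Rightarrow> complex) \<Rightarrow> 'i pmf \<Rightarrow> 'i \<Rightarrow> complex \<Rightarrow> complex set \<Rightarrow>
   (nat \<Rightarrow> (nat \<Rightarrow> 'i) \<Rightarrow> complex set) \<Rightarrow> (nat \<Rightarrow> nat) \<Rightarrow> bool" where
  "exceptional_family \<beta> q i0 s0 V E R \<longleftrightarrow> open V \<and> s0 \<in> V \<and> (\<forall>N \<omega>. closed (E N \<omega>)) \<and>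
     (\<forall>N \<omega> \<omega>'. (\<forall>j<R N. \<omega> j = \<omega>' j) \<longrightarrow> E N \<omega> = E N \<omega>') \<and>
     (AE \<omega> in bernoulli_measure q. \<forall>s>1. hausdorff_null s (limsup (\<lambda>N. E N \<omega>))) \<and>
     (\<forall>\<omega> s k t p j1 j2. s \<in> V \<longrightarrow> exp s \<notin> limsup (\<lambda>N. E N \<omega>) \<longrightarrow>
        planar_model k t p (\<lambda>i. exp (\<beta> i * s)) \<longrightarrow>
        j1 < k i0 \<longrightarrow> j2 < k i0 \<longrightarrow> t i0 j1 \<noteq> t i0 j2 \<longrightarrow>
        eta k t p (\<lambda>i. exp (\<beta> i * s)) \<omega> \<in> D2)"

lemma exists_exceptional_family:
  fixes \<beta> :: "'i::finite \<Rightarrow> complex" and q :: "'i pmf"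
  assumes \<beta>: "\<beta> i0 \<noteq> 0" and q: "0 < pmf q i0"
    and s0: "Re s0 < 0" "\<And>i. Re (\<beta> i * s0) < 0" "Im (exp (\<beta> i0 * s0)) \<noteq> 0"
  shows "\<exists>V E R. exceptional_family \<beta> q i0 s0 V E R"
proof -
  obtain V c L M \<delta> C where V: "open V" "s0 \<in> V" "\<And>s. s \<in> V \<Longrightarrow> Re s < 0"
    and piece: "exponent_piece \<beta> i0 V c L M \<delta> C"
    using exists_exponent_piece[of \<beta> i0 s0, OF \<beta> s0] by blast
  interpret exponent_piece \<beta> i0 V c L M \<delta> C by fact
  have Vne: "V \<noteq> {}" using V(2) by blast
  obtain b and \<kappa> :: real where b: "1 \<le> b" and \<kappa>: "0 < \<kappa>" and rates: "2 * ((1 - pmf q i0 ^ 4) ^ b) powr \<kappa> < 1"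
    "2 * W b powr (4 * \<kappa>) * c ^ (4 * b) \<le> 1 / 2"
    using exists_parameters[OF Vne q pmf_le_1] by blast
  define \<epsilon> where "\<epsilon> = 1 / (4 * (H b + 1))"
  have "1 \<le> H b" using H_ge(2)[OF V(2)] .
  then have \<epsilon>: "0 < \<epsilon>" "\<epsilon> \<le> 1 / 2" unfolding \<epsilon>_def by (auto simp: field_simps)
  \<comment> \<open>Closures only enlarge the sets to be avoided, so avoiding them still yields
    decay.\<close>
  let ?E = "\<lambda>N \<omega>. closure (exp ` exceptional b \<epsilon> \<kappa> N \<omega>)"
  have prefix: "?E N \<omega> = ?E N \<omega>'" if "\<forall>j<4 * b * N. \<omega> j = \<omega>' j" for N \<omega> \<omega>'
    using exceptional_prefix[OF b, of N \<omega> \<omega>'] that by simp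
  have null: "AE \<omega> in bernoulli_measure q. \<forall>s>1. hausdorff_null s (limsup (\<lambda>N. ?E N \<omega>))"
    using AE_few_bad[OF b \<kappa> rates(1)]
  proof eventually_elim
    case (elim \<omega>)
    then have "\<forall>\<^sub>F N in sequentially. real (card {m. m < N \<and> \<not> good b \<omega> m}) \<le> \<kappa> * N"
      unfolding good_def .
    then show ?case
      using exceptional_limsup_null[OF b rates(2) \<epsilon>_def Vne V(3) \<kappa>] unfolding limsup_INF_SUP by blast
  qed
  have decay: "eta k t p (\<lambda>i. exp (\<beta> i * s)) \<omega> \<in> D2"
    if s: "s \<in> V" and notin: "exp s \<notin> limsup (\<lambda>N. ?E N \<omega>)"
      and m: "planar_model k t p (\<lambda>i. exp (\<beta> i * s))" "j1 < k i0" "j2 < k i0" "t i0 j1 \<noteq> t i0 j2"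
    for \<omega> s k t p j1 j2
  proof -
    have "\<exists>n. \<forall>N\<ge>n. exp s \<notin> ?E N \<omega>" using notin unfolding limsup_INF_SUP by (simp add: Ball_def)
    then obtain n where n: "\<And>N. n \<le> N \<Longrightarrow> exp s \<notin> ?E N \<omega>" by blast
    have "s \<notin> exceptional b \<epsilon> \<kappa> N \<omega>" if "n \<le> N" for N
    proof
      assume "s \<in> exceptional b \<epsilon> \<kappa> N \<omega>"
      then have "exp s \<in> ?E N \<omega>" by (intro subsetD[OF closure_subset] imageI)
      then show False using n[OF that] by simp
    qed
    from Fourier_decay[OF s b \<epsilon> \<kappa> this m] show ?thesis by blast
  qed
  have "exceptional_family \<beta> q i0 s0 V ?E (\<lambda>N. 4 * b * N)"
    unfolding exceptional_family_def
    by (intro conjI allI impI V(1,2) closed_closure null) (rule prefix, assumption, erule (5) decay)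
  then show ?thesis by blast
qed

section \<open>Measurability and the passage from local pieces to the disc\<close>

lemma sets_finite_prefix:
  fixes E :: "(nat \<Rightarrow> 'i::finite) \<Rightarrow> complex set"
  assumes closed: "\<And>\<omega>. closed (E \<omega>)"
    and prefix: "\<And>\<omega> \<omega>'. (\<And>j. j < R \<Longrightarrow> \<omega> j = \<omega>' j) \<Longrightarrow> E \<omega> = E \<omega>'"
  shows "{(\<omega>, l). l \<in> E \<omega>} \<in> sets (Omega_space \<Otimes>\<^sub>M borel)"
proof -
  let ?W = "{w :: 'i list. set w \<subseteq> UNIV \<and> length w = R}"
  let ?C = "\<lambda>w :: 'i list. {\<omega> \<in> space Omega_space. \<forall>j\<in>{..<R}. \<omega> j = w ! j}"
  \<comment> \<open>The alphabet is finite, so a prefix of length \<open>R\<close> takes finitely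
    many values, and over each cylinder the section is one fixed closed set.\<close>
  have "{(\<omega>, l). l \<in> E \<omega>} = (\<Union>w\<in>?W. ?C w \<times> E (\<lambda>j. w ! j))"
  proof (intro set_eqI iffI)
    fix x assume "x \<in> {(\<omega>, l). l \<in> E \<omega>}"
    then obtain \<omega> l where x: "x = (\<omega>, l)" "l \<in> E \<omega>" by auto
    let ?w = "map \<omega> [0..<R]"
    have "E \<omega> = E (\<lambda>j. ?w ! j)" by (rule prefix) simp
    then have "x \<in> ?C ?w \<times> E (\<lambda>j. ?w ! j)" using x by (auto simp: Omega_space_def space_PiM)
    moreover have "?w \<in> ?W" by simp
    ultimately show "x \<in> (\<Union>w\<in>?W. ?C w \<times> E (\<lambda>j. w ! j))" by blast
  next
    fix x assume "x \<in> (\<Union>w\<in>?W. ?C w \<times> E (\<lambda>j. w ! j))"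
    then obtain w \<omega> l where x: "x = (\<omega>, l)" "\<And>j. j < R \<Longrightarrow> \<omega> j = w ! j" "l \<in> E (\<lambda>j. w ! j)" by auto
    have "E \<omega> = E (\<lambda>j. w ! j)" by (rule prefix) (rule x(2))
    then show "x \<in> {(\<omega>, l). l \<in> E \<omega>}" using x by simp
  qed
  moreover have "?C w \<in> sets Omega_space" for w
  proof (rule sets.sets_Collect_finite_All)
    fix j
    have "(\<lambda>\<omega>. \<omega> j) \<in> measurable (Omega_space :: (nat \<Rightarrow> 'i) measure) (count_space UNIV)"
      unfolding Omega_space_def by (rule measurable_component_singleton) simp
    from measurable_sets[OF this, of "{w ! j}"] show "{\<omega> \<in> space Omega_space. \<omega> j = w ! j} \<in> sets Omega_space"
      by (simp add: vimage_def Int_def conj_commute)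
  qed simp
  moreover have "finite ?W" by (rule finite_lists_length_eq) simp
  ultimately show ?thesis using closed by (auto intro!: sets.finite_UN pair_measureI borel_closed)
qed

theorem theorem1p5:
  fixes \<beta> :: "'i::finite \<Rightarrow> complex" and q :: "'i pmf"
  assumes "\<forall>i. \<beta> i \<noteq> 0"
  shows "\<exists>G. G \<in> sets (Omega_space \<Otimes>\<^sub>M (borel :: complex measure)) \<and>
             G \<subseteq> UNIV \<times> ball 0 1 \<and>
             (AE \<omega> in bernoulli_measure q.
                hausdorff_dim {l \<in> ball 0 1 - {0}. (\<omega>, l) \<notin> G} \<le> 1) \<and>
             (\<forall>\<omega> l. (\<omega>, l) \<in> G \<longrightarrow>
                (\<forall>k t p. planar_model k t p (\<lambda>i. l powr \<beta> i) \<and>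
                         nondegenerate (bernoulli_measure q) k t \<longrightarrow>
                         eta k t p (\<lambda>i. l powr \<beta> i) \<omega> \<in> D2))"
proof -
  define U where "U i = {s. Re s < 0 \<and> (\<forall>j. Re (\<beta> j * s) < 0) \<and> Im (exp (\<beta> i * s)) \<noteq> 0}" for i
  \<comment> \<open>A letter of probability zero cannot witness nondegeneracy, and positive
    probability is what makes superblocks without four consecutive \<open>i0\<close> rare.\<close>
  define A where "A = {i. 0 < pmf q i}"
  have "\<exists>V E R. exceptional_family \<beta> q i s0 V E R" if "i \<in> A" "s0 \<in> U i" for i s0
    using exists_exceptional_family[of \<beta> i q s0] assms that by (simp add: A_def U_def)
  then obtain V E R where
    fam: "\<And>i s0. i \<in> A \<Longrightarrow> s0 \<in> U i \<Longrightarrow> exceptional_family \<beta> q i s0 (V i s0) (E i s0) (R i s0)"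
    by metis
  \<comment> \<open>The pieces are open and independent of \<open>\<omega>\<close>, so a countable
    subcover exists and the null sets of \<open>\<omega>\<close> attached to its members have a null
    union.\<close>
  have "\<exists>D. countable D \<and> D \<subseteq> U i \<and> U i \<subseteq> (\<Union>s0\<in>D. V i s0)" if i: "i \<in> A" for i
  proof -
    have "\<And>S. S \<in> V i ` U i \<Longrightarrow> open S" using fam[OF i] by (auto simp: exceptional_family_def)
    then obtain \<F> where \<F>: "\<F> \<subseteq> V i ` U i" "countable \<F>" "\<Union>\<F> = \<Union>(V i ` U i)" by (rule Lindelof)
    then obtain D where D: "countable D" "D \<subseteq> U i" "\<F> = V i ` D" using countable_subset_image by metis
    have "U i \<subseteq> \<Union>(V i ` U i)" using fam[OF i] by (auto simp: exceptional_family_def)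
    then have "U i \<subseteq> (\<Union>s0\<in>D. V i s0)" using \<F>(3) unfolding D(3) by simp
    then show ?thesis using D(1,2) by (intro exI[of _ D] conjI)
  qed
  then obtain D where D: "\<And>i. i \<in> A \<Longrightarrow> countable (D i)" "\<And>i. i \<in> A \<Longrightarrow> D i \<subseteq> U i"
    "\<And>i. i \<in> A \<Longrightarrow> U i \<subseteq> (\<Union>s0\<in>D i. V i s0)" by metis
  \<comment> \<open>Discarding the branch cut of the logarithm costs only dimension one and makes \<open>X0\<close> open.\<close>
  define X0 where "X0 = {l \<in> ball 0 1 - \<real>\<^sub>\<le>\<^sub>0. \<forall>i. Im (exp (\<beta> i * Ln l)) \<noteq> 0}"
  define G where "G = UNIV \<times> X0 - (\<Union>i\<in>A. \<Union>s0\<in>D i. {(\<omega>, l). l \<in> limsup (\<lambda>N. E i s0 N \<omega>)})"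
  have famD: "exceptional_family \<beta> q i s0 (V i s0) (E i s0) (R i s0)" if "i \<in> A" "s0 \<in> D i" for i s0
    using fam D(2) that by blast
  have "open X0"
  proof -
    have "X0 = (\<Inter>i. {l \<in> ball 0 1 - \<real>\<^sub>\<le>\<^sub>0. Im (exp (\<beta> i * Ln l)) \<in> - {0}})" by (auto simp: X0_def)
    moreover have "open {l \<in> ball 0 1 - \<real>\<^sub>\<le>\<^sub>0. Im (exp (\<beta> i * Ln l)) \<in> - {0}}" for i
    proof -
      have "continuous_on (ball 0 1 - \<real>\<^sub>\<le>\<^sub>0) (\<lambda>l. Im (exp (\<beta> i * Ln l)))"
        by (intro continuous_intros) auto
      then show ?thesis
        using continuous_open_preimage[of "ball 0 1 - \<real>\<^sub>\<le>\<^sub>0" "\<lambda>l. Im (exp (\<beta> i * Ln l))" "- {0}"]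
        by (simp add: vimage_def Int_def open_Diff open_Compl closed_nonpos_Reals_complex)
    qed
    ultimately show ?thesis by (simp add: open_INT)
  qed
  have limsup_sets: "{(\<omega>, l). l \<in> limsup (\<lambda>N. E i s0 N \<omega>)} \<in> sets (Omega_space \<Otimes>\<^sub>M borel)" if "i \<in> A" "s0 \<in> D i" for i s0
  proof -
    have "{(\<omega>, l). l \<in> limsup (\<lambda>N. E i s0 N \<omega>)} = (\<Inter>n. \<Union>N\<in>{n..}. {(\<omega>, l). l \<in> E i s0 N \<omega>})"
      by (auto simp: limsup_INF_SUP)
    moreover have "{(\<omega>, l). l \<in> E i s0 N \<omega>} \<in> sets (Omega_space \<Otimes>\<^sub>M borel)" for N
      using famD[OF that] by (intro sets_finite_prefix[where R = "R i s0 N"]) (auto simp: exceptional_family_def)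
    ultimately show ?thesis by auto
  qed
  have "finite A" by simp
  have "UNIV \<in> sets (Omega_space :: (nat \<Rightarrow> 'i) measure)"
    using sets.top[of "Omega_space :: (nat \<Rightarrow> 'i) measure"] by (simp add: Omega_space_def space_PiM)
  then have G_sets: "G \<in> sets (Omega_space \<Otimes>\<^sub>M borel)"
    unfolding G_def using \<open>open X0\<close> limsup_sets D(1) \<open>finite A\<close>
    by (intro sets.Diff pair_measureI sets.finite_UN sets.countable_UN'') auto
  have AE: "AE \<omega> in bernoulli_measure q. hausdorff_dim {l \<in> ball 0 1 - {0}. (\<omega>, l) \<notin> G} \<le> 1"
  proof -
    have "AE \<omega> in bernoulli_measure q. \<forall>i\<in>A. \<forall>s0\<in>D i. \<forall>s>1. hausdorff_null s (limsup (\<lambda>N. E i s0 N \<omega>))"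
      using famD D(1) \<open>finite A\<close> by (intro AE_ball_countable') (auto simp: exceptional_family_def countable_finite)
    then show ?thesis
    proof eventually_elim
      case (elim \<omega>)
      have "hausdorff_null s {l \<in> ball 0 1 - {0}. (\<omega>, l) \<notin> G}" if s: "1 < s" for s
      proof -
        \<comment> \<open>A parameter can be missing from \<open>G\<close> only because of the
          branch cut, a real power, or the limsup set of one of the chosen pieces.\<close>
        have "hausdorff_null s (\<real>\<^sub>\<le>\<^sub>0 \<union> ((\<Union>i. {l \<in> ball 0 1 - {0}. Im (l powr \<beta> i) = 0}) \<union>
            (\<Union>i\<in>A. \<Union>s0\<in>D i. limsup (\<lambda>N. E i s0 N \<omega>))))"
          using elim s assms D(1) \<open>finite A\<close>
          by (intro hausdorff_null_Un hausdorff_null_UN hausdorff_null_nonpos_Reals hausdorff_null_real_power_curve)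
            (auto simp: countable_finite)
        then show ?thesis
          by (rule hausdorff_null_subset) (auto simp: G_def X0_def powr_def)
      qed
      then show ?case unfolding one_ereal_def by (intro hausdorff_dim_le) simp_all
    qed
  qed
  have decay: "eta k t p (\<lambda>i. l powr \<beta> i) \<omega> \<in> D2" if lG: "(\<omega>, l) \<in> G" and
    model: "planar_model k t p (\<lambda>i. l powr \<beta> i)" and nd: "nondegenerate (bernoulli_measure q) k t" for \<omega> l k t p
  proof -
    have l: "cmod l < 1" "l \<noteq> 0" "\<And>i. Im (exp (\<beta> i * Ln l)) \<noteq> 0" using lG by (auto simp: G_def X0_def)
    define s where "s = Ln l"
    have powr: "(\<lambda>i. l powr \<beta> i) = (\<lambda>i. exp (\<beta> i * s))" using l(2) by (auto simp: powr_def s_def)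
    obtain i j1 j2 where i: "0 < measure (bernoulli_measure q) {\<omega> \<in> space (bernoulli_measure q). \<omega> 0 = i}"
      and j: "j1 < k i" "j2 < k i" "t i j1 \<noteq> t i j2"
      using nd unfolding nondegenerate_def by blast
    have "measure (bernoulli_measure q) {\<omega> \<in> space (bernoulli_measure q). \<omega> 0 = i} = pmf q i"
    proof -
      have "distr (bernoulli_measure q) (measure_pmf q) (\<lambda>\<omega>. \<omega> 0) = measure_pmf q"
        unfolding bernoulli_measure_def by (rule distr_PiM_component) (auto intro: prob_space_measure_pmf)
      then have "pmf q i = measure (distr (bernoulli_measure q) (measure_pmf q) (\<lambda>\<omega>. \<omega> 0)) {i}"
        by (simp add: measure_pmf_single)
      also have "\<dots> = measure (bernoulli_measure q) {\<omega> \<in> space (bernoulli_measure q). \<omega> 0 = i}"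
        unfolding bernoulli_measure_def
        by (subst measure_distr) (auto intro!: arg_cong2[where f = measure])
      finally show ?thesis by simp
    qed
    then have "i \<in> A" using i by (simp add: A_def)
    moreover have "s \<in> U i"
    proof -
      \<comment> \<open>Contraction is read off from the model and not imposed on \<open>X0\<close>:
        a parameter for which some power has modulus at least one admits no model.\<close>
      have "Re (\<beta> j * s) < 0" for j
      proof -
        have "cmod (exp (\<beta> j * s)) < 1" using model unfolding powr planar_model_def by blast
        then show ?thesis by (simp only: norm_exp_eq_Re exp_less_one_iff)
      qed
      moreover have "Re s < 0" using l(1,2) by (simp add: s_def)
      ultimately show ?thesis using l(3) by (simp add: U_def s_def)
    qed
    ultimately obtain s0 where s0: "s0 \<in> D i" "s \<in> V i s0" using D(3) by blast
    have "exp s = l" using l(2) by (simp add: s_def)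
    then have "exp s \<notin> limsup (\<lambda>N. E i s0 N \<omega>)" using lG \<open>i \<in> A\<close> s0(1) by (auto simp: G_def)
    then show ?thesis
      using famD[OF \<open>i \<in> A\<close> s0(1)] s0(2) model j unfolding powr exceptional_family_def by blast
  qed
  have "G \<subseteq> UNIV \<times> ball 0 1" by (auto simp: G_def X0_def)
  then show ?thesis using G_sets AE decay by blast
qed

end
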